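(* Let $d=2$. For $R>0$ and $a,b\in S^1$ let $$K_R(a,b)=\int_{S^1}\int_{S^1}Q_R(a+\theta+\vartheta)\,Q_R(b-\theta-\vartheta)\,d\sigma(\theta)\,d\sigma(\vartheta),\qquad Q_R(\xi)=\int_{B_R}e^{i\xi\cdot x}\,dx .$$ Then, as $R\to\infty$, $$I(R):=\int_{S^1}\int_{S^1}K_R(a,b)^2\,d\sigma(a)\,d\sigma(b)\ \sim\ \frac{256}{9}R^3 .$$
   Context: $S^1\subset\mathbb{R}^2$ is the unit circle, $\sigma$ is the uniform probability measure on $S^1$ (arc length divided by $2\pi$), and $B_R\subset\mathbb{R}^2$ is the disc of radius $R$ centered at the origin. The function $Q_R$ is real-valued and radial. The notation $\sim$ means that the ratio tends to $1$. *)

theory Defs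
  imports "HOL-Analysis.Analysis" "HOL-Probability.Probability" "HOL-Library.Landau_Symbols"
begin

(* Arc length divided by 2 * pi, as the image of the uniform distribution on [0, 2 * pi). *)
definition circle_measure :: "(real ^ 2) measure" where
  "circle_measure =
     distr (uniform_measure lborel {0..<2 * pi}) (restrict_space borel (sphere 0 1))
       (\<lambda>t. vector [cos t, sin t])"

(* The values are real (Q_disc_real below); the complex type only keeps the defining integral
   literal, so that the integrals built from it are complex-typed as well. *)
definition Q_disc :: "real \<Rightarrow> real ^ 2 \<Rightarrow> complex" where
  "Q_disc R \<xi> = (LINT x:ball 0 R|lborel. exp (\<i> * of_real (\<xi> \<bullet> x)))"

definition K_kernel :: "real \<Rightarrow> real ^ 2 \<Rightarrow> real ^ 2 \<Rightarrow> complex" where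
  "K_kernel R a b = (LINT \<phi>|circle_measure. LINT \<theta>|circle_measure.
     Q_disc R (a + \<theta> + \<phi>) * Q_disc R (b - \<theta> - \<phi>))"

definition I_moment :: "real \<Rightarrow> complex" where
  "I_moment R = (LINT b|circle_measure. LINT a|circle_measure. (K_kernel R a b)\<^sup>2)"

lemma vector_cos_sin_measurable:
  "(\<lambda>t. vector [cos t, sin t] :: real ^ 2) \<in> borel \<rightarrow>\<^sub>M restrict_space borel (sphere 0 1)"
proof (rule measurable_restrict_space2)
  show "(\<lambda>t. vector [cos t, sin t] :: real ^ 2) \<in> space borel \<rightarrow> sphere 0 1"
    by (auto simp: norm_vec_def L2_set_def UNIV_2 vector_2)
  have "continuous_on UNIV (\<lambda>t. vector [cos t, sin t] :: real ^ 2)"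
  proof -
    have "(\<lambda>t. vector [cos t, sin t] :: real ^ 2) = (\<lambda>t. \<chi> i. if i = 1 then cos t else sin t)"
      by (auto simp: vec_eq_iff forall_2 vector_2)
    moreover have "continuous_on UNIV (\<lambda>t. (\<chi> i. if i = 1 then cos t else sin t) :: real ^ 2)"
    proof (rule continuous_on_vec_lambda)
      fix i :: 2
      show "continuous_on UNIV (\<lambda>t::real. if i = 1 then cos t else sin t)"
        by (cases "i = 1") (auto intro!: continuous_intros)
    qed
    ultimately show ?thesis by (simp only:)
  qed
  then show "(\<lambda>t. vector [cos t, sin t] :: real ^ 2) \<in> borel \<rightarrow>\<^sub>M borel"
    by (rule borel_measurable_continuous_onI)
qed

lemma space_circle_measure: "space circle_measure = sphere 0 1"
  by (simp add: circle_measure_def space_restrict_space)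

lemma prob_space_circle_measure: "prob_space circle_measure"
  unfolding circle_measure_def
proof (rule prob_space.prob_space_distr)
  show "prob_space (uniform_measure lborel {0..<2 * pi})"
    by (rule prob_space_uniform_measure) auto
  show "(\<lambda>t. vector [cos t, sin t] :: real ^ 2)
      \<in> uniform_measure lborel {0..<2 * pi} \<rightarrow>\<^sub>M restrict_space borel (sphere 0 1)"
    using vector_cos_sin_measurable by (simp cong: measurable_cong_sets)
qed

lemma Q_disc_real: "Q_disc R \<xi> \<in> \<real>"
proof -
  have "cnj (Q_disc R \<xi>) = (LINT x:ball 0 R|lborel. exp (- \<i> * of_real (\<xi> \<bullet> x)))"
    unfolding Q_disc_def set_lebesgue_integral_def
    by (subst Bochner_Integration.integral_cnj[symmetric])
       (auto intro!: Bochner_Integration.integral_cong simp: exp_cnj)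
  also have "\<dots> = (LINT x|distr lborel borel uminus.
      indicator (ball 0 R) x *\<^sub>R exp (- \<i> * of_real (\<xi> \<bullet> x)))"
    using lborel_affine[of "-1" "0 :: real ^ 2"]
    by (simp add: set_lebesgue_integral_def density_1 flip: one_ennreal_def)
  also have "\<dots> = Q_disc R \<xi>"
    unfolding Q_disc_def set_lebesgue_integral_def
    by (subst integral_distr) (auto intro!: Bochner_Integration.integral_cong simp: indicator_def)
  finally show ?thesis
    by (simp add: Reals_cnj_iff)
qed

end

theory Submission
  imports Defs
begin

text \<open>
  The sum of two independent uniform points of the circle has the planar density
  1 / (pi^2 r sqrt (4 - r^2)), which is smooth near the unit circle and equals 1 / (pi^2 sqrt 3) on it.
  The product Q_R(a + x) Q_R(b - x) is concentrated near x = -a and x = b, so the density may be replaced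
  by its value on the unit circle; by Parseval the resulting planar convolution is 4 pi^2 Q_R(a + b), whence
  K_R(a, b) is close to 4 / sqrt 3 Q_R(a + b).  The decay |Q_R(x)| <= 20 sqrt R |x|^(-3/2) bounds the error by
  C R |a + b|^(-2/5), whose square integral over the torus is O(R^2).  The square integral of Q_R(a + b) is,
  after rescaling angles by R, asymptotic to R^3 / pi times the integral over the half line of disc_ft^2, where
  Q_R(x) = R^2 disc_ft (R |x|) and disc_ft is the Fourier transform of the semicircle density 2 sqrt (1 - x^2); Parseval
  evaluates that integral as 16 pi / 3, and 16/3 * 16/3 = 256/9.
\<close>

section \<open>Parseval by Gaussian regularisation\<close>

text \<open>For fixed a and b the comparison of the kernel with its main term says little: the error
  bound is of order R, while Q_R(a + b) is only O(sqrt R). It is effective in mean square, because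
  R^3 comes from |a + b| of order 1/R, where Q_R is of order R^2.

  Taking absolute values alone is not enough. The integral of |x + a|^(-3/2) |x - b|^(-3/2) over the
  plane is of order 1/|a + b|, whose square is not integrable on the torus. The gain comes from the
  difference of the densities: it vanishes to first order on the unit circle, where both singular
  points -a and b lie, and this one power lowers the exponent to 2/5. The sum of two circle points
  is parametrised by half the angle between them, which is uniform; so the singularity of the
  density at radius 2 never appears, and the constant 1 is compared with a multiple of sin (2
  alpha).

  Q_R is not absolutely integrable over the plane, only the product of two translates is. Hence
  Parseval is proved under that assumption, with damping, rather than by Fourier inversion.\<close>

definition gauss :: "'a::euclidean_space \<Rightarrow> real" where
  "gauss x = exp (- (norm x)\<^sup>2 / 2)"

lemma gauss_prod: "gauss x = (\<Prod>b\<in>Basis. exp (- (x \<bullet> b)\<^sup>2 / 2))"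
proof -
  have "(norm x)\<^sup>2 = (\<Sum>b\<in>Basis. (x \<bullet> b)\<^sup>2)"
    by (subst power2_norm_eq_inner, subst euclidean_inner) (simp add: power2_eq_square)
  then show ?thesis
    by (simp add: gauss_def sum_negf sum_divide_distrib exp_sum flip: exp_sum)
qed

lemma gauss_nonneg [simp]: "0 \<le> gauss x" and gauss_le_1 [simp]: "gauss x \<le> 1"
  and gauss_minus [simp]: "gauss (- x) = gauss x" and gauss_0 [simp]: "gauss 0 = 1"
  by (simp_all add: gauss_def)

lemma continuous_gauss: "continuous_on UNIV gauss"
  unfolding gauss_def by (intro continuous_intros) auto

lemma measurable_gauss [measurable]: "gauss \<in> borel_measurable borel"
  using continuous_gauss by (rule borel_measurable_continuous_onI)

text \<open>Up to the factor sqrt (2 pi) this is the characteristic function of the standard normal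
  distribution.\<close>

lemma gauss_fourier_1:
  fixes t :: real
  shows "integrable lborel (\<lambda>x::real. complex_of_real (exp (- x\<^sup>2 / 2)) * exp (\<i> * of_real (x * t)))" (is "integrable _ ?h")
    and "(LINT x|lborel. complex_of_real (exp (- x\<^sup>2 / 2)) * exp (\<i> * of_real (x * t)))
       = complex_of_real (sqrt (2 * pi) * exp (- t\<^sup>2 / 2))"
proof -
  have eq: "?h = (\<lambda>x. complex_of_real (sqrt (2 * pi)) * (std_normal_density x *\<^sub>R iexp (t * x)))"
    by (auto simp: std_normal_density_def scaleR_conv_of_real mult_ac)
  have i: "integrable lborel (\<lambda>x. std_normal_density x *\<^sub>R iexp (t * x))"
  proof (rule Bochner_Integration.integrable_bound[of _ std_normal_density])
    show "integrable lborel std_normal_density" by simp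
  qed (auto simp: cis_conv_exp[symmetric] norm_mult abs_mult)
  then show "integrable lborel ?h" unfolding eq by (rule integrable_mult_right)
  have "(LINT x|lborel. std_normal_density x *\<^sub>R iexp (t * x)) = char std_normal_distribution t"
    unfolding char_def by (subst integral_density) auto
  then show "integral\<^sup>L lborel ?h = complex_of_real (sqrt (2 * pi) * exp (- t\<^sup>2 / 2))"
    unfolding eq integral_mult_right_zero by (simp add: char_std_normal_distribution)
qed

text \<open>Both the Gaussian and the exponential factor over the coordinates, and
  \<open>lborel\<close> is the image of a product of one-dimensional Lebesgue measures.\<close>

lemma gauss_fourier:
  fixes w :: "'a::euclidean_space"
  shows "integrable lborel (\<lambda>x. complex_of_real (gauss x) * exp (\<i> * of_real (x \<bullet> w)))" (is ?A)
    and "(LINT x|lborel. complex_of_real (gauss x) * exp (\<i> * of_real (x \<bullet> w)))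
       = complex_of_real (sqrt (2 * pi) ^ DIM('a) * gauss w)" (is ?B)
proof -
  interpret product_sigma_finite "\<lambda>_::'a. lborel::real measure"
    by standard
  let ?h = "\<lambda>b x. complex_of_real (exp (- x\<^sup>2 / 2)) * exp (\<i> * of_real (x * (w \<bullet> b)))"
  let ?f = "\<lambda>x::'a. complex_of_real (gauss x) * exp (\<i> * of_real (x \<bullet> w))"
  have eq: "?f (\<Sum>b\<in>Basis. g b *\<^sub>R b) = (\<Prod>b\<in>Basis. ?h b (g b))" for g :: "'a \<Rightarrow> real"
  proof -
    have "(\<Sum>b\<in>Basis. g b *\<^sub>R b) \<bullet> w = (\<Sum>b\<in>Basis. g b * (w \<bullet> b))"
      by (subst inner_commute) (simp add: inner_sum_right)
    then show ?thesis
      by (simp add: gauss_prod prod.distrib exp_sum sum_distrib_left)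
  qed
  have m: "?f \<in> borel_measurable borel" by measurable
  have mm: "(\<lambda>g. \<Sum>b\<in>Basis. g b *\<^sub>R b) \<in> (\<Pi>\<^sub>M b\<in>Basis. lborel) \<rightarrow>\<^sub>M (borel :: 'a measure)"
    by measurable
  show ?A
    by (subst lborel_eq, subst integrable_distr_eq[OF mm m], unfold eq)
       (intro product_integrable_prod gauss_fourier_1 finite_Basis)
  have "integral\<^sup>L lborel ?f = (\<Prod>b\<in>Basis. integral\<^sup>L lborel (?h b))"
    by (subst lborel_eq, subst integral_distr[OF mm m], unfold eq)
       (intro product_integral_prod gauss_fourier_1 finite_Basis)
  also have "\<dots> = (\<Prod>b\<in>(Basis::'a set). complex_of_real (sqrt (2 * pi) * exp (- (w \<bullet> b)\<^sup>2 / 2)))"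
    by (simp only: gauss_fourier_1)
  finally show ?B by (simp add: gauss_prod prod.distrib)
qed

lemma integrable_gauss: "integrable lborel (gauss :: 'a::euclidean_space \<Rightarrow> real)"
  and integral_gauss: "(LINT x|lborel. gauss (x::'a)) = sqrt (2 * pi) ^ DIM('a)"
proof -
  have 1: "integrable lborel (\<lambda>x::'a. complex_of_real (gauss x))"
    using gauss_fourier(1)[of "0::'a"] by simp
  then show "integrable lborel (gauss :: 'a \<Rightarrow> real)"
    by (simp add: complex_of_real_integrable_eq)
  show "(LINT x|lborel. gauss (x::'a)) = sqrt (2 * pi) ^ DIM('a)"
    using gauss_fourier(2)[of "0::'a"] by (simp flip: of_real_power of_real_mult)
qed

lemma lborel_affine_integral:
  fixes f :: "'a::euclidean_space \<Rightarrow> 'b::{banach, second_countable_topology}"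
  assumes c: "c > 0" and f [measurable]: "f \<in> borel_measurable borel"
  shows "(LINT x|lborel. f x) = c ^ DIM('a) *\<^sub>R (LINT x|lborel. f (t + c *\<^sub>R x))"
    and "integrable lborel f \<longleftrightarrow> integrable lborel (\<lambda>x. f (t + c *\<^sub>R x))"
proof -
  have *: "lborel = density (distr lborel borel (\<lambda>x::'a. t + c *\<^sub>R x)) (\<lambda>_. ennreal (c ^ DIM('a)))"
    using lborel_affine[of c t] c by simp
  show "(LINT x|lborel. f x) = c ^ DIM('a) *\<^sub>R (LINT x|lborel. f (t + c *\<^sub>R x))"
    using c by (subst *) (simp add: integral_density integral_distr)
  show "integrable lborel f \<longleftrightarrow> integrable lborel (\<lambda>x. f (t + c *\<^sub>R x))"
  proof -
    have "integrable lborel f \<longleftrightarrow> integrable lborel (\<lambda>x. c ^ DIM('a) *\<^sub>R f (t + c *\<^sub>R x))"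
      using c by (subst *) (simp add: integrable_density integrable_distr_eq)
    also have "\<dots> \<longleftrightarrow> integrable lborel (\<lambda>x. f (t + c *\<^sub>R x))"
      using c integrable_scaleR_right[of "inverse (c ^ DIM('a))" lborel "\<lambda>x. c ^ DIM('a) *\<^sub>R f (t + c *\<^sub>R x)"]
      by auto
    finally show ?thesis .
  qed
qed

text \<open>Both sides are the same double integral, dominated by the product of the norms of u and
  f. The parameter s lets one statement serve both signs of the exponent.\<close>

lemma fourier_swap:
  fixes u f :: "'a::euclidean_space \<Rightarrow> complex" and s :: real
  assumes u: "integrable lborel u" and f: "integrable lborel f"
  shows "(LINT y|lborel. u y * (LINT x|lborel. f x * exp (\<i> * of_real (s * (y \<bullet> x)))))
       = (LINT x|lborel. f x * (LINT y|lborel. u y * exp (\<i> * of_real (s * (y \<bullet> x)))))"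
proof -
  have [measurable]: "u \<in> borel_measurable borel" "f \<in> borel_measurable borel"
    using u f by auto
  have 1: "integrable (lborel \<Otimes>\<^sub>M lborel) (\<lambda>(y, x). u y * (f x * exp (\<i> * of_real (s * (y \<bullet> x)))))"
  proof (rule Bochner_Integration.integrable_bound[where f="\<lambda>(y, x). u y * f x"])
    show "integrable (lborel \<Otimes>\<^sub>M lborel) (\<lambda>(y, x). u y * f x)"
      using u f by (auto intro!: lborel_pair.Fubini_integrable simp: norm_mult)
  qed (auto simp: norm_mult)
  have "(LINT y|lborel. u y * (LINT x|lborel. f x * exp (\<i> * of_real (s * (y \<bullet> x)))))
      = (LINT y|lborel. (LINT x|lborel. u y * (f x * exp (\<i> * of_real (s * (y \<bullet> x))))))"
    by simp
  also have "\<dots> = (LINT x|lborel. (LINT y|lborel. u y * (f x * exp (\<i> * of_real (s * (y \<bullet> x))))))"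
    using lborel_pair.Fubini_integral[OF 1] by simp
  also have "\<dots> = (LINT x|lborel. (LINT y|lborel. f x * (u y * exp (\<i> * of_real (s * (y \<bullet> x))))))"
    by (simp add: mult_ac)
  finally show ?thesis by simp
qed

lemma fourier_bounded:
  fixes f :: "'a::euclidean_space \<Rightarrow> complex" and s :: real
  shows "norm (LINT x|lborel. f x * exp (\<i> * of_real (s * (y \<bullet> x)))) \<le> (LINT x|lborel. norm (f x))"
  by (rule order_trans[OF integral_norm_bound]) (simp add: norm_mult)

lemma measurable_fourier:
  fixes f :: "'a::euclidean_space \<Rightarrow> complex" and s :: real
  assumes [measurable]: "f \<in> borel_measurable borel"
  shows "(\<lambda>y. LINT x|lborel. f x * exp (\<i> * of_real (s * (y \<bullet> x)))) \<in> borel_measurable borel"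
  by measurable

text \<open>Only the product F G is assumed integrable. A factor
  \<open>gauss (e *\<^sub>R y)\<close> makes every exchange of integrals legitimate; it reappears on
  the other side as a Gaussian average of g at scale e, and e tends to 0. Since F and G carry
  opposite signs in the exponent, the limit is the integral of f g without a conjugate. Continuity
  almost everywhere, instead of everywhere, admits the indicator of a disc.\<close>

lemma parseval:
  fixes f g :: "'a::euclidean_space \<Rightarrow> complex"
  defines "F \<equiv> \<lambda>y. LINT x|lborel. f x * exp (\<i> * of_real (y \<bullet> x))"
    and "G \<equiv> \<lambda>y. LINT x|lborel. g x * exp (- \<i> * of_real (y \<bullet> x))"
  assumes f: "integrable lborel f" and g: "integrable lborel g"
    and B: "\<And>x. norm (g x) \<le> B" and cont: "AE x in lborel. isCont g x"
    and FG: "integrable lborel (\<lambda>y. F y * G y)"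
  shows "(LINT y|lborel. F y * G y) = (2 * pi) ^ DIM('a) * (LINT x|lborel. f x * g x)"
proof -
  define c where "c = sqrt (2 * pi) ^ DIM('a)"
  have [measurable]: "f \<in> borel_measurable borel" "g \<in> borel_measurable borel"
    using f g by auto
  have [measurable]: "F \<in> borel_measurable borel" "G \<in> borel_measurable borel"
    using measurable_fourier[of f 1] measurable_fourier[of g "-1"] by (simp_all add: F_def G_def)
  have Gb: "norm (G y) \<le> (LINT x|lborel. norm (g x))" for y
    using fourier_bounded[of g "-1" y] by (simp add: G_def)
  have B0: "0 \<le> B" using B[of 0] by (meson norm_ge_zero order_trans)
  \<comment> \<open>The unnormalised Gaussian average of g around x: its limit for e to 0 is c * g x
    at every continuity point, c being the total mass of the Gaussian.\<close>
  define S where "S e x = (LINT z|lborel. g (x + e *\<^sub>R z) * of_real (gauss z))" for e x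
  have S_meas [measurable]: "S e \<in> borel_measurable borel" for e
    unfolding S_def by measurable
  have S_bound: "norm (S e x) \<le> B * c" for e x
  proof -
    have "norm (S e x) \<le> (LINT z|lborel. norm (g (x + e *\<^sub>R z) * of_real (gauss z)))"
      unfolding S_def by (rule integral_norm_bound)
    also have "\<dots> \<le> (LINT z|lborel. B * gauss (z::'a))"
    proof (rule integral_mono_AE')
      show "integrable lborel (\<lambda>z::'a. B * gauss z)"
        by (simp add: integrable_gauss)
    qed (auto simp: norm_mult B0 intro!: mult_right_mono B)
    finally show ?thesis by (simp add: integral_gauss c_def)
  qed
  have key: "(LINT y|lborel. gauss (e *\<^sub>R y) *\<^sub>R (F y * G y)) = c * (LINT x|lborel. f x * S e x)"
    if e: "e > 0" for e :: real
  proof -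
    have ig: "integrable lborel (\<lambda>y::'a. gauss (e *\<^sub>R y))"
      using lborel_affine_integral(2)[OF e, of "gauss :: 'a \<Rightarrow> real" 0] by (simp add: integrable_gauss)
    have iu: "integrable lborel (\<lambda>y. gauss (e *\<^sub>R y) *\<^sub>R G y)"
    proof (rule Bochner_Integration.integrable_bound)
      show "integrable lborel (\<lambda>y::'a. gauss (e *\<^sub>R y) * (LINT x|lborel. norm (g x)))"
        using ig by simp
      show "AE y in lborel. norm (gauss (e *\<^sub>R y) *\<^sub>R G y) \<le> norm (gauss (e *\<^sub>R y) * (LINT x|lborel. norm (g x)))"
        using Gb by (auto simp: abs_mult intro!: AE_I2 mult_left_mono order_trans[OF Gb])
    qed measurable
    have iv: "integrable lborel (\<lambda>y. gauss (e *\<^sub>R y) *\<^sub>R exp (\<i> * of_real (y \<bullet> x)))" for x :: 'a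
      by (rule Bochner_Integration.integrable_bound[OF ig]) (auto simp: )
    \<comment> \<open>Unfolding G and exchanging the integrals once more turns the damped inverse
      transform of G into this average of g.\<close>
    have inner: "(LINT y|lborel. (gauss (e *\<^sub>R y) *\<^sub>R G y) * exp (\<i> * of_real (y \<bullet> x))) = c * S e x" for x
    proof -
      have "(LINT y|lborel. (gauss (e *\<^sub>R y) *\<^sub>R G y) * exp (\<i> * of_real (y \<bullet> x)))
          = (LINT y|lborel. (gauss (e *\<^sub>R y) *\<^sub>R exp (\<i> * of_real (y \<bullet> x))) *
                (LINT z|lborel. g z * exp (\<i> * of_real ((-1) * (y \<bullet> z)))))"
        by (simp add: G_def mult_ac)
      also have "\<dots> = (LINT z|lborel. g z * (LINT y|lborel. (gauss (e *\<^sub>R y) *\<^sub>R exp (\<i> * of_real (y \<bullet> x))) *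
                exp (\<i> * of_real ((-1) * (y \<bullet> z)))))"
        by (rule fourier_swap[OF iv g])
      also have "\<dots> = (LINT z|lborel. g z * (LINT y|lborel. gauss (e *\<^sub>R y) *\<^sub>R exp (\<i> * of_real (y \<bullet> (x - z)))))"
        by (simp add: inner_diff_right algebra_simps flip: exp_add)
      \<comment> \<open>Substituting z by x + e z produces a factor e^n, which the substitution of y
        by y / e consumes; no power of e survives.\<close>
      also have "\<dots> = e ^ DIM('a) *\<^sub>R (LINT z|lborel. g (x + e *\<^sub>R z) * (LINT y|lborel. gauss (e *\<^sub>R y) *\<^sub>R exp (\<i> * of_real (y \<bullet> (x - (x + e *\<^sub>R z))))))"
        by (rule lborel_affine_integral(1)[OF e]) measurable
      also have "\<dots> = e ^ DIM('a) *\<^sub>R (LINT z|lborel. g (x + e *\<^sub>R z) * (LINT y|lborel. gauss (0 + e *\<^sub>R y) *\<^sub>R exp (\<i> * of_real ((0 + e *\<^sub>R y) \<bullet> (- z)))))"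
        by simp
      also have "\<dots> = (LINT z|lborel. g (x + e *\<^sub>R z) * (e ^ DIM('a) *\<^sub>R (LINT y|lborel. gauss (0 + e *\<^sub>R y) *\<^sub>R exp (\<i> * of_real ((0 + e *\<^sub>R y) \<bullet> (- z))))))"
        by simp
      also have "\<dots> = (LINT z|lborel. g (x + e *\<^sub>R z) * (LINT y|lborel. gauss y *\<^sub>R exp (\<i> * of_real (y \<bullet> (- z)))))"
        by (subst lborel_affine_integral(1)[OF e, of "\<lambda>y. gauss y *\<^sub>R exp (\<i> * of_real (y \<bullet> _))" 0, symmetric]) auto
      also have "\<dots> = (LINT z|lborel. g (x + e *\<^sub>R z) * of_real (c * gauss z))"
        unfolding scaleR_conv_of_real gauss_fourier(2) c_def by simp
      also have "\<dots> = (LINT z|lborel. c * (g (x + e *\<^sub>R z) * of_real (gauss z)))"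
        by (simp add: mult_ac)
      finally show ?thesis by (simp add: S_def)
    qed
    have "(LINT y|lborel. gauss (e *\<^sub>R y) *\<^sub>R (F y * G y)) =
        (LINT y|lborel. (gauss (e *\<^sub>R y) *\<^sub>R G y) * (LINT x|lborel. f x * exp (\<i> * of_real (1 * (y \<bullet> x)))))"
      by (simp add: F_def mult_ac)
    also have "\<dots> = (LINT x|lborel. f x * (LINT y|lborel. (gauss (e *\<^sub>R y) *\<^sub>R G y) * exp (\<i> * of_real (1 * (y \<bullet> x)))))"
      by (rule fourier_swap[OF iu f])
    also have "\<dots> = (LINT x|lborel. f x * (c * S e x))"
      by (simp only: mult_1 inner)
    also have "\<dots> = (LINT x|lborel. c * (f x * S e x))"
      by (simp only: mult.left_commute)
    finally show ?thesis by simp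
  qed
  define e where "e n = 1 / real (Suc n)" for n
  have e: "e n > 0" for n by (simp add: e_def)
  have e0: "e \<longlonglongrightarrow> 0" unfolding e_def by (rule LIMSEQ_Suc[OF lim_1_over_n])
  have "(\<lambda>n. LINT y|lborel. gauss (e n *\<^sub>R y) *\<^sub>R (F y * G y)) \<longlonglongrightarrow> (LINT y|lborel. F y * G y)"
  proof (rule integral_dominated_convergence)
    show "integrable lborel (\<lambda>y. norm (F y * G y))" using FG by (rule integrable_norm)
    show "AE y in lborel. (\<lambda>n. gauss (e n *\<^sub>R y) *\<^sub>R (F y * G y)) \<longlonglongrightarrow> F y * G y"
    proof (rule AE_I2)
      fix y :: 'a
      have "isCont gauss (0 *\<^sub>R y)"
        using continuous_gauss by (rule continuous_on_interior) simp
      moreover have "(\<lambda>n. e n *\<^sub>R y) \<longlonglongrightarrow> 0 *\<^sub>R y" by (intro tendsto_intros e0)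
      ultimately have "(\<lambda>n. gauss (e n *\<^sub>R y)) \<longlonglongrightarrow> gauss (0 *\<^sub>R y)"
        by (rule isCont_tendsto_compose)
      then have "(\<lambda>n. gauss (e n *\<^sub>R y) *\<^sub>R (F y * G y)) \<longlonglongrightarrow> gauss (0 *\<^sub>R y) *\<^sub>R (F y * G y)"
        by (rule tendsto_scaleR[OF _ tendsto_const])
      then show "(\<lambda>n. gauss (e n *\<^sub>R y) *\<^sub>R (F y * G y)) \<longlonglongrightarrow> F y * G y"
        by (simp only: scaleR_zero_left gauss_0 scaleR_one)
    qed
    show "AE y in lborel. norm (gauss (e n *\<^sub>R y) *\<^sub>R (F y * G y)) \<le> norm (F y * G y)" for n
      by (auto intro!: mult_left_le_one_le)
  qed measurable
  moreover have "(\<lambda>n. LINT x|lborel. f x * S (e n) x) \<longlonglongrightarrow> (LINT x|lborel. f x * (c * g x))"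
  proof (rule integral_dominated_convergence)
    show "integrable lborel (\<lambda>x. norm (f x) * (B * c))" using f by simp
    show "AE x in lborel. norm (f x * S (e n) x) \<le> norm (f x) * (B * c)" for n
      using S_bound by (auto simp: norm_mult intro!: mult_left_mono)
    show "AE x in lborel. (\<lambda>n. f x * S (e n) x) \<longlonglongrightarrow> f x * (c * g x)"
      using cont
    proof eventually_elim
      fix x assume x: "isCont g x"
      have "(\<lambda>n. S (e n) x) \<longlonglongrightarrow> (LINT z|lborel. g x * of_real (gauss (z::'a)))"
        unfolding S_def
      proof (rule integral_dominated_convergence)
        show "integrable lborel (\<lambda>z::'a. B * gauss z)"
          by (simp add: integrable_gauss)
        show "AE z in lborel. norm (g (x + e n *\<^sub>R z) * of_real (gauss z)) \<le> B * gauss z" for n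
          by (auto simp: norm_mult intro!: mult_right_mono B)
        show "AE z in lborel. (\<lambda>n. g (x + e n *\<^sub>R z) * of_real (gauss z)) \<longlonglongrightarrow> g x * of_real (gauss z)"
        proof (intro AE_I2 tendsto_mult_right)
          fix z
          have "(\<lambda>n. x + e n *\<^sub>R z) \<longlonglongrightarrow> x + 0 *\<^sub>R z" by (intro tendsto_intros e0)
          then show "(\<lambda>n. g (x + e n *\<^sub>R z)) \<longlonglongrightarrow> g x"
            using isCont_tendsto_compose[OF x] by simp
        qed
      qed measurable
      also have "(LINT z|lborel. g x * of_real (gauss (z::'a))) = c * g x"
        by (simp add: integral_gauss c_def)
      finally show "(\<lambda>n. f x * S (e n) x) \<longlonglongrightarrow> f x * (c * g x)"
        by (rule tendsto_mult_left)
    qed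
  qed measurable
  then have "(\<lambda>n. c * (LINT x|lborel. f x * S (e n) x)) \<longlonglongrightarrow> c * (LINT x|lborel. f x * (c * g x))"
    by (rule tendsto_mult_left)
  ultimately have "(LINT y|lborel. F y * G y) = c * (LINT x|lborel. f x * (c * g x))"
    unfolding key[OF e] by (rule LIMSEQ_unique)
  \<comment> \<open>One factor c comes from the transform of the Gaussian, the other from its total
    mass.\<close>
  also have "\<dots> = c * (c * (LINT x|lborel. f x * g x))"
    by (subst mult.left_commute[of "f _"]) simp
  also have "\<dots> = (2 * pi) ^ DIM('a) * (LINT x|lborel. f x * g x)"
  proof -
    have "c * c = (2 * pi) ^ DIM('a)" by (simp only: c_def power_mult_distrib[symmetric]) simp
    then have "complex_of_real c * complex_of_real c = (2 * complex_of_real pi) ^ DIM('a)"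
      by (metis of_real_mult of_real_power of_real_numeral)
    then show ?thesis by (simp add: mult.assoc[symmetric])
  qed
  finally show ?thesis .
qed

section \<open>Integration over the circle and the plane\<close>

definition circ :: "real \<Rightarrow> real ^ 2" where
  "circ t = vector [cos t, sin t]"

definition angle_measure :: "real measure" where
  "angle_measure = uniform_measure lborel {0..<2 * pi}"

lemma circ_nth [simp]: "circ t $ 1 = cos t" "circ t $ 2 = sin t"
  by (simp_all add: circ_def vector_2)

lemma norm_real_2: "norm (x :: real ^ 2) = sqrt ((x $ 1)\<^sup>2 + (x $ 2)\<^sup>2)"
  by (simp add: norm_vec_def L2_set_def sum_2)

lemma norm_circ [simp]: "norm (circ t) = 1"
  by (simp add: norm_real_2)

lemma circ_measurable_restrict: "circ \<in> borel \<rightarrow>\<^sub>M restrict_space borel (sphere 0 1)"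
  using vector_cos_sin_measurable by (simp add: circ_def[abs_def])

lemma circ_measurable [measurable]: "circ \<in> borel \<rightarrow>\<^sub>M borel"
  using circ_measurable_restrict by (simp add: measurable_restrict_space2_iff)

lemma angle_measure_sets [simp, measurable_cong]: "sets angle_measure = sets borel"
  by (simp add: angle_measure_def)

lemma angle_measure_space [simp]: "space angle_measure = UNIV"
  by (simp add: angle_measure_def)

lemma prob_space_ang: "prob_space angle_measure"
  unfolding angle_measure_def by (rule prob_space_uniform_measure) auto

lemma circle_measure_eq: "circle_measure = distr angle_measure (restrict_space borel (sphere 0 1)) circ"
  by (simp add: circle_measure_def angle_measure_def circ_def[abs_def])

text \<open>The restricted sigma-algebra on the sphere is dealt with here; afterwards all circle
  integrals are integrals over angles, with plain Borel measurability.\<close>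

lemma integral_circle_measure:
  fixes g :: "real ^ 2 \<Rightarrow> 'b::{banach, second_countable_topology}"
  assumes [measurable]: "g \<in> borel_measurable borel"
  shows "(LINT x|circle_measure. g x) = (LINT t|angle_measure. g (circ t))"
  unfolding circle_measure_eq
proof (rule integral_distr)
  show "circ \<in> angle_measure \<rightarrow>\<^sub>M restrict_space borel (sphere 0 1)"
    using circ_measurable_restrict by (simp cong: measurable_cong_sets)
  show "g \<in> borel_measurable (restrict_space borel (sphere 0 1))"
    by (rule measurable_restrict_space1) fact
qed

lemma nn_integral_ang:
  assumes [measurable]: "f \<in> borel_measurable borel"
  shows "(\<integral>\<^sup>+ t. f t \<partial>angle_measure) = (\<integral>\<^sup>+ t. f t * indicator {0..<2 * pi} t \<partial>lborel) / ennreal (2 * pi)"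
  unfolding angle_measure_def by (subst nn_integral_uniform_measure) auto

lemma integral_ang:
  fixes f :: "real \<Rightarrow> real"
  assumes [measurable]: "f \<in> borel_measurable borel"
  shows "(LINT t|angle_measure. f t) = (LINT t:{0..<2 * pi}|lborel. f t) / (2 * pi)"
proof -
  have d: "angle_measure = density lborel (\<lambda>t. ennreal (indicator {0..<2 * pi} t / (2 * pi)))"
    unfolding angle_measure_def uniform_measure_def
    by (intro density_cong) (auto simp: divide_ennreal[symmetric] ennreal_indicator split: split_indicator)
  have "(LINT t|angle_measure. f t) = (LINT t|lborel. (indicator {0..<2 * pi} t / (2 * pi)) *\<^sub>R f t)"
    unfolding d by (rule integral_density) auto
  also have "\<dots> = (LINT t|lborel. (indicator {0..<2 * pi} t * f t) / (2 * pi))"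
    by (simp only: real_scaleR_def times_divide_eq_left)
  also have "\<dots> = (LINT t|lborel. (indicator {0..<2 * pi} t * f t)) / (2 * pi)"
    by (rule integral_divide_zero)
  finally show ?thesis
    by (simp add: set_lebesgue_integral_def)
qed

text \<open>The shifted window [c, 2 pi + c) is cut at 2 pi, and periodicity moves its right part
  back to [0, c). For nonnegative functions this needs no integrability.\<close>

lemma nn_integral_ang_shift:
  fixes f :: "real \<Rightarrow> ennreal"
  assumes [measurable]: "f \<in> borel_measurable borel"
    and per: "\<And>x. f (x + 2 * pi) = f x" and c: "\<bar>c\<bar> < 2 * pi"
  shows "(\<integral>\<^sup>+ t. f (t + c) \<partial>angle_measure) = (\<integral>\<^sup>+ t. f t \<partial>angle_measure)"
proof -
  have *: "(\<integral>\<^sup>+ t. f (t + c) \<partial>angle_measure) = (\<integral>\<^sup>+ t. f t \<partial>angle_measure)"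
    if [measurable]: "f \<in> borel_measurable borel"
      and per: "\<And>x. f (x + 2 * pi) = f x" and c: "0 \<le> c" "c < 2 * pi" for f :: "real \<Rightarrow> ennreal" and c
  proof -
    have "(\<integral>\<^sup>+ t. f (t + c) * indicator {0..<2 * pi} t \<partial>lborel) =
        (\<integral>\<^sup>+ t. f (c + 1 * t) * indicator {c..<2 * pi + c} (c + 1 * t) \<partial>lborel)"
      by (intro nn_integral_cong) (auto simp: add_ac split: split_indicator)
    also have "\<dots> = (\<integral>\<^sup>+ t. f t * indicator {c..<2 * pi + c} t \<partial>lborel)"
      by (subst (2) nn_integral_real_affine[of _ 1 c]) auto
    also have "\<dots> = (\<integral>\<^sup>+ t. f t * indicator {c..<2 * pi} t + f t * indicator {2 * pi..<2 * pi + c} t \<partial>lborel)"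
      using c by (intro nn_integral_cong) (auto split: split_indicator)
    also have "\<dots> = (\<integral>\<^sup>+ t. f t * indicator {c..<2 * pi} t \<partial>lborel) + (\<integral>\<^sup>+ t. f t * indicator {2 * pi..<2 * pi + c} t \<partial>lborel)"
      by (rule nn_integral_add) auto
    also have "(\<integral>\<^sup>+ t. f t * indicator {2 * pi..<2 * pi + c} t \<partial>lborel) =
        (\<integral>\<^sup>+ t. f (2 * pi + 1 * t) * indicator {2 * pi..<2 * pi + c} (2 * pi + 1 * t) \<partial>lborel)"
      by (subst nn_integral_real_affine[of _ 1 "2 * pi"]) auto
    also have "\<dots> = (\<integral>\<^sup>+ t. f t * indicator {0..<c} t \<partial>lborel)"
      using per by (intro nn_integral_cong) (auto simp: add_ac split: split_indicator)
    also have "(\<integral>\<^sup>+ t. f t * indicator {c..<2 * pi} t \<partial>lborel) + (\<integral>\<^sup>+ t. f t * indicator {0..<c} t \<partial>lborel)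
        = (\<integral>\<^sup>+ t. f t * indicator {c..<2 * pi} t + f t * indicator {0..<c} t \<partial>lborel)"
      by (rule nn_integral_add[symmetric]) auto
    also have "\<dots> = (\<integral>\<^sup>+ t. f t * indicator {0..<2 * pi} t \<partial>lborel)"
      using c by (intro nn_integral_cong) (auto split: split_indicator)
    finally show ?thesis by (simp add: nn_integral_ang)
  qed
  show ?thesis
  proof (cases "0 \<le> c")
    case True
    then show ?thesis using *[of f c] per c by simp
  next
    case False
    \<comment> \<open>A negative shift is undone: the case already proved is applied to the
      translated function with the shift - c.\<close>
    have "f (t + c + 2 * pi) = f (t + c)" for t using per[of "t + c"] by simp
    then show ?thesis using *[of "\<lambda>t. f (t + c)" "- c"] False c by (simp add: algebra_simps)
  qed
qed

lemma circ_periodic: "circ (t + 2 * pi) = circ t"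
  by (simp add: circ_def)

lemma distr_circ_shift:
  assumes c: "\<bar>c\<bar> < 2 * pi"
  shows "distr angle_measure borel (\<lambda>t. circ (t + c)) = distr angle_measure borel circ"
proof (rule measure_eqI)
  fix A assume "A \<in> sets (distr angle_measure borel (\<lambda>t. circ (t + c)))"
  then have A [measurable]: "A \<in> sets borel" by simp
  have "emeasure (distr angle_measure borel (\<lambda>t. circ (t + c))) A = (\<integral>\<^sup>+ x. indicator A x \<partial>distr angle_measure borel (\<lambda>t. circ (t + c)))"
    by simp
  also have "\<dots> = (\<integral>\<^sup>+ t. indicator A (circ (t + c)) \<partial>angle_measure)"
    by (rule nn_integral_distr) auto
  also have "\<dots> = (\<integral>\<^sup>+ t. indicator A (circ t) \<partial>angle_measure)"
    by (rule nn_integral_ang_shift) (use c in \<open>auto simp: circ_periodic\<close>)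
  also have "\<dots> = (\<integral>\<^sup>+ x. indicator A x \<partial>distr angle_measure borel circ)"
    by (rule nn_integral_distr[symmetric]) auto
  finally show "emeasure (distr angle_measure borel (\<lambda>t. circ (t + c))) A = emeasure (distr angle_measure borel circ) A"
    by simp
qed simp

lemma unit_circ: 
  assumes "norm (w :: real ^ 2) = 1"
  obtains s where "0 \<le> s" "s < 2 * pi" "w = circ s"
proof -
  have "(w $ 1)\<^sup>2 + (w $ 2)\<^sup>2 = 1" using assms by (simp add: norm_real_2)
  from sincos_total_2pi[OF this] obtain t where "0 \<le> t" "t < 2 * pi" "w $ 1 = cos t" "w $ 2 = sin t"
    by metis
  then show ?thesis using that[of t] by (simp add: vec_eq_iff forall_2)
qed

lemma circ_add: "circ (s + t) = vector [cos t * cos s - sin t * sin s, cos t * sin s + sin t * cos s]"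
  by (simp add: vec_eq_iff forall_2 vector_2 cos_add sin_add mult.commute)

text \<open>By the addition formulas \<open>circ (t + c)\<close> depends on c only through
  \<open>circ c\<close>, so c may be reduced to [0, 2 pi). Working with equal image measures gives
  the identity for Bochner integrals whether or not g is integrable.\<close>

lemma integral_circ_shift:
  fixes g :: "real ^ 2 \<Rightarrow> 'b::{banach, second_countable_topology}"
  assumes [measurable]: "g \<in> borel_measurable borel"
  shows "(LINT t|angle_measure. g (circ (t + c))) = (LINT t|angle_measure. g (circ t))"
proof -
  obtain d where d: "0 \<le> d" "d < 2 * pi" "circ c = circ d" using unit_circ[of "circ c"] by auto
  then have "cos c = cos d" "sin c = sin d" by (metis circ_nth)+
  then have "(LINT t|angle_measure. g (circ (t + c))) = (LINT t|angle_measure. g (circ (t + d)))"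
    by (simp add: circ_add)
  also have "\<dots> = (LINT x|distr angle_measure borel (\<lambda>t. circ (t + d)). g x)"
    by (rule integral_distr[symmetric]) auto
  also have "\<dots> = (LINT x|distr angle_measure borel circ. g x)"
    using d by (simp add: distr_circ_shift)
  also have "\<dots> = (LINT t|angle_measure. g (circ t))"
    by (rule integral_distr) auto
  finally show ?thesis .
qed

lemma norm_circ_diff: "norm (circ s - circ t) = 2 * \<bar>sin ((t - s) / 2)\<bar>"
proof -
  have "(cos s - cos t)\<^sup>2 + (sin s - sin t)\<^sup>2 = (2 * sin ((t - s) / 2))\<^sup>2"
  proof -
    have "(cos s - cos t)\<^sup>2 + (sin s - sin t)\<^sup>2 = 2 - 2 * cos (t - s)"
      unfolding cos_diff power2_eq_square
      using sin_cos_squared_add[of s] sin_cos_squared_add[of t] by (simp add: power2_eq_square algebra_simps)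
    also have "cos (t - s) = 1 - 2 * (sin ((t - s) / 2))\<^sup>2"
    proof -
      have "2 * ((t - s) / 2) = t - s" by simp
      with cos_double_sin[of "(t - s) / 2"] show ?thesis by (simp only:)
    qed
    finally show ?thesis by (simp add: power_mult_distrib)
  qed
  then show ?thesis
    by (simp add: norm_real_2 vector_minus_component real_sqrt_mult)
qed

text \<open>Rotation invariance moves w to angle 0, where the chord to angle t has length 2 |sin (t
  / 2)|. The reflection of t to 2 pi - t folds the second half of the circle onto the first, which
  turns the normalisation 2 pi into pi.\<close>

lemma nn_integral_chord:
  assumes w: "norm (w :: real ^ 2) = 1" and [measurable]: "f \<in> borel_measurable borel"
  shows "(\<integral>\<^sup>+ t. f (norm (w - circ t)) \<partial>angle_measure) = (\<integral>\<^sup>+ t. f (2 * sin (t / 2)) * indicator {0..pi} t \<partial>lborel) / ennreal pi"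
proof -
  obtain s where s: "0 \<le> s" "s < 2 * pi" "w = circ s" using unit_circ[OF w] .
  have pi2: "x < 2 * pi" if "x \<le> pi" for x using that pi_gt_zero by linarith
  have "(\<integral>\<^sup>+ t. f (norm (w - circ t)) \<partial>angle_measure) = (\<integral>\<^sup>+ t. f (norm (w - circ (t + s))) \<partial>angle_measure)"
    by (rule nn_integral_ang_shift[symmetric]) (use s in \<open>auto simp: circ_periodic\<close>)
  also have "\<dots> = (\<integral>\<^sup>+ t. f (2 * \<bar>sin (t / 2)\<bar>) \<partial>angle_measure)"
    by (simp add: s norm_circ_diff)
  also have "\<dots> = (\<integral>\<^sup>+ t. f (2 * \<bar>sin (t / 2)\<bar>) * indicator {0..<2 * pi} t \<partial>lborel) / ennreal (2 * pi)"
    by (rule nn_integral_ang) auto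
  also have "(\<integral>\<^sup>+ t. f (2 * \<bar>sin (t / 2)\<bar>) * indicator {0..<2 * pi} t \<partial>lborel) =
      (\<integral>\<^sup>+ t. f (2 * sin (t / 2)) * indicator {0..pi} t + f (2 * sin (t / 2)) * indicator {pi<..<2 * pi} t \<partial>lborel)"
  proof (intro nn_integral_cong)
    fix t :: real
    have "f (2 * \<bar>sin (t / 2)\<bar>) = f (2 * sin (t / 2))" if "0 \<le> t" "t < 2 * pi"
      using that sin_ge_zero[of "t / 2"] by simp
    then show "f (2 * \<bar>sin (t / 2)\<bar>) * indicator {0..<2 * pi} t =
        f (2 * sin (t / 2)) * indicator {0..pi} t + f (2 * sin (t / 2)) * indicator {pi<..<2 * pi} t"
      using pi2[of t] by (cases "0 \<le> t"; cases "t \<le> pi"; cases "t < 2 * pi") (auto simp: indicator_def)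
  qed
  also have "\<dots> = (\<integral>\<^sup>+ t. f (2 * sin (t / 2)) * indicator {0..pi} t \<partial>lborel) +
      (\<integral>\<^sup>+ t. f (2 * sin (t / 2)) * indicator {pi<..<2 * pi} t \<partial>lborel)"
    by (rule nn_integral_add) auto
  also have "(\<integral>\<^sup>+ t. f (2 * sin (t / 2)) * indicator {pi<..<2 * pi} t \<partial>lborel) =
      (\<integral>\<^sup>+ t. f (2 * sin ((2 * pi + (-1) * t) / 2)) * indicator {pi<..<2 * pi} (2 * pi + (-1) * t) \<partial>lborel)"
    by (subst nn_integral_real_affine[of _ "-1" "2 * pi"]) auto
  also have "\<dots> = (\<integral>\<^sup>+ t. f (2 * sin (t / 2)) * indicator {0<..<pi} t \<partial>lborel)"
  proof (intro nn_integral_cong)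
    fix t :: real
    have "sin ((2 * pi + (-1) * t) / 2) = sin (t / 2)"
      using sin_pi_minus[of "t / 2"] by (simp add: diff_divide_distrib)
    then show "f (2 * sin ((2 * pi + (-1) * t) / 2)) * indicator {pi<..<2 * pi} (2 * pi + (-1) * t) =
        f (2 * sin (t / 2)) * indicator {0<..<pi} t"
      by (auto split: split_indicator)
  qed
  also have "\<dots> = (\<integral>\<^sup>+ t. f (2 * sin (t / 2)) * indicator {0..pi} t \<partial>lborel)"
  proof (rule nn_integral_cong_AE)
    have "AE t in lborel. t \<noteq> 0 \<and> t \<noteq> pi"
      using AE_lborel_singleton[of 0] AE_lborel_singleton[of pi] by eventually_elim auto
    then show "AE t in lborel. f (2 * sin (t / 2)) * indicator {0<..<pi} t = f (2 * sin (t / 2)) * indicator {0..pi} t"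
      by eventually_elim (auto split: split_indicator)
  qed
  also have "((\<integral>\<^sup>+ t. f (2 * sin (t / 2)) * indicator {0..pi} t \<partial>lborel) + (\<integral>\<^sup>+ t. f (2 * sin (t / 2)) * indicator {0..pi} t \<partial>lborel)) / ennreal (2 * pi)
     = (2 * (\<integral>\<^sup>+ t. f (2 * sin (t / 2)) * indicator {0..pi} t \<partial>lborel)) / (2 * ennreal pi)"
  proof -
    have "ennreal (2 * pi) = 2 * ennreal pi"
      by (subst ennreal_mult) simp_all
    then show ?thesis by (simp only: mult_2[symmetric])
  qed
  also have "\<dots> = (\<integral>\<^sup>+ t. f (2 * sin (t / 2)) * indicator {0..pi} t \<partial>lborel) / ennreal pi"
    using divide_mult_eq[of 2 "\<integral>\<^sup>+ t. f (2 * sin (t / 2)) * indicator {0..pi} t \<partial>lborel" "ennreal pi"]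
    by (simp add: mult.commute)
  finally show ?thesis .
qed

section \<open>The plane as a product of two lines\<close>

lemma measurable_vector_2 [measurable]:
  assumes [measurable]: "f \<in> borel_measurable M" "g \<in> borel_measurable M"
  shows "(\<lambda>x. vector [f x, g x] :: real ^ 2) \<in> borel_measurable M"
proof -
  have m: "(\<lambda>z. vector [fst z, snd z] :: real ^ 2) \<in> borel_measurable borel"
  proof (rule borel_measurable_continuous_onI)
    have "(\<lambda>z. vector [fst z, snd z] :: real ^ 2) = (\<lambda>z. \<chi> i. if i = 1 then fst z else snd z)"
      by (auto simp: vec_eq_iff forall_2 vector_2)
    moreover have "continuous_on UNIV (\<lambda>z. (\<chi> i. if i = 1 then fst z else snd z) :: real ^ 2)"
    proof (rule continuous_on_vec_lambda)
      fix i :: 2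
      show "continuous_on UNIV (\<lambda>z::real \<times> real. if i = 1 then fst z else snd z)"
        by (cases "i = 1") (auto intro!: continuous_intros)
    qed
    ultimately show "continuous_on UNIV (\<lambda>z. vector [fst z, snd z] :: real ^ 2)" by (simp only:)
  qed
  have "(\<lambda>x. (f x, g x)) \<in> borel_measurable M" by measurable
  from measurable_compose[OF this m] show ?thesis by simp
qed

text \<open>Lebesgue measure is determined by its values on boxes, and the preimage of a box is a
  product of intervals. This is what allows integrals over \<open>real ^ 2\<close> to be sliced by
  coordinates.\<close>

lemma lborel_real_2: "distr (lborel \<Otimes>\<^sub>M lborel) borel (\<lambda>(x, y). vector [x, y] :: real ^ 2) = lborel"
proof (rule lborel_eqI[symmetric])
  have m: "(\<lambda>(x, y). vector [x, y] :: real ^ 2) \<in> borel_measurable (lborel \<Otimes>\<^sub>M lborel)"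
    by measurable
  fix l u :: "real ^ 2" assume lu: "\<And>b. b \<in> Basis \<Longrightarrow> l \<bullet> b \<le> u \<bullet> b"
  have lu': "l $ i \<le> u $ i" for i
    using lu[of "axis i 1"] by (simp add: inner_axis axis_in_Basis_iff)
  have "(\<lambda>(x, y). vector [x, y]) -` box l u \<inter> space (lborel \<Otimes>\<^sub>M lborel) = {l $ 1<..<u $ 1} \<times> {l $ 2<..<u $ 2}"
    by (auto simp: mem_box_cart forall_2 vector_2 space_pair_measure)
  then have "emeasure (distr (lborel \<Otimes>\<^sub>M lborel) borel (\<lambda>(x, y). vector [x, y] :: real ^ 2)) (box l u) =
      ennreal (u $ 1 - l $ 1) * ennreal (u $ 2 - l $ 2)"
    using m lu' by (simp add: emeasure_distr lborel.emeasure_pair_measure_Times)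
  also have "\<dots> = ennreal ((u $ 1 - l $ 1) * (u $ 2 - l $ 2))"
    using lu' by (simp add: ennreal_mult)
  also have "(u $ 1 - l $ 1) * (u $ 2 - l $ 2) = (\<Prod>b\<in>Basis. (u - l) \<bullet> b)"
  proof -
    have B: "(Basis :: (real ^ 2) set) = {axis 1 1, axis 2 1}"
      by (auto simp: Basis_vec_def UNIV_2)
    have "axis 1 1 \<noteq> (axis 2 1 :: real ^ 2)" by (simp add: axis_eq_axis)
    then show ?thesis unfolding B by (subst prod.insert) (auto simp: inner_axis)
  qed
  finally show "emeasure (distr (lborel \<Otimes>\<^sub>M lborel) borel (\<lambda>(x, y). vector [x, y] :: real ^ 2)) (box l u) =
      ennreal (\<Prod>b\<in>Basis. (u - l) \<bullet> b)" .
qed simp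

section \<open>The Fourier transform of the disc\<close>

text \<open>The length of the chord of the unit disc over the abscissa x; \<open>max\<close> gives
  the value 0 outside [-1, 1].\<close>

definition semicircle :: "real \<Rightarrow> real" where
  "semicircle x = 2 * sqrt (max 0 (1 - x\<^sup>2))"

text \<open>In classical terms 2 pi J_1(t) / t with the Bessel function J_1. The cosine suffices
  because the chord length is even.\<close>

definition disc_ft :: "real \<Rightarrow> real" where
  "disc_ft t = (LINT x|lborel. semicircle x * cos (t * x))"

lemma continuous_semicircle: "continuous_on UNIV semicircle"
  unfolding semicircle_def by (intro continuous_intros)

lemma measurable_semicircle [measurable]: "semicircle \<in> borel_measurable borel"
  using continuous_semicircle by (rule borel_measurable_continuous_onI)

lemma semicircle_nonneg: "0 \<le> semicircle x" by (simp add: semicircle_def)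

lemma semicircle_eq_0: "1 \<le> \<bar>x\<bar> \<Longrightarrow> semicircle x = 0"
  using abs_le_square_iff[of 1 x] by (simp add: semicircle_def max_absorb1)

lemma semicircle_le: "semicircle x \<le> 2 * indicator {-1..1} x"
proof (cases "\<bar>x\<bar> \<le> 1")
  case True
  have "sqrt (max 0 (1 - x\<^sup>2)) \<le> 1" by simp
  moreover have "indicator {-1..1} x = (1::real)" using True by (auto simp: indicator_def abs_le_iff)
  ultimately show ?thesis by (simp add: semicircle_def)
next
  case False
  then show ?thesis using semicircle_eq_0[of x] by simp
qed

lemma integrable_semicircle: "integrable lborel semicircle"
proof (rule Bochner_Integration.integrable_bound)
  show "integrable lborel (\<lambda>x::real. 2 * indicator {-1..1} x :: real)" by simp
  show "AE x in lborel. norm (semicircle x) \<le> norm (2 * indicator {-1..1} x :: real)"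
    using semicircle_le semicircle_nonneg by simp
qed simp

lemma integrable_semicircle_cos: "integrable lborel (\<lambda>x. semicircle x * cos (t * x))"
  and integrable_semicircle_sin: "integrable lborel (\<lambda>x. semicircle x * sin (t * x))"
  by (rule Bochner_Integration.integrable_bound[OF integrable_semicircle];
      simp add: abs_mult semicircle_nonneg mult_left_le)+

lemma disc_ft_bound: "\<bar>disc_ft t\<bar> \<le> 4"
proof -
  have "\<bar>disc_ft t\<bar> \<le> (LINT x|lborel. \<bar>semicircle x * cos (t * x)\<bar>)"
    unfolding disc_ft_def by (rule integral_abs_bound)
  also have "\<dots> \<le> (LINT x::real|lborel. 2 * indicator {-1..1} x)"
  proof (rule Bochner_Integration.integral_mono)
    show "integrable lborel (\<lambda>x. \<bar>semicircle x * cos (t * x)\<bar>)" using integrable_semicircle_cos by (rule integrable_abs)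
    show "\<bar>semicircle x * cos (t * x)\<bar> \<le> 2 * indicator {-1..1} x" for x
      using semicircle_le[of x] semicircle_nonneg[of x] mult_left_le[of "\<bar>cos (t * x)\<bar>" "semicircle x"]
      by (simp add: abs_mult)
  qed simp
  finally show ?thesis by simp
qed

lemma disc_ft_even: "disc_ft (- t) = disc_ft t"
  by (simp add: disc_ft_def)

lemma measurable_disc_ft [measurable]: "disc_ft \<in> borel_measurable borel"
  unfolding disc_ft_def by measurable

text \<open>The sine part equals its own negative under the reflection of x.\<close>

lemma semicircle_fourier: "(LINT x|lborel. complex_of_real (semicircle x) * exp (\<i> * of_real (t * x))) = of_real (disc_ft t)"
proof -
  have "(LINT x|lborel. semicircle x * sin (t * x)) = (LINT x|lborel. semicircle (0 + (-1) * x) * sin (t * (0 + (-1) * x)))"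
    by (subst lborel_integral_real_affine[of "-1" _ 0]) simp_all
  also have "\<dots> = - (LINT x|lborel. semicircle x * sin (t * x))"
    by (simp add: semicircle_def)
  finally have 0: "(LINT x|lborel. semicircle x * sin (t * x)) = 0" by simp
  have "(LINT x|lborel. complex_of_real (semicircle x) * exp (\<i> * of_real (t * x))) =
      (LINT x|lborel. complex_of_real (semicircle x * cos (t * x)) + \<i> * complex_of_real (semicircle x * sin (t * x)))"
    by (intro Bochner_Integration.integral_cong) (simp_all add: complex_eq_iff Re_exp Im_exp)
  also have "\<dots> = of_real (LINT x|lborel. semicircle x * cos (t * x)) + \<i> * of_real (LINT x|lborel. semicircle x * sin (t * x))"
    using integrable_semicircle_cos[of t] integrable_semicircle_sin[of t]
    by (subst Bochner_Integration.integral_add)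
      (simp_all only: integral_mult_right_zero integral_complex_of_real complex_of_real_integrable_eq integrable_mult_right)
  finally show ?thesis by (simp add: 0 disc_ft_def)
qed

lemma disc_ft_integral: "disc_ft t = 2 * integral {-1..1} (\<lambda>x. sqrt (1 - x\<^sup>2) * cos (t * x))"
proof -
  have "disc_ft t = (LINT x:{-1..1}|lborel. 2 * (sqrt (1 - x\<^sup>2) * cos (t * x)))"
    unfolding disc_ft_def set_lebesgue_integral_def
  proof (intro Bochner_Integration.integral_cong refl)
    fix x :: real
    show "semicircle x * cos (t * x) = indicator {- 1..1} x *\<^sub>R (2 * (sqrt (1 - x\<^sup>2) * cos (t * x)))"
    proof (cases "\<bar>x\<bar> \<le> 1")
      case True
      then have "0 \<le> 1 - x\<^sup>2" by (simp add: abs_square_le_1)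
      moreover have "indicator {-1..1} x = (1::real)" using True by (auto simp: indicator_def abs_le_iff)
      ultimately show ?thesis by (simp add: semicircle_def)
    next
      case False
      then show ?thesis using semicircle_eq_0[of x] by (auto simp: indicator_def abs_le_iff)
    qed
  qed
  also have "\<dots> = integral {-1..1} (\<lambda>x. 2 * (sqrt (1 - x\<^sup>2) * cos (t * x)))"
    by (intro set_borel_integral_eq_integral borel_integrable_atLeastAtMost' continuous_intros)
  finally show ?thesis by simp
qed

text \<open>Integration by parts on the whole interval fails, because the derivative of sqrt (1 -
  x^2) blows up at the endpoints and the second derivative is not integrable. The end pieces are
  estimated trivially and only the middle is integrated by parts twice; with end pieces of length
  1/t all contributions are of order t^(-3/2).\<close>

lemma disc_ft_decay_large:
  assumes t: "1 \<le> t"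
  shows "\<bar>disc_ft t\<bar> * t powr (3/2) \<le> 20"
proof -
  \<comment> \<open>At distance 1/t from the endpoints s is of order t^(-1/2), so each end piece
    contributes at most s c / t, of order t^(-3/2).\<close>
  define c where "c = 1 - 1 / t"
  have c: "0 \<le> c" "c < 1" using t by (auto simp: c_def)
  define s where "s x = sqrt (1 - x\<^sup>2)" for x :: real
  define h where "h x = s x * cos (t * x)" for x
  have hc: "continuous_on A h" for A
    unfolding h_def s_def by (intro continuous_intros)
  have hi: "h integrable_on {a..b}" for a b
    using hc by (rule integrable_continuous_interval)
  have sc: "s c \<le> sqrt 2 / sqrt t" "1 / sqrt t \<le> s c"
  proof -
    have e: "1 - c\<^sup>2 = (1 / t) * (1 + c)" by (simp add: c_def power2_eq_square algebra_simps)
    have "1 - c\<^sup>2 \<le> 2 / t" unfolding e using c t by (simp add: field_simps)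
    then show "s c \<le> sqrt 2 / sqrt t" by (simp add: s_def flip: real_sqrt_divide)
    have "1 / t \<le> 1 - c\<^sup>2" unfolding e using c t by (simp add: field_simps)
    then have "sqrt (1 / t) \<le> s c" by (simp add: s_def)
    then show "1 / sqrt t \<le> s c" by (simp add: real_sqrt_divide)
  qed
  have tail: "\<bar>h x\<bar> \<le> s c" if "c \<le> \<bar>x\<bar>" "\<bar>x\<bar> \<le> 1" for x
  proof -
    have "c\<^sup>2 \<le> x\<^sup>2" using that c by (simp flip: abs_le_square_iff)
    moreover have "x\<^sup>2 \<le> 1" using that by (simp add: abs_square_le_1)
    ultimately have "s x \<le> s c" "0 \<le> s x" by (simp_all add: s_def)
    then show ?thesis by (auto simp: h_def abs_mult intro: order_trans[OF mult_left_le])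
  qed
  have T1: "\<bar>integral {-1..-c} h\<bar> \<le> s c * (1 / t)"
    using integral_bound[of "-1" "-c" h "s c"] tail hc c by (simp add: c_def)
  have T2: "\<bar>integral {c..1} h\<bar> \<le> s c * (1 / t)"
    using integral_bound[of c 1 h "s c"] tail hc c by (simp add: c_def)
  \<comment> \<open>The boundary terms of two integrations by parts, using s' = - x / s. The
    derivative of F differs from h only by a term of size at most t^(-2) s^(-3).\<close>
  define F where "F x = s x * sin (t * x) / t - x / s x * cos (t * x) / t\<^sup>2" for x
  define g where "g x = x / s x" for x
  have spos: "0 < s x" if "\<bar>x\<bar> \<le> c" for x
  proof -
    have "\<bar>x\<bar> < 1" using that c by simp
    then show ?thesis by (simp add: s_def abs_square_less_1)
  qed
  have ds: "(s has_real_derivative (- x / s x)) (at x)" if "\<bar>x\<bar> \<le> c" for x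
  proof -
    have "1 - x\<^sup>2 > 0" using spos[OF that] by (simp add: s_def)
    then show ?thesis unfolding s_def[abs_def]
      by (auto intro!: derivative_eq_intros simp: field_simps)
  qed
  have s2: "s x * s x = 1 - x\<^sup>2" if "\<bar>x\<bar> \<le> c" for x
    using spos[OF that] by (simp add: s_def)
  have dg: "(g has_real_derivative (1 / s x ^ 3)) (at x)" if "\<bar>x\<bar> \<le> c" for x
  proof -
    have "(g has_real_derivative ((1 * s x - x * (- x / s x)) / (s x * s x))) (at x)"
      unfolding g_def[abs_def] using spos[OF that] by (intro DERIV_divide DERIV_ident ds that) simp
    moreover have "(1 * s x - x * (- x / s x)) / (s x * s x) = 1 / s x ^ 3"
      using s2[OF that] spos[OF that] by (simp add: field_simps power3_eq_cube power2_eq_square)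
    ultimately show ?thesis by simp
  qed
  have dF: "(F has_real_derivative (h x - cos (t * x) / s x ^ 3 / t\<^sup>2)) (at x)" if "\<bar>x\<bar> \<le> c" for x
  proof -
    have "((\<lambda>x. s x * sin (t * x) / t - g x * cos (t * x) / t\<^sup>2) has_real_derivative
       (((- x / s x) * sin (t * x) + (cos (t * x) * t) * s x) / t - ((1 / s x ^ 3) * cos (t * x) + (- sin (t * x) * t) * g x) / t\<^sup>2)) (at x)"
      using t by (auto intro!: derivative_eq_intros ds dg that simp: power4_eq_xxxx power2_eq_square)
    moreover have "((- x / s x) * sin (t * x) + (cos (t * x) * t) * s x) / t - ((1 / s x ^ 3) * cos (t * x) + (- sin (t * x) * t) * g x) / t\<^sup>2
        = h x - cos (t * x) / s x ^ 3 / t\<^sup>2"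
      using t spos[OF that] by (simp add: h_def g_def add_divide_distrib diff_divide_distrib power2_eq_square)
    ultimately have "((\<lambda>x. s x * sin (t * x) / t - g x * cos (t * x) / t\<^sup>2) has_real_derivative
       (h x - cos (t * x) / s x ^ 3 / t\<^sup>2)) (at x)" by simp
    then show ?thesis by (simp add: F_def[abs_def] g_def)
  qed
  \<comment> \<open>The majorant of the remainder has the antiderivative g = x / s, so its integral
    is 2 g c, at most 2 sqrt t.\<close>
  have I3: "((\<lambda>x. 1 / s x ^ 3) has_integral (g c - g (- c))) {-c..c}"
  proof (rule fundamental_theorem_of_calculus)
    fix x assume "x \<in> {-c..c}"
    then have "\<bar>x\<bar> \<le> c" by auto
    from has_field_derivative_at_within[OF dg[OF this]]
    show "(g has_vector_derivative 1 / s x ^ 3) (at x within {-c..c})"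
      by (simp only: has_real_derivative_iff_has_vector_derivative)
  qed (use c in simp)
  have IF: "((\<lambda>x. h x - cos (t * x) / s x ^ 3 / t\<^sup>2) has_integral (F c - F (- c))) {-c..c}"
  proof (rule fundamental_theorem_of_calculus)
    fix x assume "x \<in> {-c..c}"
    then have "\<bar>x\<bar> \<le> c" by auto
    from has_field_derivative_at_within[OF dF[OF this]]
    show "(F has_vector_derivative h x - cos (t * x) / s x ^ 3 / t\<^sup>2) (at x within {-c..c})"
      by (simp only: has_real_derivative_iff_has_vector_derivative)
  qed (use c in simp)
  have "((\<lambda>x. h x - (h x - cos (t * x) / s x ^ 3 / t\<^sup>2)) has_integral (integral {-c..c} h - (F c - F (- c)))) {-c..c}"
    by (intro has_integral_diff IF integrable_integral hi)
  then have Ic: "((\<lambda>x. cos (t * x) / s x ^ 3 / t\<^sup>2) has_integral (integral {-c..c} h - (F c - F (- c)))) {-c..c}"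
    by simp
  have "\<bar>integral {-c..c} h - (F c - F (- c))\<bar> \<le> (g c - g (- c)) / t\<^sup>2"
  proof -
    have "norm (integral {-c..c} (\<lambda>x. cos (t * x) / s x ^ 3 / t\<^sup>2)) \<le> integral {-c..c} (\<lambda>x. 1 / s x ^ 3 / t\<^sup>2)"
    proof (rule integral_norm_bound_integral)
      show "(\<lambda>x. cos (t * x) / s x ^ 3 / t\<^sup>2) integrable_on {-c..c}" using Ic by blast
      show "(\<lambda>x. 1 / s x ^ 3 / t\<^sup>2) integrable_on {-c..c}" using has_integral_divide[OF I3, of "t\<^sup>2"] by blast
      fix x assume "x \<in> {-c..c}"
      then have "0 < s x ^ 3" using spos[of x] by auto
      then show "norm (cos (t * x) / s x ^ 3 / t\<^sup>2) \<le> 1 / s x ^ 3 / t\<^sup>2"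
        by (auto simp: abs_mult abs_of_pos intro!: divide_right_mono)
    qed
    also have "integral {-c..c} (\<lambda>x. 1 / s x ^ 3 / t\<^sup>2) = (g c - g (- c)) / t\<^sup>2"
      using has_integral_divide[OF I3, of "t\<^sup>2"] by (rule integral_unique)
    finally show ?thesis using integral_unique[OF Ic] by simp
  qed
  moreover have gc: "0 \<le> g c" "g c \<le> sqrt t" "g (- c) = - g c"
  proof -
    have "1 / s c \<le> sqrt t" using sc(2) spos[of c] c t by (simp add: field_simps)
    moreover have "g c \<le> 1 / s c" unfolding g_def using c spos[of c] by (intro divide_right_mono) auto
    ultimately show "g c \<le> sqrt t" by simp
    show "0 \<le> g c" using c spos[of c] by (simp add: g_def)
    show "g (- c) = - g c" by (simp add: g_def s_def)
  qed
  moreover have "\<bar>F c - F (- c)\<bar> \<le> 2 * (s c / t + g c / t\<^sup>2)"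
  proof -
    have "F (- c) = - F c" by (simp add: F_def s_def)
    moreover have "\<bar>F c\<bar> \<le> \<bar>s c * sin (t * c) / t\<bar> + \<bar>g c * cos (t * c) / t\<^sup>2\<bar>"
      unfolding F_def g_def by (rule abs_triangle_ineq4)
    moreover have "\<bar>s c * sin (t * c) / t\<bar> \<le> s c / t"
      using t spos[of c] c by (auto simp: abs_mult intro!: divide_right_mono mult_left_le)
    moreover have "\<bar>g c * cos (t * c) / t\<^sup>2\<bar> \<le> g c / t\<^sup>2"
      using t gc by (auto simp: abs_mult intro!: divide_right_mono mult_left_le)
    ultimately show ?thesis by simp
  qed
  ultimately have mid: "\<bar>integral {-c..c} h\<bar> \<le> 2 * (s c / t) + 4 * (g c / t\<^sup>2)"
  proof -
    assume 1: "\<bar>integral {-c..c} h - (F c - F (- c))\<bar> \<le> (g c - g (- c)) / t\<^sup>2"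
      and g: "g (- c) = - g c" and 2: "\<bar>F c - F (- c)\<bar> \<le> 2 * (s c / t + g c / t\<^sup>2)"
    define A B where "A = g c / t\<^sup>2" and "B = s c / t"
    have "\<bar>integral {-c..c} h - (F c - F (- c))\<bar> \<le> 2 * A" using 1 by (simp add: g A_def)
    moreover have "\<bar>F c - F (- c)\<bar> \<le> 2 * (B + A)" using 2 by (simp only: A_def B_def)
    ultimately have "\<bar>integral {-c..c} h\<bar> \<le> 2 * B + 4 * A"
      using abs_triangle_ineq[of "integral {-c..c} h - (F c - F (- c))" "F c - F (- c)"] by simp
    then show ?thesis by (simp only: A_def B_def)
  qed
  have "integral {-1..1} h = integral {-1..-c} h + integral {-c..c} h + integral {c..1} h"
    using Henstock_Kurzweil_Integration.integral_combine[of "-1" "-c" c h] Henstock_Kurzweil_Integration.integral_combine[of "-1" c 1 h] hi c by simp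
  then have "\<bar>integral {-1..1} h\<bar> \<le> 4 * s c / t + 4 * g c / t\<^sup>2"
    using T1 T2 mid by (simp add: abs_le_iff)
  also have "\<dots> \<le> 4 * (sqrt 2 / sqrt t) / t + 4 * sqrt t / t\<^sup>2"
    using sc gc t by (intro add_mono divide_right_mono) auto
  \<comment> \<open>4 sqrt 2 + 4 <= 10 by sqrt 2 <= 3/2; \<open>disc_ft\<close> is twice this
    integral, whence the constant 20.\<close>
  also have "\<dots> \<le> 10 / (t * sqrt t)"
  proof -
    have "sqrt 2 \<le> 3/2" by (rule real_le_lsqrt) (auto simp: power2_eq_square)
    moreover have "4 * sqrt t / t\<^sup>2 = 4 * (1 / (t * sqrt t))" using t by (simp add: field_simps power2_eq_square)
    moreover have "4 * (sqrt 2 / sqrt t) / t = 4 * sqrt 2 * (1 / (t * sqrt t))" using t by (simp add: field_simps)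
    ultimately have "4 * (sqrt 2 / sqrt t) / t + 4 * sqrt t / t\<^sup>2 = (4 * sqrt 2 + 4) * (1 / (t * sqrt t))"
      by (simp only: distrib_right)
    also have "\<dots> \<le> 10 * (1 / (t * sqrt t))" using \<open>sqrt 2 \<le> 3/2\<close> t by (intro mult_right_mono) auto
    finally show ?thesis by simp
  qed
  finally have "\<bar>disc_ft t\<bar> \<le> 20 / (t * sqrt t)"
    unfolding disc_ft_integral h_def[abs_def] s_def[abs_def] by (simp add: abs_mult)
  moreover have "t powr (3/2) = t * sqrt t"
    using t powr_add[of t 1 "1/2"] by (simp add: powr_half_sqrt)
  ultimately show ?thesis using t by (simp add: field_simps)
qed

lemma disc_ft_decay:
  assumes t: "0 \<le> t"
  shows "\<bar>disc_ft t\<bar> * t powr (3/2) \<le> 20"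
proof (cases "1 \<le> t")
  case False
  then have "t powr (3/2) \<le> 1" using t by (simp add: powr_le1)
  then have "\<bar>disc_ft t\<bar> * t powr (3/2) \<le> 4 * 1" using disc_ft_bound[of t] by (intro mult_mono) auto
  then show ?thesis by simp
qed (rule disc_ft_decay_large)

text \<open>For |t| >= 1 the decay t^(-3) of the square is weakened to t^(-2), with 400 = 20^2
  doubled to absorb the 1. The result is one integrable majorant on the whole line, which also
  dominates the limit in \<open>chord_moment_asymp\<close>.\<close>

lemma disc_ft_square_le: "(disc_ft t)\<^sup>2 \<le> 800 * inverse (1 + t\<^sup>2)"
proof -
  have "(disc_ft t)\<^sup>2 \<le> 800 * inverse (1 + t\<^sup>2)" if t: "0 \<le> t" for t
  proof (cases "1 \<le> t")
    case True
    have "(\<bar>disc_ft t\<bar> * t powr (3/2))\<^sup>2 \<le> 20\<^sup>2" using disc_ft_decay[OF t] by (intro power_mono) auto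
    moreover have "(t powr (3/2))\<^sup>2 = t ^ 3"
      using True by (simp add: powr_power powr_realpow[of t 3, simplified])
    ultimately have "(disc_ft t)\<^sup>2 * t ^ 3 \<le> 400" by (simp add: power_mult_distrib)
    moreover have "t\<^sup>2 \<le> t ^ 3" using True by (intro power_increasing) auto
    ultimately have "(disc_ft t)\<^sup>2 * t\<^sup>2 \<le> 400"
      using mult_left_mono[of "t\<^sup>2" "t ^ 3" "(disc_ft t)\<^sup>2"] by simp
    moreover have "(disc_ft t)\<^sup>2 \<le> (disc_ft t)\<^sup>2 * t\<^sup>2"
      using True by (simp add: mult_le_cancel_left1 one_le_power)
    ultimately have "(disc_ft t)\<^sup>2 * (1 + t\<^sup>2) \<le> 800" by (simp add: algebra_simps)
    then show ?thesis by (simp add: field_simps pos_le_divide_eq add_pos_nonneg)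
  next
    case False
    then have "t\<^sup>2 \<le> 1" using t by (simp add: abs_square_le_1)
    moreover have "(disc_ft t)\<^sup>2 \<le> 4\<^sup>2" using disc_ft_bound[of t] power_mono[of "\<bar>disc_ft t\<bar>" 4 2] by simp
    ultimately have "(disc_ft t)\<^sup>2 * (1 + t\<^sup>2) \<le> 16 * 2" by (intro mult_mono) auto
    then show ?thesis by (simp add: field_simps pos_le_divide_eq add_pos_nonneg)
  qed
  note * = this
  have "disc_ft \<bar>t\<bar> = disc_ft t" by (cases "0 \<le> t") (simp_all add: disc_ft_even)
  with *[of "\<bar>t\<bar>"] show ?thesis by simp
qed

lemma integrable_disc_ft_square: "integrable lborel (\<lambda>t. (disc_ft t)\<^sup>2)"
proof (rule Bochner_Integration.integrable_bound)
  show "integrable lborel (\<lambda>t::real. 800 * inverse (1 + t\<^sup>2))"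
    using integrable_inverse_1_plus_square by (simp add: set_integrable_def)
  show "AE t in lborel. norm ((disc_ft t)\<^sup>2) \<le> norm (800 * inverse (1 + t\<^sup>2))"
  proof (rule AE_I2)
    fix t show "norm ((disc_ft t)\<^sup>2) \<le> norm (800 * inverse (1 + t\<^sup>2))"
      using order_trans[OF disc_ft_square_le[of t] abs_ge_self] by simp
  qed
qed simp

lemma integral_semicircle_square: "(LINT x|lborel. (semicircle x)\<^sup>2) = 16 / 3"
proof -
  have "(LINT x|lborel. (semicircle x)\<^sup>2) = (LINT x|lborel. (4 * (1 - x\<^sup>2)) * indicator {-1..1} x)"
  proof (intro Bochner_Integration.integral_cong refl)
    fix x :: real
    show "(semicircle x)\<^sup>2 = (4 * (1 - x\<^sup>2)) * indicator {-1..1} x"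
    proof (cases "\<bar>x\<bar> \<le> 1")
      case True
      then have "0 \<le> 1 - x\<^sup>2" by (simp add: abs_square_le_1)
      moreover have "indicator {-1..1} x = (1::real)" using True by (auto simp: indicator_def abs_le_iff)
      ultimately show ?thesis by (simp add: semicircle_def power_mult_distrib)
    next
      case False
      then show ?thesis using semicircle_eq_0[of x] by (auto simp: indicator_def abs_le_iff)
    qed
  qed
  also have "\<dots> = (4 * (1 - 1 ^ 3 / 3)) - (4 * (- 1 - (- 1) ^ 3 / 3))"
    by (rule integral_FTC_Icc_real) (auto intro!: derivative_eq_intros continuous_intros)
  finally show ?thesis by simp
qed

text \<open>Parseval with both functions equal to \<open>semicircle\<close>: its transform is real
  and even, so the opposite signs in the exponents make no difference.\<close>

lemma integral_disc_ft_square: "(LINT t|lborel. (disc_ft t)\<^sup>2) = 32 * pi / 3"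
proof -
  let ?f = "\<lambda>x. complex_of_real (semicircle x)"
  have F: "(LINT x|lborel. ?f x * exp (\<i> * of_real (y \<bullet> x))) = of_real (disc_ft y)" for y
    using semicircle_fourier[of y] by simp
  have G: "(LINT x|lborel. ?f x * exp (- \<i> * of_real (y \<bullet> x))) = of_real (disc_ft y)" for y
    using semicircle_fourier[of "- y"] by (simp add: disc_ft_even)
  have "(LINT y|lborel. complex_of_real (disc_ft y) * of_real (disc_ft y)) = (2 * pi) ^ DIM(real) * (LINT x|lborel. ?f x * ?f x)"
  proof (rule parseval[where f="?f" and g="?f" and B=2, unfolded F G])
    show "integrable lborel ?f" "integrable lborel ?f"
      using integrable_semicircle by simp_all
    show "norm (?f x) \<le> 2" for x
      using order_trans[OF semicircle_le[of x], of 2] semicircle_nonneg[of x] by (simp add: indicator_def)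
    show "AE x in lborel. isCont ?f x"
      using continuous_semicircle by (auto simp: continuous_on_eq_continuous_at)
    show "integrable lborel (\<lambda>y. complex_of_real (disc_ft y) * of_real (disc_ft y))"
      using integrable_disc_ft_square by (simp add: power2_eq_square flip: of_real_mult)
  qed
  then have "complex_of_real (LINT y|lborel. (disc_ft y)\<^sup>2) = of_real (2 * pi * (LINT x|lborel. (semicircle x)\<^sup>2))"
    by (simp add: power2_eq_square flip: of_real_mult)
  then show ?thesis by (simp only: of_real_eq_iff integral_semicircle_square)
qed

section \<open>The disc transform is radial\<close>

lemma integral_real_2:
  fixes f :: "real ^ 2 \<Rightarrow> 'b::{banach, second_countable_topology}"
  assumes f: "integrable lborel f"
  shows "(LINT x|lborel. f x) = (LINT x|lborel. LINT y|lborel. f (vector [x, y]))"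
proof -
  have [measurable]: "f \<in> borel_measurable borel" using f by simp
  have m: "(\<lambda>(x, y). vector [x, y] :: real ^ 2) \<in> borel_measurable (lborel \<Otimes>\<^sub>M lborel)"
    by measurable
  have "integrable (distr (lborel \<Otimes>\<^sub>M lborel) borel (\<lambda>(x, y). vector [x, y] :: real ^ 2)) f"
    using f by (simp add: lborel_real_2)
  then have i: "integrable (lborel \<Otimes>\<^sub>M lborel) (\<lambda>(x, y). f (vector [x, y]))"
    using m by (simp add: integrable_distr_eq case_prod_beta')
  have "(LINT x|lborel. f x) = (LINT x|distr (lborel \<Otimes>\<^sub>M lborel) borel (\<lambda>(x, y). vector [x, y] :: real ^ 2). f x)"
    by (simp add: lborel_real_2)
  also have "\<dots> = (LINT z|(lborel \<Otimes>\<^sub>M lborel). f (case z of (x, y) \<Rightarrow> vector [x, y]))"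
    using m by (rule integral_distr) simp
  also have "\<dots> = (LINT x|lborel. LINT y|lborel. f (vector [x, y]))"
    using lborel_pair.integral_fst'[OF i] by (simp add: case_prod_beta')
  finally show ?thesis .
qed

text \<open>It is enough to compare boxes. The preimage of a box is its image under the inverse map,
  again orthogonal, and orthogonal images keep their Lebesgue measure.\<close>

lemma distr_orthogonal:
  fixes T :: "real ^ 'n::{finite,wellorder} \<Rightarrow> real ^ 'n::_"
  assumes T: "orthogonal_transformation T"
  shows "distr lborel borel T = lborel"
proof (rule lborel_eqI[symmetric])
  fix l u :: "real ^ 'n::_" assume lu: "\<And>b. b \<in> Basis \<Longrightarrow> l \<bullet> b \<le> u \<bullet> b"
  have lin: "linear T" using T by (rule orthogonal_transformation_linear)
  have m [measurable]: "T \<in> borel \<rightarrow>\<^sub>M borel"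
    by (intro borel_measurable_continuous_onI linear_continuous_on) (simp add: lin linear_conv_bounded_linear[symmetric])
  have bij: "bij T" using T by (rule orthogonal_transformation_bij)
  have Ti: "orthogonal_transformation (inv T)" using T by (rule orthogonal_transformation_inv)
  have eq: "T -` box l u = inv T ` box l u"
    using bij by (rule bij_vimage_eq_inv_image)
  have "emeasure (distr lborel borel T) (box l u) = emeasure lborel (T -` box l u)"
    by (simp add: emeasure_distr)
  also have "\<dots> = emeasure lebesgue (T -` box l u)"
    using measurable_sets[OF m, of "box l u"] by simp
  also have "\<dots> = ennreal (measure lebesgue (inv T ` box l u))"
    unfolding eq by (intro emeasure_eq_measure2 measurable_orthogonal_image Ti lmeasurable_box)
  also have "\<dots> = ennreal (measure lebesgue (box l u))"
    by (subst measure_orthogonal_image[OF Ti]) (rule lmeasurable_box, rule refl)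
  also have "\<dots> = ennreal (\<Prod>b\<in>Basis. (u - l) \<bullet> b)"
    using lu by (simp add: measure_lborel_box_eq inner_diff_left)
  finally show "emeasure (distr lborel borel T) (box l u) = ennreal (\<Prod>b\<in>Basis. (u - l) \<bullet> b)" .
qed simp

lemma integrable_ball_exp:
  "integrable lborel (\<lambda>x. indicator (ball 0 R) x *\<^sub>R exp (\<i> * of_real (\<xi> \<bullet> x)))" for \<xi> :: "'a::euclidean_space"
proof (rule Bochner_Integration.integrable_bound)
  show "integrable lborel (\<lambda>x::'a. indicator (ball 0 R) x :: real)"
    using emeasure_bounded_finite[of "ball (0::'a) R"] by (simp add: integrable_indicator_iff)
qed (auto simp: indicator_def)

lemma Q_disc_rotate:
  assumes T: "orthogonal_transformation T"
  shows "Q_disc R (T \<xi>) = Q_disc R \<xi>"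
proof -
  have lin: "linear T" using T by (rule orthogonal_transformation_linear)
  have m [measurable]: "T \<in> borel \<rightarrow>\<^sub>M borel"
    by (intro borel_measurable_continuous_onI linear_continuous_on) (simp add: lin linear_conv_bounded_linear[symmetric])
  have "Q_disc R (T \<xi>) = (LINT x|distr lborel borel T. indicator (ball 0 R) x *\<^sub>R exp (\<i> * of_real (T \<xi> \<bullet> x)))"
    by (simp add: distr_orthogonal[OF T] Q_disc_def set_lebesgue_integral_def)
  also have "\<dots> = (LINT x|lborel. indicator (ball 0 R) (T x) *\<^sub>R exp (\<i> * of_real (T \<xi> \<bullet> T x)))"
    using integrable_ball_exp[of R "T \<xi>"] by (intro integral_distr) auto
  also have "\<dots> = Q_disc R \<xi>"
    using T unfolding Q_disc_def set_lebesgue_integral_def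
    by (intro Bochner_Integration.integral_cong) (simp_all add: orthogonal_transformation_def orthogonal_transformation_norm[OF T] indicator_def)
  finally show ?thesis .
qed

text \<open>A rotation puts the frequency on the first axis. The exponential then depends on the
  first coordinate alone, and integrating out the second leaves the chord length R * semicircle (x /
  R). One factor R is in this length, the other comes from rescaling x.\<close>

lemma Q_disc_eq:
  assumes R: "R > 0"
  shows "Q_disc R \<xi> = of_real (R\<^sup>2 * disc_ft (R * norm \<xi>))"
proof -
  have "norm (norm \<xi> *\<^sub>R axis 1 1 :: real ^ 2) = norm \<xi>" by simp
  then obtain T :: "real ^ 2 \<Rightarrow> real ^ 2" where T: "orthogonal_transformation T" "T (norm \<xi> *\<^sub>R axis 1 1) = \<xi>"
    by (rule orthogonal_transformation_exists)
  let ?r = "norm \<xi>"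
  have slice: "(LINT y|lborel. indicator (ball 0 R) (vector [x, y] :: real ^ 2) *\<^sub>R exp (\<i> * of_real (?r * x)))
      = R *\<^sub>R (complex_of_real (semicircle (x / R)) * exp (\<i> * of_real (?r * x)))" for x
  proof -
    have ball_eq: "ball 0 R = {v :: real ^ 2. (v $ 1)\<^sup>2 + (v $ 2)\<^sup>2 < R\<^sup>2}"
    proof -
      have "sqrt a < R \<longleftrightarrow> a < R\<^sup>2" for a using real_sqrt_less_iff[of a "R\<^sup>2"] R by simp
      then show ?thesis by (simp only: set_eq_iff mem_ball_0 norm_real_2 mem_Collect_eq simp_thms)
    qed
    have "(vector [x, y] :: real ^ 2) \<in> ball 0 R \<longleftrightarrow> y\<^sup>2 < R\<^sup>2 - x\<^sup>2" for y
      unfolding ball_eq mem_Collect_eq vector_2 by linarith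
    moreover have "y\<^sup>2 < R\<^sup>2 - x\<^sup>2 \<longleftrightarrow> y \<in> {- sqrt (max 0 (R\<^sup>2 - x\<^sup>2))<..<sqrt (max 0 (R\<^sup>2 - x\<^sup>2))}" for y
    proof -
      have "y\<^sup>2 < R\<^sup>2 - x\<^sup>2 \<longleftrightarrow> y\<^sup>2 < max 0 (R\<^sup>2 - x\<^sup>2)"
        by (simp add: less_max_iff_disj)
      also have "\<dots> \<longleftrightarrow> \<bar>y\<bar> < sqrt (max 0 (R\<^sup>2 - x\<^sup>2))"
        by (metis real_sqrt_abs real_sqrt_less_iff)
      finally show ?thesis by auto
    qed
    ultimately have "indicator (ball 0 R) (vector [x, y] :: real ^ 2) =
        (indicator {- sqrt (max 0 (R\<^sup>2 - x\<^sup>2))<..<sqrt (max 0 (R\<^sup>2 - x\<^sup>2))} y :: real)" for y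
      by (simp add: indicator_def)
    then have "(LINT y|lborel. indicator (ball 0 R) (vector [x, y] :: real ^ 2) *\<^sub>R exp (\<i> * of_real (?r * x)))
       = (2 * sqrt (max 0 (R\<^sup>2 - x\<^sup>2))) *\<^sub>R exp (\<i> * of_real (?r * x))"
      by simp
    moreover have "2 * sqrt (max 0 (R\<^sup>2 - x\<^sup>2)) = R * semicircle (x / R)"
    proof -
      have "max 0 (R\<^sup>2 - x\<^sup>2) = R\<^sup>2 * max 0 (1 - (x / R)\<^sup>2)"
      proof -
        have "R\<^sup>2 * (1 - (x / R)\<^sup>2) = R\<^sup>2 - x\<^sup>2"
          using R by (simp add: right_diff_distrib power_divide)
        moreover have "R\<^sup>2 * max 0 (1 - (x / R)\<^sup>2) = max (R\<^sup>2 * 0) (R\<^sup>2 * (1 - (x / R)\<^sup>2))"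
          by (rule max_mult_distrib_left[THEN trans]) simp
        ultimately show ?thesis by simp
      qed
      then show ?thesis using R by (simp add: semicircle_def real_sqrt_mult)
    qed
    ultimately show ?thesis by (simp add: scaleR_conv_of_real)
  qed
  have "Q_disc R \<xi> = Q_disc R (?r *\<^sub>R axis 1 1)"
    using Q_disc_rotate[OF T(1), of R "?r *\<^sub>R axis 1 1"] T(2) by simp
  also have "\<dots> = (LINT x|lborel. LINT y|lborel. indicator (ball 0 R) (vector [x, y] :: real ^ 2) *\<^sub>R exp (\<i> * of_real ((?r *\<^sub>R axis 1 1 :: real ^ 2) \<bullet> vector [x, y])))"
    unfolding Q_disc_def set_lebesgue_integral_def by (rule integral_real_2) (rule integrable_ball_exp)
  also have "\<dots> = (LINT x|lborel. LINT y|lborel. indicator (ball 0 R) (vector [x, y] :: real ^ 2) *\<^sub>R exp (\<i> * of_real (?r * x)))"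
    by (simp add: inner_axis' vector_2)
  also have "\<dots> = (LINT x|lborel. R *\<^sub>R (complex_of_real (semicircle (x / R)) * exp (\<i> * of_real (?r * x))))"
    by (simp only: slice)
  also have "\<dots> = R *\<^sub>R (LINT x|lborel. R *\<^sub>R (complex_of_real (semicircle ((0 + R * x) / R)) * exp (\<i> * of_real (?r * (0 + R * x)))))"
    using R by (subst lborel_integral_real_affine[of R _ 0]) simp_all
  also have "\<dots> = R *\<^sub>R R *\<^sub>R (LINT x|lborel. (complex_of_real (semicircle x) * exp (\<i> * of_real ((R * ?r) * x))))"
    using R by (simp add: mult_ac)
  also have "\<dots> = of_real (R\<^sup>2 * disc_ft (R * ?r))"
    unfolding semicircle_fourier by (simp add: power2_eq_square scaleR_conv_of_real)
  finally show ?thesis .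
qed

section \<open>Polar coordinates\<close>

lemma circ_inj:
  assumes "circ s = circ t" "0 \<le> s" "s < 2 * pi" "0 \<le> t" "t < 2 * pi"
  shows "s = t"
proof -
  have "cos s = cos t" "sin s = sin t" using assms(1) by (metis circ_nth)+
  then have "sin (s - t) = 0" "cos (s - t) = 1"
    using sin_cos_squared_add3[of t] by (simp_all add: sin_diff cos_diff)
  from \<open>cos (s - t) = 1\<close> obtain n :: int where n: "s - t = n * 2 * pi"
    by (auto simp: cos_one_2pi_int)
  have "\<bar>s - t\<bar> < 2 * pi" using assms by auto
  then have "\<bar>real_of_int n\<bar> * (2 * pi) < 1 * (2 * pi)" unfolding n by (simp add: abs_mult)
  then have "\<bar>real_of_int n\<bar> < 1" by (simp only: mult_less_cancel_right) auto
  then have "n = 0" by linarith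
  then show ?thesis using n by simp
qed

text \<open>Polar coordinates with radius r = 2 cos alpha: r dr becomes 2 sin (2 alpha) d alpha up
  to sign, and the normalisation of the angular mean supplies 2 pi. With this radius the formula
  differs from \<open>sum_circ_polar\<close> only in the weight sin (2 alpha) and the
  constant.\<close>

lemma polar_disc:
  fixes H :: "real ^ 2 \<Rightarrow> real"
  assumes [measurable]: "H \<in> borel_measurable borel" and B: "\<And>x. \<bar>H x\<bar> \<le> B"
  shows "(LINT x:ball 0 2|lborel. H x) = 4 * pi * (LINT \<alpha>:{0..<pi/2}|lborel. sin (2 * \<alpha>) * (LINT t|angle_measure. H ((2 * cos \<alpha>) *\<^sub>R circ t)))"
proof -
  define S :: "(real ^ 2) set" where "S = box 0 (vector [pi / 2, 2 * pi])"
  have S: "x \<in> S \<longleftrightarrow> 0 < x $ 1 \<and> x $ 1 < pi / 2 \<and> 0 < x $ 2 \<and> x $ 2 < 2 * pi" for x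
    by (auto simp: S_def mem_box_cart forall_2 vector_2)
  have S_borel [measurable]: "S \<in> sets borel" by (simp add: S_def)
  define g where "g v = (2 * cos (v $ 1)) *\<^sub>R circ (v $ 2)" for v :: "real ^ 2"
  define g' where "g' v h = (vector [- 2 * sin (v $ 1) * cos (v $ 2) * h $ 1 - 2 * cos (v $ 1) * sin (v $ 2) * h $ 2,
      - 2 * sin (v $ 1) * sin (v $ 2) * h $ 1 + 2 * cos (v $ 1) * cos (v $ 2) * h $ 2] :: real ^ 2)" for v h :: "real ^ 2"
  have g_eq: "g v = vector [2 * cos (v $ 1) * cos (v $ 2), 2 * cos (v $ 1) * sin (v $ 2)]" for v
    by (simp add: g_def vec_eq_iff forall_2 vector_2)
  have der: "(g has_derivative g' x) (at x within S)" for x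
  proof (rule has_derivative_componentwise_within[THEN iffD2], rule ballI)
    fix i :: "real ^ 2" assume "i \<in> Basis"
    then have "i = axis 1 1 \<or> i = axis 2 1" by (auto simp: Basis_vec_def UNIV_2)
    moreover have "((\<lambda>x. 2 * cos (x $ 1) * cos (x $ 2)) has_derivative
        (\<lambda>h. - 2 * sin (x $ 1) * cos (x $ 2) * h $ 1 - 2 * cos (x $ 1) * sin (x $ 2) * h $ 2)) (at x within S)"
      by (rule derivative_eq_intros bounded_linear_imp_has_derivative bounded_linear_vec_nth refl)+ (simp add: algebra_simps)
    moreover have "((\<lambda>x. 2 * cos (x $ 1) * sin (x $ 2)) has_derivative
        (\<lambda>h. - 2 * sin (x $ 1) * sin (x $ 2) * h $ 1 + 2 * cos (x $ 1) * cos (x $ 2) * h $ 2)) (at x within S)"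
      by (rule derivative_eq_intros bounded_linear_imp_has_derivative bounded_linear_vec_nth refl)+ (simp add: algebra_simps)
    ultimately show "((\<lambda>x. g x \<bullet> i) has_derivative (\<lambda>h. g' x h \<bullet> i)) (at x within S)"
      by (auto simp: g_eq g'_def inner_axis vector_2)
  qed
  have det: "\<bar>det (matrix (g' x))\<bar> = 2 * sin (2 * x $ 1)" if "x \<in> S" for x
  proof -
    have "det (matrix (g' x)) = - 4 * sin (x $ 1) * cos (x $ 1)"
      unfolding det_2 matrix_def
      by (simp add: g'_def axis_def vector_2) (use sin_cos_squared_add3[of "x $ 2"] in algebra)
    then have "det (matrix (g' x)) = - 2 * sin (2 * x $ 1)"
      by (simp add: sin_double)
    moreover have "0 < sin (2 * x $ 1)" using that by (intro sin_gt_zero) (auto simp: S)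
    ultimately show ?thesis by simp
  qed
  have norm_g: "norm (g x) = 2 * cos (x $ 1)" "0 < cos (x $ 1)" if "x \<in> S" for x
  proof -
    show "0 < cos (x $ 1)" using that by (intro cos_gt_zero) (auto simp: S)
    then show "norm (g x) = 2 * cos (x $ 1)" by (simp add: g_def)
  qed
  have inj: "inj_on g S"
  proof (rule inj_onI)
    fix x y assume x: "x \<in> S" and y: "y \<in> S" and eq: "g x = g y"
    have "cos (x $ 1) = cos (y $ 1)" using norm_g[OF x] norm_g[OF y] eq by simp
    moreover have "0 \<le> x $ 1" "x $ 1 \<le> pi" "0 \<le> y $ 1" "y $ 1 \<le> pi"
      using x y pi_gt_zero unfolding S by linarith+
    ultimately have 1: "x $ 1 = y $ 1" by (metis cos_inj_pi)
    then have "circ (x $ 2) = circ (y $ 2)" using eq norm_g[OF y] by (simp add: g_def)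
    then have "x $ 2 = y $ 2" using x y by (intro circ_inj) (auto simp: S)
    with 1 show "x = y" by (simp add: vec_eq_iff forall_2)
  qed
  have sub: "g ` S \<subseteq> ball 0 2"
  proof
    fix z assume "z \<in> g ` S"
    then obtain x where x: "x \<in> S" "z = g x" by auto
    have "0 < x $ 1" "x $ 1 \<le> pi" using x pi_gt_zero unfolding S by linarith+
    then have "cos (x $ 1) < cos 0" by (intro cos_monotone_0_pi) simp_all
    then show "z \<in> ball 0 2" using norm_g[OF x(1)] x by simp
  qed
  \<comment> \<open>The open rectangle misses the centre and the ray at angle 0; both lie on the
    line x $ 2 = 0.\<close>
  have neg: "negligible (ball 0 2 - g ` S)"
  proof (rule negligible_subset)
    show "negligible {x :: real ^ 2. x $ 2 = 0}" by (rule negligible_standard_hyperplane_cart)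
    show "ball 0 2 - g ` S \<subseteq> {x. x $ 2 = 0}"
    proof (rule subsetI, rule ccontr)
      fix z :: "real ^ 2" assume z: "z \<in> ball 0 2 - g ` S" "z \<notin> {x. x $ 2 = 0}"
      then have nz: "z \<noteq> 0" and z2: "z $ 2 \<noteq> 0" by auto
      have "norm (z /\<^sub>R norm z) = 1" using nz by simp
      then obtain s where s: "0 \<le> s" "s < 2 * pi" "z /\<^sub>R norm z = circ s" by (rule unit_circ)
      then have zs: "z = norm z *\<^sub>R circ s" using nz by (metis divideR_right norm_eq_zero)
      have "s \<noteq> 0"
      proof
        assume "s = 0"
        then have "z $ 2 = 0" by (subst zs) simp
        with z2 show False by simp
      qed
      define r where "r = norm z"
      have r: "0 < r" "r < 2" using z nz by (auto simp: r_def)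
      define a where "a = arccos (r / 2)"
      have ca: "cos a = r / 2" unfolding a_def using r by (intro cos_arccos) auto
      have "arccos 1 < a" unfolding a_def using r by (intro arccos_less_arccos) auto
      moreover have "a < arccos 0" unfolding a_def using r by (intro arccos_less_arccos) auto
      ultimately have "vector [a, s] \<in> S" using s \<open>s \<noteq> 0\<close> by (simp add: S vector_2 arccos_0)
      moreover have "g (vector [a, s]) = z" by (subst zs) (simp add: g_def vector_2 ca r_def)
      ultimately show False using z by blast
    qed
  qed
  have H_int: "set_integrable lborel A H" if "A \<in> sets borel" "emeasure lborel A < \<infinity>" for A
    unfolding set_integrable_def
  proof (rule Bochner_Integration.integrable_bound)
    show "integrable lborel (\<lambda>x. B * indicator A x :: real)"
      using that by (simp add: integrable_indicator_iff)
    show "AE x in lborel. norm (indicat_real A x *\<^sub>R H x) \<le> norm (B * indicator A x :: real)"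
      using B by (auto simp: indicator_def intro: order_trans[OF _ abs_ge_self])
  qed (use that in measurable)
  \<comment> \<open>The change of variables theorem applied below concerns vector-valued integrands,
    so H is read as a map into \<open>real ^ 1\<close>.\<close>
  define f :: "real ^ 2 \<Rightarrow> real ^ 1" where "f x = vec (H x)" for x
  have J_meas: "(\<lambda>v. indicator S v * (2 * sin (2 * v $ 1) * H (g v))) \<in> borel_measurable borel"
    unfolding g_eq by measurable
  have J_int: "integrable lborel (\<lambda>v. indicator S v * (2 * sin (2 * v $ 1) * H (g v)))"
  proof (rule Bochner_Integration.integrable_bound)
    show "integrable lborel (\<lambda>x. 2 * B * indicator S x :: real)"
      using emeasure_bounded_finite[of S] by (simp add: integrable_indicator_iff S_def bounded_box)
    show "AE v in lborel. norm (indicator S v * (2 * sin (2 * v $ 1) * H (g v))) \<le> norm (2 * B * indicator S v :: real)"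
    proof (rule AE_I2)
      fix v
      have "\<bar>sin (2 * v $ 1)\<bar> * \<bar>H (g v)\<bar> \<le> 1 * B" by (intro mult_mono B) auto
      then show "norm (indicator S v * (2 * sin (2 * v $ 1) * H (g v))) \<le> norm (2 * B * indicator S v :: real)"
        by (auto simp: indicator_def abs_mult mult.commute intro: order_trans[OF _ abs_ge_self])
    qed
  qed (use J_meas in simp)
  have J_abs: "(\<lambda>v. \<bar>det (matrix (g' v))\<bar> *\<^sub>R f (g v)) absolutely_integrable_on S"
    and J_eq: "integral S (\<lambda>v. \<bar>det (matrix (g' v))\<bar> *\<^sub>R f (g v)) $ 1 = (LINT v|lborel. indicator S v * (2 * sin (2 * v $ 1) * H (g v)))"
  proof -
    have si: "set_integrable lborel S (\<lambda>v. 2 * sin (2 * v $ 1) * H (g v))"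
      using J_int by (simp add: set_integrable_def)
    have "(\<lambda>v. 2 * sin (2 * v $ 1) * H (g v)) absolutely_integrable_on S"
      using J_int J_meas by (simp add: set_integrable_def integrable_completion)
    then have "(\<lambda>v. \<bar>det (matrix (g' v))\<bar> * H (g v)) absolutely_integrable_on S"
      by (subst set_integrable_cong[OF refl refl]) (simp_all add: det)
    then show 1: "(\<lambda>v. \<bar>det (matrix (g' v))\<bar> *\<^sub>R f (g v)) absolutely_integrable_on S"
      by (subst absolutely_integrable_on_iff_component) (simp_all add: f_def S_def)
    have "integral S (\<lambda>v. \<bar>det (matrix (g' v))\<bar> *\<^sub>R f (g v)) $ 1 = integral S (\<lambda>v. (\<bar>det (matrix (g' v))\<bar> *\<^sub>R f (g v)) $ 1)"
      using set_lebesgue_integral_eq_integral(1)[OF 1] by (rule integral_component_eq_cart[symmetric])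
    also have "\<dots> = integral S (\<lambda>v. 2 * sin (2 * v $ 1) * H (g v))"
      by (intro Henstock_Kurzweil_Integration.integral_cong) (simp add: f_def det)
    also have "\<dots> = (LINT v:S|lborel. 2 * sin (2 * v $ 1) * H (g v))"
      using set_borel_integral_eq_integral(2)[OF si] by simp
    finally show "integral S (\<lambda>v. \<bar>det (matrix (g' v))\<bar> *\<^sub>R f (g v)) $ 1 = (LINT v|lborel. indicator S v * (2 * sin (2 * v $ 1) * H (g v)))"
      by (simp add: set_lebesgue_integral_def)
  qed
  have "f absolutely_integrable_on (g ` S) \<and> integral (g ` S) f = integral S (\<lambda>v. \<bar>det (matrix (g' v))\<bar> *\<^sub>R f (g v))"
    using has_absolute_integral_change_of_variables[OF _ der inj, of f] J_abs S_borel by auto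
  then have f_abs: "f absolutely_integrable_on (g ` S)"
    and f_eq: "integral (g ` S) f = integral S (\<lambda>v. \<bar>det (matrix (g' v))\<bar> *\<^sub>R f (g v))" by auto
  have "(LINT x:ball 0 2|lborel. H x) = integral (ball 0 2) H"
    by (rule set_borel_integral_eq_integral(2)[OF H_int]) (auto simp: emeasure_bounded_finite[simplified])
  also have "\<dots> = integral (g ` S) H"
  proof (rule integral_spike_set)
    show "negligible {x \<in> ball 0 2 - g ` S. H x \<noteq> 0}" by (rule negligible_subset[OF neg]) auto
    have "{x \<in> g ` S - ball 0 2. H x \<noteq> 0} = {}" using sub by auto
    then show "negligible {x \<in> g ` S - ball 0 2. H x \<noteq> 0}" by (simp only: negligible_empty)
  qed
  also have "\<dots> = integral (g ` S) (\<lambda>x. f x $ 1)" by (simp add: f_def)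
  also have "\<dots> = integral (g ` S) f $ 1"
    using set_lebesgue_integral_eq_integral(1)[OF f_abs] by (rule integral_component_eq_cart)
  also have "\<dots> = (LINT v|lborel. indicator S v * (2 * sin (2 * v $ 1) * H (g v)))"
    unfolding f_eq J_eq ..
  also have "\<dots> = (LINT x|lborel. LINT y|lborel. indicator S (vector [x, y]) * (2 * sin (2 * x) * H (g (vector [x, y]))))"
    using integral_real_2[OF J_int] by (simp add: vector_2)
  also have "\<dots> = (LINT x|lborel. LINT y|lborel. (indicator {0<..<pi/2} x * (2 * sin (2 * x))) * (indicator {0<..<2*pi} y * H ((2 * cos x) *\<^sub>R circ y)))"
  proof (intro Bochner_Integration.integral_cong refl)
    fix x y :: real
    show "indicator S (vector [x, y]) * (2 * sin (2 * x) * H (g (vector [x, y]))) =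
      (indicator {0<..<pi/2} x * (2 * sin (2 * x))) * (indicator {0<..<2*pi} y * H ((2 * cos x) *\<^sub>R circ y))"
      by (auto simp: indicator_def S vector_2 g_def)
  qed
  also have "\<dots> = (LINT x|lborel. (indicator {0<..<pi/2} x * (2 * sin (2 * x))) * (LINT y|lborel. indicator {0<..<2*pi} y * H ((2 * cos x) *\<^sub>R circ y)))"
    by (simp only: integral_mult_right_zero)
  also have "\<dots> = (LINT x|lborel. (indicator {0<..<pi/2} x * (2 * sin (2 * x))) * ((2 * pi) * (LINT t|angle_measure. H ((2 * cos x) *\<^sub>R circ t))))"
  proof (intro Bochner_Integration.integral_cong refl arg_cong2[where f="(*)"])
    fix x :: real
    have "(LINT t|angle_measure. H ((2 * cos x) *\<^sub>R circ t)) = (LINT t:{0..<2 * pi}|lborel. H ((2 * cos x) *\<^sub>R circ t)) / (2 * pi)"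
      by (rule integral_ang) measurable
    also have "(LINT t:{0..<2 * pi}|lborel. H ((2 * cos x) *\<^sub>R circ t)) = (LINT y|lborel. indicator {0<..<2*pi} y * H ((2 * cos x) *\<^sub>R circ y))"
      unfolding set_lebesgue_integral_def
    proof (rule integral_cong_AE)
      show "AE y in lborel. indicat_real {0..<2 * pi} y *\<^sub>R H ((2 * cos x) *\<^sub>R circ y) = indicat_real {0<..<2*pi} y * H ((2 * cos x) *\<^sub>R circ y)"
        using AE_lborel_singleton[of 0] by eventually_elim (auto simp: indicator_def)
    qed measurable
    finally show "(LINT y|lborel. indicator {0<..<2*pi} y * H ((2 * cos x) *\<^sub>R circ y)) = (2 * pi) * (LINT t|angle_measure. H ((2 * cos x) *\<^sub>R circ t))"
      by simp
  qed
  \<comment> \<open>The endpoint 0 may be added because the weight sin (2 x) vanishes there.\<close>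
  also have "\<dots> = (LINT x|lborel. (4 * pi) * (indicator {0..<pi/2} x *\<^sub>R (sin (2 * x) * (LINT t|angle_measure. H ((2 * cos x) *\<^sub>R circ t)))))"
  proof (intro Bochner_Integration.integral_cong refl)
    fix x :: real
    show "(indicator {0<..<pi/2} x * (2 * sin (2 * x))) * ((2 * pi) * (LINT t|angle_measure. H ((2 * cos x) *\<^sub>R circ t))) =
      (4 * pi) * (indicator {0..<pi/2} x *\<^sub>R (sin (2 * x) * (LINT t|angle_measure. H ((2 * cos x) *\<^sub>R circ t))))"
      by (cases "x = 0") (auto simp: indicator_def)
  qed
  finally show ?thesis by (simp add: set_lebesgue_integral_def)
qed

section \<open>The sum of two uniform points of the circle\<close>

lemma integrable_bounded_ang:
  fixes f :: "real \<Rightarrow> real"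
  assumes "f \<in> borel_measurable borel" "\<And>x. \<bar>f x\<bar> \<le> B"
  shows "integrable angle_measure f"
proof -
  interpret prob_space angle_measure by (rule prob_space_ang)
  show ?thesis
    by (rule integrable_const_bound[of _ B]) (use assms in auto)
qed

lemma integral_bounded_ang:
  fixes f :: "real \<Rightarrow> real"
  assumes "f \<in> borel_measurable borel" "\<And>x. \<bar>f x\<bar> \<le> B"
  shows "\<bar>LINT t|angle_measure. f t\<bar> \<le> B"
proof -
  interpret prob_space angle_measure by (rule prob_space_ang)
  have "\<bar>LINT t|angle_measure. f t\<bar> \<le> (LINT t|angle_measure. \<bar>f t\<bar>)" by (rule integral_abs_bound)
  also have "\<dots> \<le> (LINT t|angle_measure. B)"
    by (intro Bochner_Integration.integral_mono integrable_abs integrable_bounded_ang[OF assms] assms) auto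
  finally show ?thesis using prob_space by simp
qed

lemma circ_sum: "circ (t + s) + circ (t - s) = (2 * cos s) *\<^sub>R circ t"
  by (simp add: vec_eq_iff forall_2 cos_add cos_diff sin_add sin_diff)

lemma circ_add_pi: "circ (t + pi) = - circ t"
  by (simp add: vec_eq_iff forall_2)

text \<open>After rotating the first point by the angle of the second, t is the angle between them.
  Shifting s by - t / 2 then makes the two points symmetric about angle s, and their sum is 2 cos (t
  / 2) times \<open>circ s\<close>. So alpha = t / 2 is uniform on [0, pi); since the angular mean
  is unchanged when the radius changes sign (a rotation by pi), the second half folds onto [0,
  pi/2), giving the factor 2 / pi.\<close>

lemma sum_circ_polar:
  fixes H :: "real ^ 2 \<Rightarrow> real"
  assumes [measurable]: "H \<in> borel_measurable borel" and B: "\<And>x. \<bar>H x\<bar> \<le> B"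
  shows "(LINT s|angle_measure. LINT t|angle_measure. H (circ t + circ s)) = 2 / pi * (LINT \<alpha>:{0..<pi/2}|lborel. LINT t|angle_measure. H ((2 * cos \<alpha>) *\<^sub>R circ t))"
proof -
  interpret A: prob_space angle_measure by (rule prob_space_ang)
  interpret P: pair_prob_space angle_measure angle_measure ..
  have int_pair: "integrable (angle_measure \<Otimes>\<^sub>M angle_measure) (\<lambda>(s, t). H (circ (t + s) + circ s))"
    by (rule P.P.integrable_const_bound[of _ B]) (use B in auto)
  define M where "M c = (LINT t|angle_measure. H ((2 * c) *\<^sub>R circ t))" for c
  have M_meas [measurable]: "M \<in> borel_measurable borel" unfolding M_def by measurable
  have M_bound: "\<bar>M c\<bar> \<le> B" for c
    unfolding M_def by (rule integral_bounded_ang) (use B in auto)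
  have M_even: "M (- c) = M c" for c
  proof -
    have "M (- c) = (LINT t|angle_measure. H ((2 * - c) *\<^sub>R circ (t + pi)))"
      unfolding M_def by (rule integral_circ_shift[symmetric]) measurable
    then show ?thesis by (simp add: M_def circ_add_pi)
  qed
  have set_int: "set_integrable lborel S (\<lambda>x. M (cos x))" if "S \<in> sets borel" "bounded S" for S
    unfolding set_integrable_def
  proof (rule Bochner_Integration.integrable_bound)
    show "integrable lborel (\<lambda>x. B * indicator S x :: real)"
      using that emeasure_bounded_finite[of S] by (simp add: integrable_indicator_iff)
    show "AE x in lborel. norm (indicat_real S x *\<^sub>R M (cos x)) \<le> norm (B * indicator S x :: real)"
      using M_bound by (auto simp: indicator_def intro: order_trans[OF _ abs_ge_self])
  qed (use that in measurable)
  have "(LINT s|angle_measure. LINT t|angle_measure. H (circ t + circ s)) = (LINT s|angle_measure. LINT t|angle_measure. H (circ (t + s) + circ s))"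
    by (intro Bochner_Integration.integral_cong refl integral_circ_shift[symmetric, of "\<lambda>v. H (v + _)"]) measurable
  also have "\<dots> = (LINT t|angle_measure. LINT s|angle_measure. H (circ (t + s) + circ s))"
    using P.Fubini_integral[OF int_pair] by simp
  also have "\<dots> = (LINT t|angle_measure. M (cos (t / 2)))"
  proof (intro Bochner_Integration.integral_cong refl)
    fix t
    \<comment> \<open>For fixed t the integrand is written as a function of the point
      \<open>circ s\<close> alone, with \<open>circ (t + s)\<close> as its rotation by t, so that
      the shift by - t / 2 is covered by rotation invariance.\<close>
    define g where "g v = H (vector [v $ 1 * cos t - v $ 2 * sin t, v $ 1 * sin t + v $ 2 * cos t] + v)" for v :: "real ^ 2"
    have [measurable]: "g \<in> borel_measurable borel" unfolding g_def by measurable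
    have g: "g (circ s) = H (circ (t + s) + circ s)" for s
      unfolding g_def circ_add circ_nth by (simp add: add.commute)
    have "(LINT s|angle_measure. H (circ (t + s) + circ s)) = (LINT s|angle_measure. g (circ s))" by (simp only: g)
    also have "\<dots> = (LINT s|angle_measure. g (circ (s + (- t / 2))))"
      by (rule integral_circ_shift[symmetric]) measurable
    also have "\<dots> = (LINT s|angle_measure. H (circ (s + t / 2) + circ (s - t / 2)))"
    proof -
      have "t + (s + - t / 2) = s + t / 2" "s + - t / 2 = s - t / 2" for s by simp_all
      then show ?thesis unfolding g by (simp only:)
    qed
    also have "\<dots> = M (cos (t / 2))"
      unfolding circ_sum M_def ..
    finally show "(LINT s|angle_measure. H (circ (t + s) + circ s)) = M (cos (t / 2))" .
  qed
  also have "\<dots> = (LINT t:{0..<2 * pi}|lborel. M (cos (t / 2))) / (2 * pi)"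
    by (rule integral_ang) measurable
  also have "(LINT t:{0..<2 * pi}|lborel. M (cos (t / 2))) = 2 * (LINT t:{0..<pi}|lborel. M (cos t))"
    unfolding set_lebesgue_integral_def
    by (subst lborel_integral_real_affine[of 2 _ 0]) (auto simp: indicator_def intro!: Bochner_Integration.integral_cong)
  also have "(LINT t:{0..<pi}|lborel. M (cos t)) = (LINT t:{0..<pi/2}|lborel. M (cos t)) + (LINT t:{pi/2..<pi}|lborel. M (cos t))"
  proof -
    have "{0..<pi} = {0..<pi/2} \<union> {pi/2..<pi}" by auto
    then show ?thesis
      by (simp only:) (rule set_integral_Un; auto intro!: set_int)
  qed
  also have "(LINT t:{pi/2..<pi}|lborel. M (cos t)) = (LINT t:{0..<pi/2}|lborel. M (cos t))"
  proof -
    have "(LINT t:{pi/2..<pi}|lborel. M (cos t)) = (LINT t:{0<..pi/2}|lborel. M (cos t))"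
      unfolding set_lebesgue_integral_def
    proof (subst lborel_integral_real_affine[of "-1" _ pi])
      have "indicator {pi/2..<pi} (pi + - 1 * x) = (indicator {0<..pi/2} x :: real)" for x
        by (auto simp: indicator_def)
      moreover have "M (cos (pi + - 1 * x)) = M (cos x)" for x
        using M_even[of "cos x"] by simp
      ultimately show "\<bar>- 1\<bar> *\<^sub>R (LBINT x. indicator {pi/2..<pi} (pi + - 1 * x) *\<^sub>R M (cos (pi + - 1 * x))) =
         (LBINT x. indicator {0<..pi/2} x *\<^sub>R M (cos x))" by simp
    qed simp
    also have "\<dots> = (LINT t:{0..<pi/2}|lborel. M (cos t))"
      unfolding set_lebesgue_integral_def
    proof (rule integral_cong_AE)
      show "AE t in lborel. indicat_real {0<..pi/2} t *\<^sub>R M (cos t) = indicat_real {0..<pi/2} t *\<^sub>R M (cos t)"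
        using AE_lborel_singleton[of 0] AE_lborel_singleton[of "pi/2"]
        by eventually_elim (auto simp: indicator_def)
    qed measurable
    finally show ?thesis .
  qed
  finally show ?thesis by (simp add: M_def)
qed

section \<open>The error in replacing the density\<close>

text \<open>The convex function - sin lies below its chord on [0, pi/2]. The inequality bounds
  chords and radii below by angles, as is required when they carry negative exponents.\<close>

lemma jordan_sin:
  assumes "0 \<le> x" "x \<le> pi / 2"
  shows "2 / pi * x \<le> sin x"
proof -
  have "convex_on {0..pi/2} (\<lambda>x. - sin x)"
  proof (rule f''_ge0_imp_convex)
    show "((\<lambda>x. - sin x) has_real_derivative - cos x) (at x)" for x :: real
      by (auto intro!: derivative_eq_intros)
    show "((\<lambda>x. - cos x) has_real_derivative sin x) (at x)" for x :: real
      by (auto intro!: derivative_eq_intros)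
    show "0 \<le> sin x" if "x \<in> {0..pi/2}" for x using that by (intro sin_ge_zero) auto
  qed simp
  from convex_onD_Icc[OF this, of "2 / pi * x"] show ?thesis
    using assms by (simp add: field_simps)
qed

lemma integrable_powr_singularity:
  assumes "- 1 < a"
  shows "integrable lborel (\<lambda>x::real. indicator {-L..L} (x - c) * \<bar>x - c\<bar> powr a)"
proof (cases "0 \<le> L")
  case True
  have "(\<integral>\<^sup>+x. ennreal (x powr a) * indicator {0..L} x \<partial>lborel) = ennreal (L powr (a + 1) / (a + 1))"
    by (rule nn_integral_has_integral_lebesgue'[OF _ has_integral_powr_from_0]) (use assms True in auto)
  then have "integrable lborel (\<lambda>x. indicator {0..L} x * x powr a)"
    by (intro integrableI_nonneg) (auto simp: ennreal_mult' mult.commute ennreal_indicator)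
  note i = this
  have "integrable lborel (\<lambda>x. indicator {0..L} (- c + 1 * x) * (- c + 1 * x) powr a + indicator {0..L} (c + (-1) * x) * (c + (-1) * x) powr a)"
    by (intro Bochner_Integration.integrable_add lborel_integrable_real_affine[OF i]) auto
  then show ?thesis
    by (rule Bochner_Integration.integrable_bound) (auto simp: indicator_def abs_if)
next
  case False
  then have "{-L..L} = {}" by auto
  then show ?thesis by simp
qed

lemma AE_circ_neq:
  assumes "norm w = 1"
  shows "AE t in angle_measure. circ t \<noteq> w"
proof -
  obtain s where s: "0 \<le> s" "s < 2 * pi" "w = circ s" using unit_circ[OF assms] .
  show ?thesis unfolding angle_measure_def
  proof (rule AE_uniform_measureI)
    show "AE t in lborel. t \<in> {0..<2 * pi} \<longrightarrow> circ t \<noteq> w"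
      using AE_lborel_singleton[of s] by eventually_elim (use s circ_inj in auto)
  qed simp
qed

text \<open>The chord is at least (2 / pi) t, and t^(-4/5) is integrable at 0; by rotation
  invariance the bound is uniform in w. It serves twice: for the angular singularities of the
  product of transforms, and for the square of |a + b|^(-2/5).\<close>

lemma chord_singularity:
  "\<exists>L\<ge>0. \<forall>w. norm w = 1 \<longrightarrow> integrable angle_measure (\<lambda>t. norm (w - circ t) powr (-4/5)) \<and>
    (LINT t|angle_measure. norm (w - circ t) powr (-4/5)) \<le> L"
proof -
  let ?h = "\<lambda>t::real. indicator {-pi..pi} (t - 0) * \<bar>t - 0\<bar> powr (-4/5) * (2 / pi) powr (-4/5)"
  have i: "integrable lborel ?h"
    by (intro Bochner_Integration.integrable_mult_left integrable_powr_singularity) simp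
  define L where "L = (LINT t|lborel. ?h t) / pi"
  have L0: "0 \<le> L" unfolding L_def by (intro divide_nonneg_pos Bochner_Integration.integral_nonneg) auto
  have nn: "(\<integral>\<^sup>+ t. ennreal (norm (w - circ t) powr (-4/5)) \<partial>angle_measure) \<le> ennreal L" if w: "norm w = 1" for w
  proof -
    have "(\<integral>\<^sup>+ t. ennreal (norm (w - circ t) powr (-4/5)) \<partial>angle_measure)
        = (\<integral>\<^sup>+ t. ennreal ((2 * sin (t / 2)) powr (-4/5)) * indicator {0..pi} t \<partial>lborel) / ennreal pi"
      by (rule nn_integral_chord[OF w]) measurable
    also have "\<dots> \<le> (\<integral>\<^sup>+ t. ennreal (?h t) \<partial>lborel) / ennreal pi"
    proof (intro divide_right_mono_ennreal nn_integral_mono)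
      fix t :: real
      show "ennreal ((2 * sin (t / 2)) powr (-4/5)) * indicator {0..pi} t \<le> ennreal (?h t)"
      proof (cases "0 < t \<and> t \<le> pi")
        case True
        have "2 / pi * (t / 2) \<le> sin (t / 2)" using True by (intro jordan_sin) auto
        then have "2 / pi * t \<le> 2 * sin (t / 2)" by simp
        then have "(2 * sin (t / 2)) powr (-4/5) \<le> (2 / pi * t) powr (-4/5)"
          using True by (intro powr_mono2') auto
        also have "\<dots> = t powr (-4/5) * (2 / pi) powr (-4/5)"
          using True by (subst powr_mult) auto
        finally show ?thesis using True by (auto simp: indicator_def intro!: ennreal_leI)
      next
        case False
        then show ?thesis by (cases "t = 0") (auto simp: indicator_def)
      qed
    qed
    also have "(\<integral>\<^sup>+ t. ennreal (?h t) \<partial>lborel) = ennreal (LINT t|lborel. ?h t)"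
      by (rule nn_integral_eq_integral[OF i]) simp
    also have "\<dots> / ennreal pi = ennreal L"
      unfolding L_def by (rule divide_ennreal) (auto intro: Bochner_Integration.integral_nonneg)
    finally show ?thesis .
  qed
  have int: "integrable angle_measure (\<lambda>t. norm (w - circ t) powr (-4/5))" if w: "norm w = 1" for w
    using nn[OF w] by (intro integrableI_nonneg) (auto simp: top_unique less_top[symmetric] intro: le_less_trans)
  have "(LINT t|angle_measure. norm (w - circ t) powr (-4/5)) \<le> L" if w: "norm w = 1" for w
    using nn[OF w] L0 by (subst (asm) nn_integral_eq_integral[OF int[OF w]]) auto
  with L0 int show ?thesis by blast
qed

text \<open>The radius 2 cos alpha equals 1 at alpha = pi/3, where sin (2 alpha) = sqrt 3 / 2. So
  the left side is the mismatch of the two weights, normalised to vanish on the unit circle, and the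
  bound records that it vanishes to first order.\<close>

lemma weight_bound: "\<bar>1 - 2 / sqrt 3 * sin (2 * \<alpha>)\<bar> \<le> 4 * \<bar>\<alpha> - pi / 3\<bar>"
proof -
  have s3: "sin (2 * (pi / 3)) = sqrt 3 / 2" unfolding sin_double sin_60 cos_60 by simp
  have "1 - 2 / sqrt 3 * sin (2 * \<alpha>) = 2 / sqrt 3 * (sin (2 * (pi / 3)) - sin (2 * \<alpha>))"
    unfolding s3 by (simp add: right_diff_distrib)
  also have "sin (2 * (pi / 3)) - sin (2 * \<alpha>) = 2 * sin ((2 * (pi / 3) - 2 * \<alpha>) / 2) * cos ((2 * (pi / 3) + 2 * \<alpha>) / 2)"
    by (rule sin_diff_sin)
  finally have "\<bar>1 - 2 / sqrt 3 * sin (2 * \<alpha>)\<bar> = 4 / sqrt 3 * (\<bar>sin (pi / 3 - \<alpha>)\<bar> * \<bar>cos (pi / 3 + \<alpha>)\<bar>)"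
    by (simp add: abs_mult diff_divide_distrib add_divide_distrib)
  also have "\<dots> \<le> 4 * (\<bar>\<alpha> - pi / 3\<bar> * 1)"
  proof (intro mult_mono)
    show "\<bar>sin (pi / 3 - \<alpha>)\<bar> \<le> \<bar>\<alpha> - pi / 3\<bar>"
      using Maclaurin_sin_bound[of "pi / 3 - \<alpha>" 1] by (simp add: sin_coeff_def abs_minus_commute)
    have "1 \<le> sqrt (3::real)" by simp
    then show "4 / sqrt 3 \<le> (4::real)" by (simp add: field_simps)
  qed auto
  finally show ?thesis by simp
qed

text \<open>In the product formula for cos alpha - cos (pi/3) the argument (alpha + pi/3) / 2 lies
  between pi/6 and pi/2, so its sine is at least 1/2; the other sine is handled by Jordan's
  inequality.\<close>

lemma radius_bound:
  assumes "0 \<le> \<alpha>" "\<alpha> \<le> pi / 2"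
  shows "2 / pi * \<bar>\<alpha> - pi / 3\<bar> \<le> \<bar>2 * cos \<alpha> - 1\<bar>"
proof -
  have "2 * cos \<alpha> - 1 = 2 * (cos \<alpha> - cos (pi / 3))" by (simp add: cos_60)
  also have "cos \<alpha> - cos (pi / 3) = 2 * sin ((\<alpha> + pi / 3) / 2) * sin ((pi / 3 - \<alpha>) / 2)"
    by (rule cos_diff_cos)
  finally have "\<bar>2 * cos \<alpha> - 1\<bar> = 4 * \<bar>sin ((\<alpha> + pi / 3) / 2)\<bar> * \<bar>sin ((pi / 3 - \<alpha>) / 2)\<bar>"
    by (simp add: abs_mult)
  moreover have "1 / 2 \<le> \<bar>sin ((\<alpha> + pi / 3) / 2)\<bar>"
  proof -
    have "sin (pi / 6) \<le> sin ((\<alpha> + pi / 3) / 2)"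
      using assms by (intro sin_monotone_2pi_le) auto
    then show ?thesis by (simp add: sin_30)
  qed
  moreover have "2 / pi * (\<bar>\<alpha> - pi / 3\<bar> / 2) \<le> \<bar>sin ((pi / 3 - \<alpha>) / 2)\<bar>"
  proof -
    have "\<bar>\<alpha> - pi / 3\<bar> / 2 \<le> pi / 2"
    proof -
      have "- pi \<le> \<alpha> - pi / 3" "\<alpha> - pi / 3 \<le> pi" using assms pi_gt_zero by linarith+
      then show ?thesis by (simp add: abs_le_iff)
    qed
    then have "2 / pi * (\<bar>\<alpha> - pi / 3\<bar> / 2) \<le> sin (\<bar>\<alpha> - pi / 3\<bar> / 2)"
      by (intro jordan_sin) auto
    also have "\<dots> \<le> \<bar>sin ((pi / 3 - \<alpha>) / 2)\<bar>"
    proof (cases "\<alpha> \<le> pi / 3")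
      case False
      then have "\<bar>\<alpha> - pi / 3\<bar> / 2 = (\<alpha> - pi / 3) / 2" by simp
      moreover have "(pi / 3 - \<alpha>) / 2 = - ((\<alpha> - pi / 3) / 2)"
        by (simp only: minus_divide_left minus_diff_eq)
      ultimately show ?thesis by (simp only: sin_minus abs_minus_cancel abs_ge_self)
    qed auto
    finally show ?thesis .
  qed
  ultimately have "4 * (1 / 2) * (2 / pi * (\<bar>\<alpha> - pi / 3\<bar> / 2)) \<le> \<bar>2 * cos \<alpha> - 1\<bar>"
    by (simp only:) (intro mult_mono, auto)
  then show ?thesis by simp
qed

text \<open>Of the total decay exponent 3 of the two factors, 9/5 is given to the radial variable,
  4/5 to the angular variable and 2/5 to the separation of the two singular points: each of the
  three resulting singularities is integrable, the last one even after squaring.\<close>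

lemma kernel_pointwise:
  fixes u v :: "real ^ 2"
  assumes u: "norm u = 1" and v: "norm v = 1" and uv: "u \<noteq> v"
    and r: "0 \<le> r" "r \<noteq> 1" and t: "circ t \<noteq> u" "circ t \<noteq> v"
  shows "(norm (r *\<^sub>R circ t - u) * norm (r *\<^sub>R circ t - v)) powr (-3/2) \<le>
    \<bar>r - 1\<bar> powr (-9/5) * (norm (u - v) / 2) powr (-2/5) *
      ((norm (u - circ t) / 2) powr (-4/5) + (norm (v - circ t) / 2) powr (-4/5))"
proof -
  have key: "(norm (r *\<^sub>R circ t - u) * norm (r *\<^sub>R circ t - v)) powr (-3/2) \<le>
    \<bar>r - 1\<bar> powr (-9/5) * (norm (u - v) / 2) powr (-2/5) * (norm (u - circ t) / 2) powr (-4/5)"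
    if u: "norm u = 1" and uv: "u \<noteq> v" and t: "circ t \<noteq> u"
      and le: "norm (r *\<^sub>R circ t - u) \<le> norm (r *\<^sub>R circ t - v)" for u v :: "real ^ 2"
  proof -
    define X Y where "X = norm (r *\<^sub>R circ t - u)" and "Y = norm (r *\<^sub>R circ t - v)"
    have X1: "\<bar>r - 1\<bar> \<le> X"
      using norm_triangle_ineq3[of "r *\<^sub>R circ t" u] r u by (simp add: X_def)
    have "norm (u - circ t) \<le> norm (r *\<^sub>R circ t - u) + norm (circ t - r *\<^sub>R circ t)"
      using norm_triangle_ineq[of "u - r *\<^sub>R circ t" "r *\<^sub>R circ t - circ t"]
      by (simp add: norm_minus_commute)
    also have "circ t - r *\<^sub>R circ t = (1 - r) *\<^sub>R circ t" by (simp add: scaleR_left_diff_distrib)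
    finally have X2: "norm (u - circ t) / 2 \<le> X" using X1 by (simp add: X_def abs_minus_commute)
    have "norm (u - v) \<le> X + Y"
      using norm_triangle_ineq[of "u - r *\<^sub>R circ t" "r *\<^sub>R circ t - v"]
      by (simp add: X_def Y_def norm_minus_commute)
    then have Y1: "norm (u - v) / 2 \<le> Y" using le by (simp add: X_def Y_def)
    have X0: "0 < X" using X1 r by linarith
    have XY: "X \<le> Y" using le by (simp add: X_def Y_def)
    have Y0: "0 < Y" using X0 XY by linarith
    \<comment> \<open>X is the smaller distance. From the exponent 3/2 of Y, 2/5 is spent on |u - v|
      / 2 <= Y and the remaining 11/10 is passed on to X by X <= Y. X then carries 3/2 + 11/10 = 9/5
      + 4/5, spent on |r - 1| <= X and |u - circ t| / 2 <= X.\<close>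
    have "(X * Y) powr (-3/2) = X powr (-3/2) * (Y powr (-11/10) * Y powr (-2/5))"
      using X0 Y0 by (simp add: powr_mult flip: powr_add)
    also have "\<dots> \<le> X powr (-3/2) * (X powr (-11/10) * (norm (u - v) / 2) powr (-2/5))"
      using X0 XY Y1 uv by (intro mult_left_mono mult_mono powr_mono2') auto
    also have "\<dots> = X powr (-9/5) * (norm (u - v) / 2) powr (-2/5) * X powr (-4/5)"
      using X0 by (simp add: mult_ac flip: powr_add mult.assoc)
    also have "\<dots> \<le> \<bar>r - 1\<bar> powr (-9/5) * (norm (u - v) / 2) powr (-2/5) * (norm (u - circ t) / 2) powr (-4/5)"
      using X1 X2 r t uv by (intro mult_mono powr_mono2') auto
    finally show ?thesis by (simp add: X_def Y_def)
  qed
  show ?thesis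
  proof (cases "norm (r *\<^sub>R circ t - u) \<le> norm (r *\<^sub>R circ t - v)")
    case True
    have "(norm (r *\<^sub>R circ t - u) * norm (r *\<^sub>R circ t - v)) powr (-3/2) \<le>
        \<bar>r - 1\<bar> powr (-9/5) * (norm (u - v) / 2) powr (-2/5) * (norm (u - circ t) / 2) powr (-4/5)"
      by (rule key[OF u uv t(1) True])
    also have "\<dots> \<le> \<bar>r - 1\<bar> powr (-9/5) * (norm (u - v) / 2) powr (-2/5) *
      ((norm (u - circ t) / 2) powr (-4/5) + (norm (v - circ t) / 2) powr (-4/5))"
      by (intro mult_left_mono) auto
    finally show ?thesis .
  next
    case False
    then have "norm (r *\<^sub>R circ t - v) \<le> norm (r *\<^sub>R circ t - u)" by simp
    from key[OF v uv[symmetric] t(2) this]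
    have "(norm (r *\<^sub>R circ t - u) * norm (r *\<^sub>R circ t - v)) powr (-3/2) \<le>
        \<bar>r - 1\<bar> powr (-9/5) * (norm (u - v) / 2) powr (-2/5) * (norm (v - circ t) / 2) powr (-4/5)"
      by (simp add: mult.commute norm_minus_commute)
    also have "\<dots> \<le> \<bar>r - 1\<bar> powr (-9/5) * (norm (u - v) / 2) powr (-2/5) *
      ((norm (u - circ t) / 2) powr (-4/5) + (norm (v - circ t) / 2) powr (-4/5))"
      by (intro mult_left_mono) auto
    finally show ?thesis .
  qed
qed

section \<open>The product of two disc transforms and its integral\<close>

definition Q_real :: "real \<Rightarrow> real ^ 2 \<Rightarrow> real" where
  "Q_real R \<xi> = R\<^sup>2 * disc_ft (R * norm \<xi>)"

text \<open>The integrand of the kernel depends on the two circle points only through their sum,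
  which is the argument here.\<close>

definition Q_pair :: "real \<Rightarrow> real ^ 2 \<Rightarrow> real ^ 2 \<Rightarrow> real ^ 2 \<Rightarrow> real" where
  "Q_pair R a b \<eta> = Q_real R (a + \<eta>) * Q_real R (b - \<eta>)"

definition K_real :: "real \<Rightarrow> real ^ 2 \<Rightarrow> real ^ 2 \<Rightarrow> real" where
  "K_real R a b = (LINT s|angle_measure. LINT t|angle_measure. Q_pair R a b (circ t + circ s))"

lemma measurable_Q_real [measurable]: "Q_real R \<in> borel_measurable borel"
  unfolding Q_real_def by measurable

lemma measurable_Q_pair [measurable]: "Q_pair R a b \<in> borel_measurable borel"
  unfolding Q_pair_def by measurable

lemma Q_real_bound: "\<bar>Q_real R \<xi>\<bar> \<le> 4 * R\<^sup>2"
  using mult_left_mono[OF disc_ft_bound[of "R * norm \<xi>"], of "R\<^sup>2"] by (simp add: Q_real_def abs_mult)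

lemma Q_pair_bound: "\<bar>Q_pair R a b \<eta>\<bar> \<le> 16 * R ^ 4"
  using mult_mono[OF Q_real_bound[of R "a + \<eta>"] Q_real_bound[of R "b - \<eta>"]]
  by (simp add: Q_pair_def abs_mult flip: power_add)

text \<open>R^2 (R |x|)^(-3/2) = sqrt R |x|^(-3/2). The loss from R^2 to sqrt R is what makes the
  product of two such factors only linear in R.\<close>

lemma Q_real_decay:
  assumes R: "0 < R" and \<xi>: "\<xi> \<noteq> 0"
  shows "\<bar>Q_real R \<xi>\<bar> \<le> 20 * sqrt R * norm \<xi> powr (-3/2)"
proof -
  have "\<bar>disc_ft (R * norm \<xi>)\<bar> * (R powr (3/2) * norm \<xi> powr (3/2)) \<le> 20"
    using disc_ft_decay[of "R * norm \<xi>"] R by (simp add: powr_mult)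
  then have "\<bar>disc_ft (R * norm \<xi>)\<bar> * (R powr (3/2) * norm \<xi> powr (3/2)) * (sqrt R * norm \<xi> powr (-3/2)) \<le> 20 * (sqrt R * norm \<xi> powr (-3/2))"
    using R by (intro mult_right_mono) auto
  moreover have "R powr (3/2) * sqrt R = R\<^sup>2"
    using R powr_add[of R "3/2" "1/2"] by (simp add: powr_half_sqrt powr_realpow[of R 2, simplified])
  moreover have "norm \<xi> powr (3/2) * norm \<xi> powr (-3/2) = 1"
    using \<xi> by (simp flip: powr_add)
  ultimately have "\<bar>disc_ft (R * norm \<xi>)\<bar> * R\<^sup>2 \<le> 20 * (sqrt R * norm \<xi> powr (-3/2))"
  proof -
    assume 1: "\<bar>disc_ft (R * norm \<xi>)\<bar> * (R powr (3/2) * norm \<xi> powr (3/2)) * (sqrt R * norm \<xi> powr (-3/2)) \<le> 20 * (sqrt R * norm \<xi> powr (-3/2))"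
      and 2: "R powr (3/2) * sqrt R = R\<^sup>2" and 3: "norm \<xi> powr (3/2) * norm \<xi> powr (-3/2) = 1"
    have eq: "\<bar>disc_ft (R * norm \<xi>)\<bar> * (R powr (3/2) * norm \<xi> powr (3/2)) * (sqrt R * norm \<xi> powr (-3/2))
      = \<bar>disc_ft (R * norm \<xi>)\<bar> * (R powr (3/2) * sqrt R) * (norm \<xi> powr (3/2) * norm \<xi> powr (-3/2))"
      by (simp only: mult_ac)
    from 1[unfolded eq 2 3] show ?thesis by simp
  qed
  then show ?thesis by (simp add: Q_real_def abs_mult mult_ac)
qed

lemma Q_pair_decay:
  assumes R: "0 < R" and ne: "\<eta> \<noteq> - a" "\<eta> \<noteq> b"
  shows "\<bar>Q_pair R a b \<eta>\<bar> \<le> 400 * R * (norm (\<eta> - - a) * norm (\<eta> - b)) powr (-3/2)"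
proof -
  have "a + \<eta> \<noteq> 0" using ne by (metis add_eq_0_iff)
  moreover have "b - \<eta> \<noteq> 0" using ne by simp
  ultimately have "\<bar>Q_pair R a b \<eta>\<bar> \<le> (20 * sqrt R * norm (a + \<eta>) powr (-3/2)) * (20 * sqrt R * norm (b - \<eta>) powr (-3/2))"
    unfolding Q_pair_def abs_mult using R by (intro mult_mono Q_real_decay) auto
  also have "\<dots> = 400 * (sqrt R * sqrt R) * (norm (a + \<eta>) powr (-3/2) * norm (b - \<eta>) powr (-3/2))"
    by simp
  also have "\<dots> = 400 * R * (norm (\<eta> - - a) * norm (\<eta> - b)) powr (-3/2)"
    using R by (simp add: powr_mult norm_minus_commute add.commute)
  finally show ?thesis .
qed

text \<open>A substitute for |x|^(-3) at infinity, in product form so that its integrability reduces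
  to the line.\<close>

definition planar_weight :: "real ^ 2 \<Rightarrow> real" where
  "planar_weight \<eta> = (1 + \<bar>\<eta> $ 1\<bar>) powr (-3/2) * (1 + \<bar>\<eta> $ 2\<bar>) powr (-3/2)"

lemma integrable_planar_weight: "integrable lborel planar_weight"
proof -
  have "(\<integral>\<^sup>+x. ennreal (x powr (-3/2)) * indicator {1..} x \<partial>lborel) = ennreal (- (1 powr (-3/2 + 1)) / (-3/2 + 1))"
    by (rule nn_integral_has_integral_lebesgue'[OF _ has_integral_powr_to_inf]) auto
  then have "integrable lborel (\<lambda>x::real. indicator {1..} x * x powr (-3/2))"
    by (intro integrableI_nonneg) (auto simp: ennreal_mult' mult.commute ennreal_indicator)
  note i = this
  have "integrable lborel (\<lambda>x. indicator {1..} (1 + 1 * x) * (1 + 1 * x) powr (-3/2) + indicator {1..} (1 + (-1) * x) * (1 + (-1) * x) powr (-3/2) :: real)"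
    by (intro Bochner_Integration.integrable_add lborel_integrable_real_affine[OF i]) auto
  then have f: "integrable lborel (\<lambda>x::real. (1 + \<bar>x\<bar>) powr (-3/2))"
    by (rule Bochner_Integration.integrable_bound) (auto simp: indicator_def abs_if)
  have "integrable (lborel \<Otimes>\<^sub>M lborel) (\<lambda>(x, y). (1 + \<bar>x\<bar>) powr (-3/2) * (1 + \<bar>y\<bar>) powr (-3/2) :: real)"
    using f by (intro lborel_pair.Fubini_integrable) (auto simp: abs_mult)
  then have "integrable (lborel \<Otimes>\<^sub>M lborel) (\<lambda>z. planar_weight ((\<lambda>(x, y). vector [x, y]) z))"
    by (simp add: planar_weight_def vector_2 case_prod_beta')
  moreover have "planar_weight \<in> borel_measurable borel"
    unfolding planar_weight_def by measurable
  moreover have "(\<lambda>(x, y). vector [x, y] :: real ^ 2) \<in> borel_measurable (lborel \<Otimes>\<^sub>M lborel)"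
    by measurable
  ultimately have "integrable (distr (lborel \<Otimes>\<^sub>M lborel) borel (\<lambda>(x, y). vector [x, y] :: real ^ 2)) planar_weight"
    by (simp add: integrable_distr_eq)
  then show ?thesis by (simp add: lborel_real_2)
qed

lemma powr_square:
  assumes "0 \<le> (x::real)"
  shows "(x * x) powr (-3/2) = x powr (-3)"
proof -
  have "(x * x) powr (-3/2) = x powr (-3/2) * x powr (-3/2)" by (rule powr_mult)
  also have "\<dots> = x powr (-3/2 + -3/2)" by (rule powr_add[symmetric])
  finally show ?thesis by simp
qed

lemma planar_weight_lower:
  assumes "2 \<le> norm \<eta>"
  shows "norm \<eta> powr (-3) \<le> 8 * planar_weight \<eta>"
proof -
  have c: "\<bar>\<eta> $ 1\<bar> \<le> norm \<eta>" "\<bar>\<eta> $ 2\<bar> \<le> norm \<eta>" by (rule component_le_norm_cart)+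
  have "(1 + \<bar>\<eta> $ 1\<bar>) * (1 + \<bar>\<eta> $ 2\<bar>) \<le> (2 * norm \<eta>) * (2 * norm \<eta>)"
    using c assms by (intro mult_mono) auto
  then have "((2 * norm \<eta>) * (2 * norm \<eta>)) powr (-3/2) \<le> ((1 + \<bar>\<eta> $ 1\<bar>) * (1 + \<bar>\<eta> $ 2\<bar>)) powr (-3/2)"
    by (intro powr_mono2') (auto intro!: mult_pos_pos)
  also have "\<dots> = planar_weight \<eta>" by (simp add: planar_weight_def powr_mult)
  also have "((2 * norm \<eta>) * (2 * norm \<eta>)) powr (-3/2) = (2 * norm \<eta>) powr (-3)"
    by (rule powr_square) simp
  also have "\<dots> = norm \<eta> powr (-3) / 8"
    using assms by (simp add: powr_mult powr_minus_divide)
  finally show ?thesis by simp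
qed

text \<open>Both singular points have norm 1, so outside radius 2 they are at distance at least half
  the norm. The constant is 400 * 8 * 8: one 8 from these halves, one from
  \<open>planar_weight_lower\<close>. No sum of two circle points lies beyond radius 2; this region
  enters only through the planar integral.\<close>

lemma Q_pair_outside:
  assumes R: "0 < R" and a: "norm a = 1" and b: "norm b = 1" and \<eta>: "2 \<le> norm \<eta>"
  shows "\<bar>Q_pair R a b \<eta>\<bar> \<le> 25600 * R * planar_weight \<eta>"
proof -
  have X: "norm \<eta> / 2 \<le> norm (\<eta> - - a)" "norm \<eta> / 2 \<le> norm (\<eta> - b)"
    using norm_triangle_ineq2[of \<eta> "- a"] norm_triangle_ineq2[of \<eta> b] a b \<eta> by auto
  have "\<bar>Q_pair R a b \<eta>\<bar> \<le> 400 * R * (norm (\<eta> - - a) * norm (\<eta> - b)) powr (-3/2)"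
    using a b \<eta> by (intro Q_pair_decay R) auto
  also have "\<dots> \<le> 400 * R * (norm \<eta> / 2 * (norm \<eta> / 2)) powr (-3/2)"
    using X R \<eta> by (intro mult_left_mono powr_mono2' mult_mono) (auto intro!: mult_pos_pos)
  also have "(norm \<eta> / 2 * (norm \<eta> / 2)) powr (-3/2) = (norm \<eta> / 2) powr (-3)"
    by (rule powr_square) simp
  also have "\<dots> = 8 * norm \<eta> powr (-3)"
    using \<eta> by (simp add: powr_divide powr_minus_divide)
  also have "400 * R * (8 * norm \<eta> powr (-3)) \<le> 400 * R * (8 * (8 * planar_weight \<eta>))"
    using R \<eta> by (intro mult_left_mono planar_weight_lower) auto
  finally show ?thesis by simp
qed

lemma planar_weight_nonneg: "0 \<le> planar_weight \<eta>"
  by (simp add: planar_weight_def)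

lemma integrable_Q_pair:
  assumes R: "0 < R" and a: "norm a = 1" and b: "norm b = 1"
  shows "integrable lborel (Q_pair R a b)"
proof (rule Bochner_Integration.integrable_bound)
  show "integrable lborel (\<lambda>\<eta>. 16 * R ^ 4 * indicator (ball 0 2) \<eta> + 25600 * R * planar_weight \<eta>)"
    using emeasure_bounded_finite[of "ball (0::real ^ 2) 2"] integrable_planar_weight
    by (intro Bochner_Integration.integrable_add Bochner_Integration.integrable_mult_right)
      (simp_all add: integrable_indicator_iff)
  show "AE \<eta> in lborel. norm (Q_pair R a b \<eta>) \<le> norm (16 * R ^ 4 * indicator (ball 0 2) \<eta> + 25600 * R * planar_weight \<eta>)"
  proof (rule AE_I2)
    fix \<eta>
    have "\<bar>Q_pair R a b \<eta>\<bar> \<le> 16 * R ^ 4 * indicator (ball 0 2) \<eta> + 25600 * R * planar_weight \<eta>"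
    proof (cases "norm \<eta> < 2")
      case True
      then show ?thesis using Q_pair_bound[of R a b \<eta>] planar_weight_nonneg[of \<eta>] R
        by (simp add: add_increasing2)
    next
      case False
      then show ?thesis using Q_pair_outside[OF R a b, of \<eta>] by simp
    qed
    then show "norm (Q_pair R a b \<eta>) \<le> norm (16 * R ^ 4 * indicator (ball 0 2) \<eta> + 25600 * R * planar_weight \<eta>)"
      by simp
  qed
qed measurable

text \<open>Parseval for the indicator of the disc modulated by a and by b: the transforms are the
  translates of Q_R by a and b, and the product of the modulated indicators has frequency a + b. The
  indicator jumps only on the circle of radius R, a null set.\<close>

lemma integral_Q_pair:
  assumes R: "0 < R" and a: "norm a = 1" and b: "norm b = 1"
  shows "(LINT \<eta>|lborel. Q_pair R a b \<eta>) = 4 * pi\<^sup>2 * Q_real R (a + b)"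
proof -
  let ?e = "\<lambda>c x. indicator (ball 0 R) x *\<^sub>R exp (\<i> * of_real (c \<bullet> x)) :: complex"
  have Q: "(LINT x|lborel. ?e c x) = of_real (Q_real R c)" for c :: "real ^ 2"
    using Q_disc_eq[OF R, of c] by (simp add: Q_disc_def set_lebesgue_integral_def Q_real_def)
  have F: "(LINT x|lborel. ?e a x * exp (\<i> * of_real (y \<bullet> x))) = of_real (Q_real R (a + y))" for y
    unfolding Q[symmetric] by (intro Bochner_Integration.integral_cong refl)
      (simp add: inner_add_left distrib_left exp_add)
  have G: "(LINT x|lborel. ?e b x * exp (- \<i> * of_real (y \<bullet> x))) = of_real (Q_real R (b - y))" for y
    unfolding Q[symmetric] by (intro Bochner_Integration.integral_cong refl)
      (simp add: inner_diff_left right_diff_distrib exp_diff exp_minus divide_inverse)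
  have "(LINT y|lborel. complex_of_real (Q_real R (a + y)) * of_real (Q_real R (b - y))) =
      (2 * pi) ^ DIM(real ^ 2) * (LINT x|lborel. ?e a x * ?e b x)"
  proof (rule parseval[where f="?e a" and g="?e b" and B=1, unfolded F G])
    show "norm (?e b x) \<le> 1" for x by (simp add: indicator_def)
    have "sphere (0 :: real ^ 2) R \<in> null_sets lborel"
      using negligible_sphere[of "0 :: real ^ 2" R] by (simp add: negligible_iff_null_sets null_sets_completion_iff)
    then have "AE x in lborel. x \<notin> sphere (0 :: real ^ 2) R" by (rule AE_not_in)
    then show "AE x in lborel. isCont (?e b) x"
    proof eventually_elim
      fix x :: "real ^ 2" assume x: "x \<notin> sphere 0 R"
      have "isCont (\<lambda>x. indicator (ball 0 R) x :: real) x"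
        using x R by (simp add: isCont_indicator)
      then show "isCont (?e b) x" by (intro continuous_intros)
    qed
    show "integrable lborel (\<lambda>y. complex_of_real (Q_real R (a + y)) * of_real (Q_real R (b - y)))"
      using integrable_Q_pair[OF assms] by (simp add: Q_pair_def[abs_def] complex_of_real_integrable_eq flip: of_real_mult)
  qed (rule integrable_ball_exp)+
  also have "(LINT x|lborel. ?e a x * ?e b x) = of_real (Q_real R (a + b))"
    unfolding Q[symmetric] by (intro Bochner_Integration.integral_cong refl)
      (simp add: inner_add_left distrib_left exp_add indicator_def)
  finally have "complex_of_real (LINT \<eta>|lborel. Q_pair R a b \<eta>) = of_real ((2 * pi)\<^sup>2 * Q_real R (a + b))"
    by (simp add: Q_pair_def flip: of_real_mult)
  then show ?thesis by (simp only: of_real_eq_iff power_mult_distrib) simp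
qed

text \<open>\<open>kernel_pointwise\<close> integrated over the angle at fixed radius. In the
  constant 3200 = 400 * 4 * 2, the 4 comes from two angular singularities, each with a factor
  2^(4/5) <= 2 for its half distance, and the 2 from 2^(2/5) <= 2 for half of |a + b|.\<close>

lemma weighted_angular_bound:
  fixes u v :: "real ^ 2"
  assumes L: "0 \<le> L"
    "\<And>w. norm w = 1 \<Longrightarrow> integrable angle_measure (\<lambda>t. norm (w - circ t) powr (-4/5))"
    "\<And>w. norm w = 1 \<Longrightarrow> (LINT t|angle_measure. norm (w - circ t) powr (-4/5)) \<le> L"
    and R: "0 < R" and a: "norm a = 1" and b: "norm b = 1" and ab: "a + b \<noteq> 0"
    and r: "0 \<le> r" "r \<noteq> 1"
  shows "\<bar>LINT t|angle_measure. Q_pair R a b (r *\<^sub>R circ t)\<bar> \<le> 3200 * L * R * \<bar>r - 1\<bar> powr (-9/5) * norm (a + b) powr (-2/5)"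
proof -
  let ?D = "\<lambda>w t. norm (w - circ t) powr (-4/5)"
  define c where "c = 400 * R * (\<bar>r - 1\<bar> powr (-9/5) * (norm (a + b) / 2) powr (-2/5))"
  have c0: "0 \<le> c" using R by (simp add: c_def)
  have na: "norm (- a) = 1" using a by simp
  have ne: "- a \<noteq> b" using ab by (metis add.right_inverse)
  have nab: "norm (- a - b) = norm (a + b)" by (metis minus_add_distrib diff_conv_add_uminus norm_minus_cancel)
  have two: "(x / 2) powr (-4/5) \<le> 2 * x powr (-4/5)" if "0 \<le> x" for x :: real
  proof -
    have "(x / 2) powr (-4/5) = x powr (-4/5) * 2 powr (4/5)"
      using that by (simp add: powr_divide powr_minus_divide)
    also have "\<dots> \<le> x powr (-4/5) * 2"
      using powr_mono[of "4/5" 1 "2::real"] by (intro mult_left_mono) auto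
    finally show ?thesis by simp
  qed
  have ib: "integrable angle_measure (\<lambda>t. c * (2 * ?D (- a) t + 2 * ?D b t))"
    by (intro Bochner_Integration.integrable_mult_right Bochner_Integration.integrable_add L na b)
  have "\<bar>LINT t|angle_measure. Q_pair R a b (r *\<^sub>R circ t)\<bar> \<le> (LINT t|angle_measure. \<bar>Q_pair R a b (r *\<^sub>R circ t)\<bar>)"
    by (rule integral_abs_bound)
  also have "\<dots> \<le> (LINT t|angle_measure. c * (2 * ?D (- a) t + 2 * ?D b t))"
  proof (rule integral_mono_AE'[OF ib])
    show "AE t in angle_measure. \<bar>Q_pair R a b (r *\<^sub>R circ t)\<bar> \<le> c * (2 * ?D (- a) t + 2 * ?D b t)"
      using AE_circ_neq[OF na] AE_circ_neq[OF b]
    proof eventually_elim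
      fix t assume t: "circ t \<noteq> - a" "circ t \<noteq> b"
      have "norm (r *\<^sub>R circ t) \<noteq> 1" using r by simp
      then have "r *\<^sub>R circ t \<noteq> - a" "r *\<^sub>R circ t \<noteq> b" using na b by metis+
      then have "\<bar>Q_pair R a b (r *\<^sub>R circ t)\<bar> \<le> 400 * R * (norm (r *\<^sub>R circ t - - a) * norm (r *\<^sub>R circ t - b)) powr (-3/2)"
        by (rule Q_pair_decay[OF R])
      also have "\<dots> \<le> 400 * R * (\<bar>r - 1\<bar> powr (-9/5) * (norm (- a - b) / 2) powr (-2/5) *
        ((norm (- a - circ t) / 2) powr (-4/5) + (norm (b - circ t) / 2) powr (-4/5)))"
        using R by (intro mult_left_mono kernel_pointwise na b ne r t) auto
      also have "\<dots> = c * ((norm (- a - circ t) / 2) powr (-4/5) + (norm (b - circ t) / 2) powr (-4/5))"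
        unfolding nab c_def by (simp only: mult.assoc)
      also have "\<dots> \<le> c * (2 * ?D (- a) t + 2 * ?D b t)"
        by (intro mult_left_mono[OF _ c0] add_mono two norm_ge_zero)
      finally show "\<bar>Q_pair R a b (r *\<^sub>R circ t)\<bar> \<le> c * (2 * ?D (- a) t + 2 * ?D b t)" .
    qed
    show "AE t in angle_measure. 0 \<le> c * (2 * ?D (- a) t + 2 * ?D b t)"
      using c0 by simp
  qed
  also have "\<dots> = c * (2 * (LINT t|angle_measure. ?D (- a) t) + 2 * (LINT t|angle_measure. ?D b t))"
    using L(2)[OF na] L(2)[OF b] by simp
  also have "\<dots> \<le> c * (2 * L + 2 * L)"
    using L(3)[OF na] L(3)[OF b] by (intro mult_left_mono[OF _ c0] add_mono) auto
  also have "\<dots> = 1600 * L * R * \<bar>r - 1\<bar> powr (-9/5) * (norm (a + b) / 2) powr (-2/5)"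
    by (simp add: c_def)
  also have "\<dots> \<le> 1600 * L * R * \<bar>r - 1\<bar> powr (-9/5) * (2 * norm (a + b) powr (-2/5))"
  proof (rule mult_left_mono)
    have "(norm (a + b) / 2) powr (-2/5) = norm (a + b) powr (-2/5) * 2 powr (2/5)"
      by (simp add: powr_divide powr_minus_divide)
    also have "\<dots> \<le> norm (a + b) powr (-2/5) * 2"
      using powr_mono[of "2/5" 1 "2::real"] by (intro mult_left_mono) auto
    finally show "(norm (a + b) / 2) powr (-2/5) \<le> 2 * norm (a + b) powr (-2/5)"
      by simp
  qed (use L R in auto)
  finally show ?thesis by simp
qed

text \<open>The radial exponent 9/5 alone is not integrable. The first-order zero of the weight
  difference at alpha = pi/3 lowers it to 4/5, which is.\<close>

lemma weight_kernel:
  assumes "0 \<le> \<alpha>" "\<alpha> \<le> pi / 2" "\<alpha> \<noteq> pi / 3"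
  shows "\<bar>1 - 2 / sqrt 3 * sin (2 * \<alpha>)\<bar> * \<bar>2 * cos \<alpha> - 1\<bar> powr (-9/5) \<le>
    4 * (2 / pi) powr (-9/5) * \<bar>\<alpha> - pi / 3\<bar> powr (-4/5)"
proof -
  let ?y = "\<bar>\<alpha> - pi / 3\<bar>"
  have y: "0 < ?y" using assms by simp
  have "\<bar>1 - 2 / sqrt 3 * sin (2 * \<alpha>)\<bar> * \<bar>2 * cos \<alpha> - 1\<bar> powr (-9/5) \<le> (4 * ?y) * (2 / pi * ?y) powr (-9/5)"
  proof (rule mult_mono[OF weight_bound])
    have "0 < 2 / pi * ?y" using y by simp
    then show "\<bar>2 * cos \<alpha> - 1\<bar> powr (-9/5) \<le> (2 / pi * ?y) powr (-9/5)"
      using radius_bound[OF assms(1,2)] by (intro powr_mono2') auto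
  qed auto
  also have "\<dots> = 4 * (2 / pi) powr (-9/5) * (?y powr 1 * ?y powr (-9/5))"
  proof -
    have "(2 / pi * ?y) powr (-9/5) = (2 / pi) powr (-9/5) * ?y powr (-9/5)" by (rule powr_mult)
    moreover have "?y powr 1 = ?y" using y by simp
    ultimately show ?thesis by (simp only: mult_ac)
  qed
  also have "?y powr 1 * ?y powr (-9/5) = ?y powr (-4/5)"
    by (simp only: powr_add[symmetric]) simp
  finally show ?thesis .
qed

text \<open>The kernel and the part of the planar integral inside radius 2 are integrals of the same
  angular mean P, with weights 2 / pi and 4 pi sin (2 alpha). Dividing the planar identity by pi^2
  sqrt 3 makes the weights agree at alpha = pi/3 and turns 4 pi^2 into 4 / sqrt 3. What remains is P
  against the weight difference, and the planar integral outside radius 2.\<close>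

lemma K_real_approx:
  "\<exists>C\<ge>0. \<forall>R>0. \<forall>a b. norm a = 1 \<longrightarrow> norm b = 1 \<longrightarrow> a + b \<noteq> 0 \<longrightarrow>
    \<bar>K_real R a b - 4 / sqrt 3 * Q_real R (a + b)\<bar> \<le> C * R * norm (a + b) powr (-2/5)"
proof -
  interpret A: prob_space angle_measure by (rule prob_space_ang)
  obtain L where L: "0 \<le> L"
    "\<And>w. norm w = 1 \<Longrightarrow> integrable angle_measure (\<lambda>t. norm (w - circ t) powr (-4/5))"
    "\<And>w. norm w = 1 \<Longrightarrow> (LINT t|angle_measure. norm (w - circ t) powr (-4/5)) \<le> L"
    using chord_singularity by auto
  let ?s = "\<lambda>\<alpha>::real. indicator {-pi..pi} (\<alpha> - pi/3) * \<bar>\<alpha> - pi/3\<bar> powr (-4/5)"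
  have int_s: "integrable lborel ?s" by (rule integrable_powr_singularity) simp
  define W where "W = (LINT \<alpha>|lborel. ?s \<alpha>)"
  define V where "V = (LINT \<eta>|lborel. planar_weight \<eta>)"
  have V0: "0 \<le> V" and W0: "0 \<le> W"
    unfolding V_def W_def by (auto intro!: Bochner_Integration.integral_nonneg planar_weight_nonneg)
  define k where "k = 3200 * L * (4 * (2 / pi) powr (-9/5))"
  have k0: "0 \<le> k" using L(1) by (simp add: k_def)
  \<comment> \<open>The first summand belongs to the weight difference, the second to the exterior;
    its last factor 2 is the one in 1 <= 2 * d.\<close>
  define C where "C = 2 / pi * (k * W) + 1 / (pi\<^sup>2 * sqrt 3) * (25600 * V) * 2"
  have C0: "0 \<le> C" using k0 V0 W0 by (simp add: C_def)
  have "\<bar>K_real R a b - 4 / sqrt 3 * Q_real R (a + b)\<bar> \<le> C * R * norm (a + b) powr (-2/5)"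
    if R: "0 < R" and a: "norm a = 1" and b: "norm b = 1" and ab: "a + b \<noteq> 0" for R a b
  proof -
    define P where "P \<alpha> = (LINT t|angle_measure. Q_pair R a b ((2 * cos \<alpha>) *\<^sub>R circ t))" for \<alpha>
    have P_meas [measurable]: "P \<in> borel_measurable borel" unfolding P_def by measurable
    have P_bound: "\<bar>P \<alpha>\<bar> \<le> 16 * R ^ 4" for \<alpha>
      unfolding P_def by (rule integral_bounded_ang) (use Q_pair_bound in auto)
    define d where "d = norm (a + b) powr (-2/5)"
    have d0: "0 \<le> d" by (simp add: d_def)
    \<comment> \<open>Since |a + b| <= 2, d is at least 2^(-2/5) >= 1/2. The exterior error, which
      does not depend on a + b, is thereby absorbed into the same form.\<close>
    have d2: "1 \<le> 2 * d"
    proof -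
      have "0 < norm (a + b)" using ab by simp
      moreover have "norm (a + b) \<le> 2" using norm_triangle_ineq[of a b] a b by simp
      ultimately have "2 powr (-2/5) \<le> d" unfolding d_def by (intro powr_mono2') auto
      moreover have "(2::real) powr (-1) \<le> 2 powr (-2/5)" by (intro powr_mono) auto
      moreover have "(2::real) powr (-1) = 1 / 2" by (simp add: powr_minus_divide)
      ultimately show ?thesis by linarith
    qed
    have si: "set_integrable lborel {0..<pi/2} (\<lambda>\<alpha>. f \<alpha> * P \<alpha>)"
      if f: "f \<in> borel_measurable borel" "\<And>x. \<bar>f x\<bar> \<le> 3" for f :: "real \<Rightarrow> real"
      unfolding set_integrable_def
    proof (rule integrableI_bounded_set_indicator[where B = "3 * (16 * R ^ 4)"])
      show "AE x in lborel. x \<in> {0..<pi/2} \<longrightarrow> norm (f x * P x) \<le> 3 * (16 * R ^ 4)"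
        unfolding real_norm_def abs_mult by (intro AE_I2 impI mult_mono f(2) P_bound) auto
    qed (use f in auto)
    have one: "(LINT \<alpha>:{0..<pi/2}|lborel. P \<alpha>) = (LINT \<alpha>:{0..<pi/2}|lborel. 1 * P \<alpha>)" by simp
    have K: "K_real R a b = 2 / pi * (LINT \<alpha>:{0..<pi/2}|lborel. P \<alpha>)"
      unfolding K_real_def P_def by (rule sum_circ_polar) (use Q_pair_bound in auto)
    have J: "(LINT \<eta>:ball 0 2|lborel. Q_pair R a b \<eta>) = 4 * pi * (LINT \<alpha>:{0..<pi/2}|lborel. sin (2 * \<alpha>) * P \<alpha>)"
      unfolding P_def by (rule polar_disc) (use Q_pair_bound in auto)
    define Z where "Z = (LINT \<eta>|lborel. indicator (- ball 0 2) \<eta> * Q_pair R a b \<eta>)"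
    have iH: "integrable lborel (Q_pair R a b)" using R a b by (rule integrable_Q_pair)
    have i1: "integrable lborel (\<lambda>\<eta>. indicator (ball 0 2) \<eta> *\<^sub>R Q_pair R a b \<eta>)"
      using iH by (intro integrable_mult_indicator) auto
    have i2: "integrable lborel (\<lambda>\<eta>. indicator (- ball 0 2) \<eta> *\<^sub>R Q_pair R a b \<eta>)"
      using iH by (intro integrable_mult_indicator) auto
    have "4 * pi\<^sup>2 * Q_real R (a + b) = (LINT \<eta>|lborel. Q_pair R a b \<eta>)"
      using integral_Q_pair[OF R a b] by simp
    also have "\<dots> = (LINT \<eta>|lborel. indicator (ball 0 2) \<eta> *\<^sub>R Q_pair R a b \<eta> + indicator (- ball 0 2) \<eta> *\<^sub>R Q_pair R a b \<eta>)"
      by (intro Bochner_Integration.integral_cong) (auto simp: indicator_def)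
    also have "\<dots> = 4 * pi * (LINT \<alpha>:{0..<pi/2}|lborel. sin (2 * \<alpha>) * P \<alpha>) + Z"
      using Bochner_Integration.integral_add[OF i1 i2] J by (simp add: Z_def set_lebesgue_integral_def)
    finally have Q: "4 * pi\<^sup>2 * Q_real R (a + b) = 4 * pi * (LINT \<alpha>:{0..<pi/2}|lborel. sin (2 * \<alpha>) * P \<alpha>) + Z" .
    \<comment> \<open>At alpha = pi/3 the factor 1 - 2 / sqrt 3 * sin (2 * alpha) vanishes; this
      fixes the normalisation 1 / (pi^2 sqrt 3).\<close>
    have E: "K_real R a b - 4 / sqrt 3 * Q_real R (a + b) =
        2 / pi * (LINT \<alpha>:{0..<pi/2}|lborel. (1 - 2 / sqrt 3 * sin (2 * \<alpha>)) * P \<alpha>) - 1 / (pi\<^sup>2 * sqrt 3) * Z"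
    proof -
      have "4 / sqrt 3 * Q_real R (a + b) = 1 / (pi\<^sup>2 * sqrt 3) * (4 * pi\<^sup>2 * Q_real R (a + b))"
        by simp
      also have "\<dots> = 2 / pi * (2 / sqrt 3 * (LINT \<alpha>:{0..<pi/2}|lborel. sin (2 * \<alpha>) * P \<alpha>)) + 1 / (pi\<^sup>2 * sqrt 3) * Z"
        unfolding Q by (simp add: distrib_left power2_eq_square)
      finally have 1: "4 / sqrt 3 * Q_real R (a + b) = 2 / pi * (2 / sqrt 3 * (LINT \<alpha>:{0..<pi/2}|lborel. sin (2 * \<alpha>) * P \<alpha>)) + 1 / (pi\<^sup>2 * sqrt 3) * Z" .
      have "(LINT \<alpha>:{0..<pi/2}|lborel. (1 - 2 / sqrt 3 * sin (2 * \<alpha>)) * P \<alpha>)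
         = (LINT \<alpha>:{0..<pi/2}|lborel. 1 * P \<alpha> - 2 / sqrt 3 * (sin (2 * \<alpha>) * P \<alpha>))"
        by (simp only: left_diff_distrib mult.assoc)
      also have "\<dots> = (LINT \<alpha>:{0..<pi/2}|lborel. 1 * P \<alpha>) - (LINT \<alpha>:{0..<pi/2}|lborel. 2 / sqrt 3 * (sin (2 * \<alpha>) * P \<alpha>))"
      proof (rule set_integral_diff(2))
        show "set_integrable lborel {0..<pi/2} (\<lambda>\<alpha>. 1 * P \<alpha>)" by (rule si) auto
        have "set_integrable lborel {0..<pi/2} (\<lambda>\<alpha>. sin (2 * \<alpha>) * P \<alpha>)"
          by (rule si) (auto intro: order_trans[OF abs_sin_le_one])
        then show "set_integrable lborel {0..<pi/2} (\<lambda>\<alpha>. 2 / sqrt 3 * (sin (2 * \<alpha>) * P \<alpha>))"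
          by (rule set_integrable_mult_right)
      qed
      also have "\<dots> = (LINT \<alpha>:{0..<pi/2}|lborel. P \<alpha>) - 2 / sqrt 3 * (LINT \<alpha>:{0..<pi/2}|lborel. sin (2 * \<alpha>) * P \<alpha>)"
        by simp
      finally show ?thesis unfolding K 1 by (simp only: right_diff_distrib diff_diff_eq)
    qed
    have Zb: "\<bar>Z\<bar> \<le> 25600 * R * V"
    proof -
      have "\<bar>Z\<bar> \<le> (LINT \<eta>|lborel. \<bar>indicator (- ball 0 2) \<eta> * Q_pair R a b \<eta>\<bar>)"
        unfolding Z_def by (rule integral_abs_bound)
      also have "\<dots> \<le> (LINT \<eta>|lborel. 25600 * R * planar_weight \<eta>)"
      proof (rule integral_mono_AE')
        show "integrable lborel (\<lambda>\<eta>. 25600 * R * planar_weight \<eta>)"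
          using integrable_planar_weight by simp
        show "AE \<eta> in lborel. \<bar>indicator (- ball 0 2) \<eta> * Q_pair R a b \<eta>\<bar> \<le> 25600 * R * planar_weight \<eta>"
          using Q_pair_outside[OF R a b] planar_weight_nonneg R by (auto simp: indicator_def)
      qed (use planar_weight_nonneg R in auto)
      finally show ?thesis by (simp add: V_def)
    qed
    have main: "\<bar>LINT \<alpha>:{0..<pi/2}|lborel. (1 - 2 / sqrt 3 * sin (2 * \<alpha>)) * P \<alpha>\<bar> \<le> k * R * d * W"
    proof -
      have "\<bar>LINT \<alpha>:{0..<pi/2}|lborel. (1 - 2 / sqrt 3 * sin (2 * \<alpha>)) * P \<alpha>\<bar> \<le>
        (LINT \<alpha>|lborel. \<bar>indicator {0..<pi/2} \<alpha> *\<^sub>R ((1 - 2 / sqrt 3 * sin (2 * \<alpha>)) * P \<alpha>)\<bar>)"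
        unfolding set_lebesgue_integral_def by (rule integral_abs_bound)
      also have "\<dots> \<le> (LINT \<alpha>|lborel. k * R * d * ?s \<alpha>)"
      proof (rule integral_mono_AE')
        show "integrable lborel (\<lambda>\<alpha>. k * R * d * ?s \<alpha>)" using int_s by (rule Bochner_Integration.integrable_mult_right)
        show "AE \<alpha> in lborel. \<bar>indicator {0..<pi/2} \<alpha> *\<^sub>R ((1 - 2 / sqrt 3 * sin (2 * \<alpha>)) * P \<alpha>)\<bar> \<le> k * R * d * ?s \<alpha>"
          using AE_lborel_singleton[of "pi/3"]
        proof eventually_elim
          fix \<alpha> :: real assume ne: "\<alpha> \<noteq> pi / 3"
          show "\<bar>indicator {0..<pi/2} \<alpha> *\<^sub>R ((1 - 2 / sqrt 3 * sin (2 * \<alpha>)) * P \<alpha>)\<bar> \<le> k * R * d * ?s \<alpha>"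
          proof (cases "\<alpha> \<in> {0..<pi/2}")
            case True
            then have al: "0 \<le> \<alpha>" "\<alpha> \<le> pi / 2" by auto
            have "0 < 2 / pi * \<bar>\<alpha> - pi / 3\<bar>" using ne by simp
            then have "0 < \<bar>2 * cos \<alpha> - 1\<bar>" using radius_bound[OF al] by linarith
            then have r1: "2 * cos \<alpha> \<noteq> 1" by auto
            have r0: "0 \<le> 2 * cos \<alpha>" using al by (simp add: cos_ge_zero)
            have "\<bar>P \<alpha>\<bar> \<le> 3200 * L * R * \<bar>2 * cos \<alpha> - 1\<bar> powr (-9/5) * d"
              unfolding P_def d_def by (rule weighted_angular_bound[OF L R a b ab r0 r1])
            then have "\<bar>(1 - 2 / sqrt 3 * sin (2 * \<alpha>)) * P \<alpha>\<bar> \<le>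
              \<bar>1 - 2 / sqrt 3 * sin (2 * \<alpha>)\<bar> * (3200 * L * R * \<bar>2 * cos \<alpha> - 1\<bar> powr (-9/5) * d)"
              unfolding abs_mult by (intro mult_left_mono) auto
            also have "\<dots> = 3200 * L * R * d * (\<bar>1 - 2 / sqrt 3 * sin (2 * \<alpha>)\<bar> * \<bar>2 * cos \<alpha> - 1\<bar> powr (-9/5))"
              by (simp only: mult_ac)
            also have "\<dots> \<le> 3200 * L * R * d * (4 * (2 / pi) powr (-9/5) * \<bar>\<alpha> - pi / 3\<bar> powr (-4/5))"
              using L(1) R d0 by (intro mult_left_mono weight_kernel al ne) auto
            also have "\<dots> = k * R * d * \<bar>\<alpha> - pi / 3\<bar> powr (-4/5)" by (simp add: k_def)
            also have "\<dots> = k * R * d * ?s \<alpha>"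
            proof -
              have "- pi \<le> \<alpha> - pi/3" "\<alpha> - pi/3 \<le> pi" using al pi_gt_zero by linarith+
              then show ?thesis by simp
            qed
            finally show ?thesis using True by simp
          next
            case False
            then show ?thesis using k0 R d0 by simp
          qed
        qed
        show "AE \<alpha> in lborel. 0 \<le> k * R * d * ?s \<alpha>" using k0 R d0 by simp
      qed
      finally show ?thesis by (simp add: W_def)
    qed
    have "\<bar>K_real R a b - 4 / sqrt 3 * Q_real R (a + b)\<bar> \<le> 2 / pi * (k * R * d * W) + 1 / (pi\<^sup>2 * sqrt 3) * (25600 * R * V)"
    proof -
      have "\<bar>K_real R a b - 4 / sqrt 3 * Q_real R (a + b)\<bar> \<le>
        \<bar>2 / pi * (LINT \<alpha>:{0..<pi/2}|lborel. (1 - 2 / sqrt 3 * sin (2 * \<alpha>)) * P \<alpha>)\<bar> + \<bar>1 / (pi\<^sup>2 * sqrt 3) * Z\<bar>"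
        unfolding E by (rule abs_triangle_ineq4)
      also have "\<dots> = 2 / pi * \<bar>LINT \<alpha>:{0..<pi/2}|lborel. (1 - 2 / sqrt 3 * sin (2 * \<alpha>)) * P \<alpha>\<bar> + 1 / (pi\<^sup>2 * sqrt 3) * \<bar>Z\<bar>"
        unfolding abs_mult by simp
      also have "\<dots> \<le> 2 / pi * (k * R * d * W) + 1 / (pi\<^sup>2 * sqrt 3) * (25600 * R * V)"
        by (intro add_mono mult_left_mono main Zb) auto
      finally show ?thesis .
    qed
    also have "1 / (pi\<^sup>2 * sqrt 3) * (25600 * R * V) \<le> 1 / (pi\<^sup>2 * sqrt 3) * (25600 * R * V) * (2 * d)"
    proof -
      have "0 \<le> 1 / (pi\<^sup>2 * sqrt 3) * (25600 * R * V)" using V0 R by simp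
      from mult_left_mono[OF d2 this] show ?thesis by (simp only: mult_1_right)
    qed
    also have "2 / pi * (k * R * d * W) + 1 / (pi\<^sup>2 * sqrt 3) * (25600 * R * V) * (2 * d) = C * R * d"
      unfolding C_def distrib_right by (simp only: mult_ac)
    finally show ?thesis by (simp add: d_def)
  qed
  with C0 show ?thesis by blast
qed

section \<open>The main term and the asymptotics\<close>

lemma disc_ft_tendsto:
  assumes x: "(x \<longlongrightarrow> v) (at_top :: real filter)"
  shows "((\<lambda>R. disc_ft (x R)) \<longlongrightarrow> disc_ft v) at_top"
  unfolding disc_ft_def
proof (rule integral_dominated_convergence_at_top)
  show "integrable lborel semicircle" by (rule integrable_semicircle)
  show "\<forall>\<^sub>F R in at_top. AE y in lborel. norm (semicircle y * cos (x R * y)) \<le> semicircle y"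
    by (simp add: abs_mult semicircle_nonneg mult_left_le)
  show "AE y in lborel. ((\<lambda>R. semicircle y * cos (x R * y)) \<longlongrightarrow> semicircle y * cos (v * y)) at_top"
    by (intro AE_I2 tendsto_intros x)
qed measurable

text \<open>The chord of angle v / R, magnified by R, approaches its arc. The remainder |sin y - y|
  <= y^2 / 2 suffices and gives the rate v^2 / (4 R).\<close>

lemma chord_param_tendsto: "((\<lambda>R. 2 * R * sin (v / (2 * R))) \<longlongrightarrow> v) (at_top :: real filter)"
proof -
  have r: "((\<lambda>R::real. v\<^sup>2 / 4 * inverse R) \<longlongrightarrow> v\<^sup>2 / 4 * 0) at_top"
    by (intro tendsto_mult tendsto_const tendsto_inverse_0_at_top filterlim_ident)
  have "((\<lambda>R. 2 * R * sin (v / (2 * R)) - v) \<longlongrightarrow> 0) (at_top :: real filter)"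
  proof (rule Lim_null_comparison)
    show "\<forall>\<^sub>F R in at_top. norm (2 * R * sin (v / (2 * R)) - v) \<le> v\<^sup>2 / 4 * inverse R"
      using eventually_gt_at_top[of 0]
    proof eventually_elim
      fix R :: real assume R: "0 < R"
      define y where "y = v / (2 * R)"
      have "\<bar>sin y - y\<bar> \<le> y\<^sup>2 / 2"
        using Maclaurin_sin_bound[of y 2] by (simp add: sin_coeff_def numeral_2_eq_2 field_simps)
      then have "2 * R * \<bar>sin y - y\<bar> \<le> 2 * R * (y\<^sup>2 / 2)" using R by (intro mult_left_mono) auto
      moreover have "2 * R * \<bar>sin y - y\<bar> = \<bar>2 * R * sin y - v\<bar>"
      proof -
        have "2 * R * sin y - v = 2 * R * (sin y - y)" using R by (simp add: y_def right_diff_distrib)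
        then show ?thesis using R by (simp add: abs_mult)
      qed
      moreover have "2 * R * (y\<^sup>2 / 2) = v\<^sup>2 / 4 * inverse R"
        using R by (simp add: y_def field_simps power2_eq_square)
      ultimately show "norm (2 * R * sin (v / (2 * R)) - v) \<le> v\<^sup>2 / 4 * inverse R"
        by (simp add: y_def)
    qed
    show "((\<lambda>R::real. v\<^sup>2 / 4 * inverse R) \<longlongrightarrow> 0) at_top" using r by simp
  qed
  then show ?thesis by (simp add: LIM_zero_iff)
qed

lemma integral_disc_ft_square_half_line: "(LINT v|lborel. indicator {0..} v * (disc_ft v)\<^sup>2) = 16 * pi / 3"
proof -
  have i: "integrable lborel (\<lambda>v. indicator {0..} v * (disc_ft v)\<^sup>2)"
    using integrable_mult_indicator[OF _ integrable_disc_ft_square, of "{0..}"] by simp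
  have i': "integrable lborel (\<lambda>v. indicator {0..} (0 + (-1) * v) * (disc_ft (0 + (-1) * v))\<^sup>2)"
    using i by (rule lborel_integrable_real_affine) simp
  have "(LINT v|lborel. (disc_ft v)\<^sup>2) = (LINT v|lborel. indicator {0..} v * (disc_ft v)\<^sup>2 + indicator {0..} (0 + (-1) * v) * (disc_ft (0 + (-1) * v))\<^sup>2)"
  proof (rule integral_cong_AE)
    show "AE v in lborel. (disc_ft v)\<^sup>2 = indicator {0..} v * (disc_ft v)\<^sup>2 + indicator {0..} (0 + (-1) * v) * (disc_ft (0 + (-1) * v))\<^sup>2"
      using AE_lborel_singleton[of 0] by eventually_elim (auto simp: indicator_def disc_ft_even)
  qed measurable
  also have "\<dots> = (LINT v|lborel. indicator {0..} v * (disc_ft v)\<^sup>2) + (LINT v|lborel. indicator {0..} (0 + (-1) * v) * (disc_ft (0 + (-1) * v))\<^sup>2)"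
    by (rule Bochner_Integration.integral_add[OF i i'])
  also have "(LINT v|lborel. indicator {0..} (0 + (-1) * v) * (disc_ft (0 + (-1) * v))\<^sup>2) = (LINT v|lborel. indicator {0..} v * (disc_ft v)\<^sup>2)"
    by (subst (2) lborel_integral_real_affine[of "-1" _ 0]) simp_all
  finally show ?thesis by (simp add: integral_disc_ft_square)
qed

text \<open>The mean square of Q_R(a + b) over a for fixed b, independent of b: t is the angle
  between a and - b, and 2 sin (t / 2) is the norm of a + b.\<close>

definition chord_moment :: "real \<Rightarrow> real" where
  "chord_moment R = (LINT t|lborel. indicator {0..pi} t * (R\<^sup>2 * disc_ft (R * (2 * sin (t / 2))))\<^sup>2) / pi"

lemma chord_moment_nonneg: "0 \<le> chord_moment R"
  unfolding chord_moment_def by (intro divide_nonneg_pos Bochner_Integration.integral_nonneg) auto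

lemma integral_Q_real_square:
  assumes b: "norm b = 1"
  shows "(LINT t|angle_measure. (Q_real R (circ t + b))\<^sup>2) = chord_moment R"
proof -
  have nb: "norm (- b) = 1" using b by simp
  have i: "integrable lborel (\<lambda>t. indicator {0..pi} t *\<^sub>R (R\<^sup>2 * disc_ft (R * (2 * sin (t / 2))))\<^sup>2)"
  proof (rule integrableI_bounded_set_indicator[where B="(4 * R\<^sup>2)\<^sup>2"])
    have "\<bar>R\<^sup>2 * disc_ft x\<bar> \<le> \<bar>4 * R\<^sup>2\<bar>" for x
      using mult_left_mono[OF disc_ft_bound[of x], of "R\<^sup>2"] by (simp add: abs_mult)
    then have sq: "(R\<^sup>2 * disc_ft x)\<^sup>2 \<le> (4 * R\<^sup>2)\<^sup>2" for x
      by (simp only: abs_le_square_iff[symmetric])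
    show "AE t in lborel. t \<in> {0..pi} \<longrightarrow> norm ((R\<^sup>2 * disc_ft (R * (2 * sin (t / 2))))\<^sup>2) \<le> (4 * R\<^sup>2)\<^sup>2"
      by (intro AE_I2 impI) (simp only: real_norm_def abs_power2 sq)
  qed auto
  have "(\<integral>\<^sup>+ t. ennreal ((Q_real R (circ t + b))\<^sup>2) \<partial>angle_measure) = (\<integral>\<^sup>+ t. ennreal ((R\<^sup>2 * disc_ft (R * norm (- b - circ t)))\<^sup>2) \<partial>angle_measure)"
  proof -
    have "norm (- b - circ t) = norm (circ t + b)" for t
      by (metis add.commute minus_add_distrib norm_minus_cancel diff_conv_add_uminus)
    then show ?thesis by (simp add: Q_real_def)
  qed
  also have "\<dots> = (\<integral>\<^sup>+ t. ennreal ((R\<^sup>2 * disc_ft (R * (2 * sin (t / 2))))\<^sup>2) * indicator {0..pi} t \<partial>lborel) / ennreal pi"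
    by (rule nn_integral_chord[OF nb]) measurable
  also have "(\<integral>\<^sup>+ t. ennreal ((R\<^sup>2 * disc_ft (R * (2 * sin (t / 2))))\<^sup>2) * indicator {0..pi} t \<partial>lborel) =
      (\<integral>\<^sup>+ t. ennreal (indicator {0..pi} t *\<^sub>R (R\<^sup>2 * disc_ft (R * (2 * sin (t / 2))))\<^sup>2) \<partial>lborel)"
    by (intro nn_integral_cong) (auto simp: indicator_def)
  also have "\<dots> = ennreal (LINT t|lborel. indicator {0..pi} t *\<^sub>R (R\<^sup>2 * disc_ft (R * (2 * sin (t / 2))))\<^sup>2)"
    by (rule nn_integral_eq_integral[OF i]) auto
  also have "\<dots> / ennreal pi = ennreal (chord_moment R)"
    unfolding chord_moment_def real_scaleR_def
    by (rule divide_ennreal) (auto intro!: Bochner_Integration.integral_nonneg)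
  finally have "(\<integral>\<^sup>+ t. ennreal ((Q_real R (circ t + b))\<^sup>2) \<partial>angle_measure) = ennreal (chord_moment R)" .
  then show ?thesis
    by (subst integral_eq_nn_integral) (auto simp: chord_moment_nonneg)
qed

text \<open>Substitution t = v / R: the squared factor R^2 gives R^4, and the differential takes one
  power off.\<close>

lemma chord_moment_scaled:
  assumes R: "0 < R"
  shows "chord_moment R / R ^ 3 = (LINT v|lborel. indicator {0..pi * R} v * (disc_ft (2 * R * sin (v / (2 * R))))\<^sup>2) / pi"
proof -
  have "(LINT t|lborel. indicator {0..pi} t * (R\<^sup>2 * disc_ft (R * (2 * sin (t / 2))))\<^sup>2) =
      \<bar>1 / R\<bar> *\<^sub>R (LINT v|lborel. indicator {0..pi} (0 + 1 / R * v) * (R\<^sup>2 * disc_ft (R * (2 * sin ((0 + 1 / R * v) / 2))))\<^sup>2)"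
    using R by (intro lborel_integral_real_affine) auto
  also have "\<dots> = 1 / R * (LINT v|lborel. R ^ 4 * (indicator {0..pi * R} v * (disc_ft (2 * R * sin (v / (2 * R))))\<^sup>2))"
  proof -
    have "indicator {0..pi} (0 + 1 / R * v) * (R\<^sup>2 * disc_ft (R * (2 * sin ((0 + 1 / R * v) / 2))))\<^sup>2 =
      R ^ 4 * (indicator {0..pi * R} v * (disc_ft (2 * R * sin (v / (2 * R))))\<^sup>2)" for v
    proof -
      have "indicator {0..pi} (0 + 1 / R * v) = (indicator {0..pi * R} v :: real)"
        using R by (auto simp: indicator_def field_simps)
      moreover have "R * (2 * sin ((0 + 1 / R * v) / 2)) = 2 * R * sin (v / (2 * R))"
        by (simp add: mult.commute)
      moreover have "(R\<^sup>2 * y)\<^sup>2 = R ^ 4 * y\<^sup>2" for y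
        by (simp add: power_mult_distrib flip: power_mult)
      ultimately show ?thesis by (simp only:) (simp only: mult_ac)
    qed
    then show ?thesis using R by simp
  qed
  also have "\<dots> = R ^ 3 * (LINT v|lborel. indicator {0..pi * R} v * (disc_ft (2 * R * sin (v / (2 * R))))\<^sup>2)"
    using R by (simp add: power4_eq_xxxx power3_eq_cube)
  finally show ?thesis using R by (simp add: chord_moment_def)
qed

text \<open>Dominated convergence. On [0, pi R] Jordan's inequality keeps the rescaled chord z above
  (2 / pi) v, so the majorant 800 / (1 + z^2) of the squared transform is at most 800 (pi^2 / 4) /
  (1 + v^2); this is the origin of 200 pi^2. The limiting half-line integral 16 pi / 3 is divided by
  pi.\<close>

lemma chord_moment_asymp: "((\<lambda>R. chord_moment R / R ^ 3) \<longlongrightarrow> 16 / 3) at_top"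
proof -
  let ?s = "\<lambda>R v. indicator {0..pi * R} v * (disc_ft (2 * R * sin (v / (2 * R))))\<^sup>2"
  have "((\<lambda>R. LINT v|lborel. ?s R v) \<longlongrightarrow> (LINT v|lborel. indicator {0..} v * (disc_ft v)\<^sup>2)) at_top"
  proof (rule integral_dominated_convergence_at_top)
    show "integrable lborel (\<lambda>v::real. 200 * pi\<^sup>2 * inverse (1 + v\<^sup>2))"
      using integrable_inverse_1_plus_square by (simp add: set_integrable_def)
    show "\<forall>\<^sub>F R in at_top. AE v in lborel. norm (?s R v) \<le> 200 * pi\<^sup>2 * inverse (1 + v\<^sup>2)"
      using eventually_gt_at_top[of 0]
    proof eventually_elim
      fix R :: real assume R: "0 < R"
      show "AE v in lborel. norm (?s R v) \<le> 200 * pi\<^sup>2 * inverse (1 + v\<^sup>2)"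
      proof (rule AE_I2)
        fix v :: real
        show "norm (?s R v) \<le> 200 * pi\<^sup>2 * inverse (1 + v\<^sup>2)"
        proof (cases "v \<in> {0..pi * R}")
          case True
          define z where "z = 2 * R * sin (v / (2 * R))"
          have "2 / pi * (v / (2 * R)) \<le> sin (v / (2 * R))"
            using True R by (intro jordan_sin) (auto simp: field_simps)
          then have "2 * R * (2 / pi * (v / (2 * R))) \<le> z"
            unfolding z_def using R by (intro mult_left_mono) auto
          then have z: "2 / pi * v \<le> z" using R by simp
          have "(2 / pi * v)\<^sup>2 \<le> z\<^sup>2" using z True by (intro power_mono) auto
          moreover have "(2 / pi)\<^sup>2 \<le> 1" using pi_ge_two by (simp add: power_le_one)
          moreover have "(2 / pi)\<^sup>2 * (1 + v\<^sup>2) = (2 / pi)\<^sup>2 + (2 / pi * v)\<^sup>2"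
            by (simp only: power_mult_distrib distrib_left mult_1_right)
          ultimately have "(2 / pi)\<^sup>2 * (1 + v\<^sup>2) \<le> 1 + z\<^sup>2" by linarith
          then have "inverse (1 + z\<^sup>2) \<le> inverse ((2 / pi)\<^sup>2 * (1 + v\<^sup>2))"
            by (intro le_imp_inverse_le) (auto intro!: mult_pos_pos add_pos_nonneg)
          also have "inverse ((2 / pi)\<^sup>2 * (1 + v\<^sup>2)) = inverse ((2 / pi)\<^sup>2) * inverse (1 + v\<^sup>2)"
            by (rule inverse_mult_distrib)
          also have "inverse ((2 / pi)\<^sup>2) = pi\<^sup>2 / 4" by (simp add: power_divide)
          finally have "800 * inverse (1 + z\<^sup>2) \<le> 800 * (pi\<^sup>2 / 4 * inverse (1 + v\<^sup>2))"
            by (intro mult_left_mono) auto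
          then have "800 * inverse (1 + z\<^sup>2) \<le> 200 * pi\<^sup>2 * inverse (1 + v\<^sup>2)" by simp
          with disc_ft_square_le[of z] have "(disc_ft z)\<^sup>2 \<le> 200 * pi\<^sup>2 * inverse (1 + v\<^sup>2)" by linarith
          then show ?thesis using True by (simp add: z_def)
        next
          case False
          then show ?thesis by simp
        qed
      qed
    qed
    show "AE v in lborel. ((\<lambda>R. ?s R v) \<longlongrightarrow> indicator {0..} v * (disc_ft v)\<^sup>2) at_top"
    proof (rule AE_I2)
      fix v :: real
      have "\<forall>\<^sub>F R in at_top. indicator {0..pi * R} v = (indicator {0..} v :: real)"
        using eventually_ge_at_top[of "v / pi"]
        by eventually_elim (auto simp: indicator_def field_simps)
      then have "((\<lambda>R. indicator {0..pi * R} v :: real) \<longlongrightarrow> indicator {0..} v) at_top"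
        by (rule tendsto_eventually)
      then show "((\<lambda>R. ?s R v) \<longlongrightarrow> indicator {0..} v * (disc_ft v)\<^sup>2) at_top"
        by (intro tendsto_mult tendsto_power disc_ft_tendsto chord_param_tendsto)
    qed
  qed measurable
  then have "((\<lambda>R. (LINT v|lborel. ?s R v) / pi) \<longlongrightarrow> 16 * pi / 3 / pi) at_top"
    unfolding integral_disc_ft_square_half_line by (intro tendsto_divide tendsto_const) auto
  then have "((\<lambda>R. (LINT v|lborel. ?s R v) / pi) \<longlongrightarrow> 16 / 3) at_top" by simp
  then show ?thesis
    by (rule Lim_transform_eventually) (use eventually_gt_at_top[of 0] in \<open>eventually_elim, simp add: chord_moment_scaled\<close>)
qed

section \<open>Reduction to real angular means and the final limit\<close>

definition I_real :: "real \<Rightarrow> real" where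
  "I_real R = (LINT s|angle_measure. LINT t|angle_measure. (K_real R (circ t) (circ s))\<^sup>2)"

lemma measurable_K_real [measurable]:
  assumes [measurable]: "f \<in> borel_measurable M" "g \<in> borel_measurable M"
  shows "(\<lambda>x. K_real R (f x) (g x)) \<in> borel_measurable M"
proof -
  interpret A: prob_space angle_measure by (rule prob_space_ang)
  show ?thesis unfolding K_real_def Q_pair_def by measurable
qed

lemma K_kernel_eq:
  assumes R: "0 < R"
  shows "K_kernel R a b = of_real (K_real R a b)"
proof -
  have Q: "Q_disc R \<xi> = of_real (Q_real R \<xi>)" for \<xi>
    using Q_disc_eq[OF R] by (simp add: Q_real_def)
  interpret A: prob_space angle_measure by (rule prob_space_ang)
  have "K_kernel R a b = (LINT \<phi>|circle_measure. LINT \<theta>|circle_measure. of_real (Q_pair R a b (\<theta> + \<phi>)))"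
    unfolding K_kernel_def Q Q_pair_def by (simp add: add.assoc diff_diff_eq)
  also have "\<dots> = (LINT \<phi>|circle_measure. LINT t|angle_measure. of_real (Q_pair R a b (circ t + \<phi>)))"
    by (intro Bochner_Integration.integral_cong refl integral_circle_measure) measurable
  also have "\<dots> = (LINT s|angle_measure. LINT t|angle_measure. of_real (Q_pair R a b (circ t + circ s)))"
    by (rule integral_circle_measure) measurable
  finally show ?thesis by (simp add: K_real_def)
qed

lemma I_moment_eq:
  assumes R: "0 < R"
  shows "I_moment R = of_real (I_real R)"
proof -
  interpret A: prob_space angle_measure by (rule prob_space_ang)
  have "I_moment R = (LINT b|circle_measure. LINT a|circle_measure. of_real ((K_real R a b)\<^sup>2))"
    unfolding I_moment_def K_kernel_eq[OF R] by simp
  also have "\<dots> = (LINT b|circle_measure. LINT t|angle_measure. of_real ((K_real R (circ t) b)\<^sup>2))"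
    by (intro Bochner_Integration.integral_cong refl integral_circle_measure) measurable
  also have "\<dots> = (LINT s|angle_measure. LINT t|angle_measure. of_real ((K_real R (circ t) (circ s))\<^sup>2))"
    by (rule integral_circle_measure) measurable
  finally show ?thesis unfolding integral_complex_of_real I_real_def .
qed

lemma K_real_bound: "\<bar>K_real R a b\<bar> \<le> 16 * R ^ 4"
proof -
  interpret A: prob_space angle_measure by (rule prob_space_ang)
  show ?thesis
    unfolding K_real_def by (intro integral_bounded_ang) (use Q_pair_bound in auto)
qed

text \<open>Young's inequality for the cross term 2 M E. Applied pointwise it leaves only the mean
  squares of M and of E to be known, and the parameter e decides how the cross term is
  shared.\<close>

lemma square_perturb:
  fixes M E e :: real
  assumes e: "0 < e"
  shows "\<bar>(M + E)\<^sup>2 - M\<^sup>2\<bar> \<le> e * M\<^sup>2 + (1 + 1 / e) * E\<^sup>2"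
proof -
  have "0 \<le> (e * \<bar>M\<bar> - \<bar>E\<bar>)\<^sup>2" by simp
  then have "2 * e * (\<bar>M\<bar> * \<bar>E\<bar>) \<le> e\<^sup>2 * M\<^sup>2 + E\<^sup>2"
    by (simp add: power2_diff power_mult_distrib algebra_simps)
  then have "(2 * (\<bar>M\<bar> * \<bar>E\<bar>)) * e \<le> (e * M\<^sup>2 + E\<^sup>2 / e) * e"
    using e by (simp add: algebra_simps power2_eq_square)
  then have "2 * (\<bar>M\<bar> * \<bar>E\<bar>) \<le> e * M\<^sup>2 + E\<^sup>2 / e"
    by (rule mult_right_le_imp_le[OF _ e])
  moreover have "(M + E)\<^sup>2 - M\<^sup>2 = 2 * (M * E) + E\<^sup>2" by (simp add: power2_sum)
  moreover have "\<bar>2 * (M * E) + E\<^sup>2\<bar> \<le> 2 * (\<bar>M\<bar> * \<bar>E\<bar>) + E\<^sup>2"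
    by (rule order_trans[OF abs_triangle_ineq]) (simp add: abs_mult)
  ultimately show ?thesis by (simp add: distrib_right)
qed

text \<open>Here 16 / 3 is the square of 4 / sqrt 3. Squaring the error of
  \<open>K_real_approx\<close> gives R^2 |a + b|^(-4/5), whose mean over a is bounded uniformly in b
  by \<open>chord_singularity\<close>. The parameter e stays free because its choice will depend on
  R.\<close>

lemma I_real_approx:
  "\<exists>D\<ge>0. \<forall>R>0. \<forall>e>0. \<bar>I_real R - 16 / 3 * chord_moment R\<bar> \<le> e * (16 / 3 * chord_moment R) + (1 + 1 / e) * (D * R\<^sup>2)"
proof -
  interpret A: prob_space angle_measure by (rule prob_space_ang)
  obtain C where C: "0 \<le> C" "\<And>R a b. 0 < R \<Longrightarrow> norm a = 1 \<Longrightarrow> norm b = 1 \<Longrightarrow> a + b \<noteq> 0 \<Longrightarrow>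
    \<bar>K_real R a b - 4 / sqrt 3 * Q_real R (a + b)\<bar> \<le> C * R * norm (a + b) powr (-2/5)"
    using K_real_approx by auto
  obtain L where L: "0 \<le> L"
    "\<And>w. norm w = 1 \<Longrightarrow> integrable angle_measure (\<lambda>t. norm (w - circ t) powr (-4/5))"
    "\<And>w. norm w = 1 \<Longrightarrow> (LINT t|angle_measure. norm (w - circ t) powr (-4/5)) \<le> L"
    using chord_singularity by auto
  define D where "D = C\<^sup>2 * L"
  have "\<bar>I_real R - 16 / 3 * chord_moment R\<bar> \<le> e * (16 / 3 * chord_moment R) + (1 + 1 / e) * (D * R\<^sup>2)"
    if R: "0 < R" and e: "0 < e" for R e
  proof -
    define bnd where "bnd = e * (16 / 3 * chord_moment R) + (1 + 1 / e) * (D * R\<^sup>2)"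
    define B where "B s = (LINT t|angle_measure. (K_real R (circ t) (circ s))\<^sup>2)" for s
    have [measurable]: "B \<in> borel_measurable borel" unfolding B_def by measurable
    have K2: "\<bar>(K_real R a b)\<^sup>2\<bar> \<le> (16 * R ^ 4)\<^sup>2" for a b
      using power_mono[OF K_real_bound[of R a b], of 2] by simp
    have Bb: "\<bar>B s\<bar> \<le> (16 * R ^ 4)\<^sup>2" for s
      unfolding B_def by (rule integral_bounded_ang) (use K2 in auto)
    have key: "\<bar>B s - 16 / 3 * chord_moment R\<bar> \<le> bnd" for s
    proof -
      define M where "M t = 4 / sqrt 3 * Q_real R (circ t + circ s)" for t
      let ?d = "\<lambda>t. norm (- circ s - circ t) powr (-4/5)"
      have [measurable]: "M \<in> borel_measurable borel" unfolding M_def by measurable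
      have iM: "integrable angle_measure (\<lambda>t. (M t)\<^sup>2)"
      proof (rule integrable_bounded_ang[where B="(4 * (4 * R\<^sup>2))\<^sup>2"])
        fix t
        have "1 \<le> sqrt (3::real)" by simp
        then have "4 / sqrt 3 \<le> (4::real)" by (simp add: field_simps)
        then have "\<bar>M t\<bar> \<le> 4 * (4 * R\<^sup>2)"
          unfolding M_def abs_mult by (intro mult_mono Q_real_bound) auto
        from power_mono[OF this, of 2] show "\<bar>(M t)\<^sup>2\<bar> \<le> (4 * (4 * R\<^sup>2))\<^sup>2" by simp
      qed measurable
      have M_int: "(LINT t|angle_measure. (M t)\<^sup>2) = 16 / 3 * chord_moment R"
        unfolding M_def power_mult_distrib by (simp add: integral_Q_real_square power_divide)
      have iK: "integrable angle_measure (\<lambda>t. (K_real R (circ t) (circ s))\<^sup>2)"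
        by (rule integrable_bounded_ang[OF _ K2]) measurable
      have ns: "norm (- circ s) = 1" by simp
      have "B s - 16 / 3 * chord_moment R = (LINT t|angle_measure. (K_real R (circ t) (circ s))\<^sup>2 - (M t)\<^sup>2)"
        unfolding B_def M_int[symmetric] using iK iM by simp
      also have "\<bar>\<dots>\<bar> \<le> (LINT t|angle_measure. \<bar>(K_real R (circ t) (circ s))\<^sup>2 - (M t)\<^sup>2\<bar>)"
        by (rule integral_abs_bound)
      also have "\<dots> \<le> (LINT t|angle_measure. e * (M t)\<^sup>2 + (1 + 1 / e) * (C\<^sup>2 * R\<^sup>2 * ?d t))"
      proof (rule integral_mono_AE')
        show "integrable angle_measure (\<lambda>t. e * (M t)\<^sup>2 + (1 + 1 / e) * (C\<^sup>2 * R\<^sup>2 * ?d t))"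
          by (intro Bochner_Integration.integrable_add Bochner_Integration.integrable_mult_right iM L(2) ns)
        show "AE t in angle_measure. \<bar>(K_real R (circ t) (circ s))\<^sup>2 - (M t)\<^sup>2\<bar> \<le> e * (M t)\<^sup>2 + (1 + 1 / e) * (C\<^sup>2 * R\<^sup>2 * ?d t)"
          using AE_circ_neq[OF ns]
        proof eventually_elim
          fix t assume t: "circ t \<noteq> - circ s"
          then have ne: "circ t + circ s \<noteq> 0" by (metis add_eq_0_iff2)
          define E where "E = K_real R (circ t) (circ s) - M t"
          have "\<bar>E\<bar> \<le> C * R * norm (circ t + circ s) powr (-2/5)"
            unfolding E_def M_def by (rule C(2)[OF R _ _ ne]) simp_all
          then have "\<bar>E\<bar>\<^sup>2 \<le> (C * R * norm (circ t + circ s) powr (-2/5))\<^sup>2"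
            by (intro power_mono) auto
          also have "\<dots> = C\<^sup>2 * R\<^sup>2 * norm (circ t + circ s) powr (-4/5)"
            by (simp add: power_mult_distrib power2_eq_square flip: powr_add)
          also have "norm (circ t + circ s) = norm (- circ s - circ t)"
            by (metis add.commute minus_add_distrib norm_minus_cancel diff_conv_add_uminus)
          finally have E2: "E\<^sup>2 \<le> C\<^sup>2 * R\<^sup>2 * ?d t" by simp
          have "\<bar>(M t + E)\<^sup>2 - (M t)\<^sup>2\<bar> \<le> e * (M t)\<^sup>2 + (1 + 1 / e) * E\<^sup>2"
            by (rule square_perturb[OF e])
          also have "\<dots> \<le> e * (M t)\<^sup>2 + (1 + 1 / e) * (C\<^sup>2 * R\<^sup>2 * ?d t)"
            using e by (intro add_left_mono mult_left_mono E2) auto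
          finally show "\<bar>(K_real R (circ t) (circ s))\<^sup>2 - (M t)\<^sup>2\<bar> \<le> e * (M t)\<^sup>2 + (1 + 1 / e) * (C\<^sup>2 * R\<^sup>2 * ?d t)"
            by (simp add: E_def)
        qed
        show "AE t in angle_measure. 0 \<le> e * (M t)\<^sup>2 + (1 + 1 / e) * (C\<^sup>2 * R\<^sup>2 * ?d t)"
          using e by simp
      qed
      also have "\<dots> = e * (LINT t|angle_measure. (M t)\<^sup>2) + (1 + 1 / e) * (C\<^sup>2 * R\<^sup>2 * (LINT t|angle_measure. ?d t))"
        using iM L(2)[OF ns] by simp
      also have "\<dots> \<le> e * (16 / 3 * chord_moment R) + (1 + 1 / e) * (C\<^sup>2 * R\<^sup>2 * L)"
        using e M_int by (intro add_mono mult_left_mono L(3) ns) auto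
      finally show ?thesis by (simp add: bnd_def D_def mult_ac)
    qed
    have iB: "integrable angle_measure B" by (rule integrable_bounded_ang[OF _ Bb]) measurable
    have "I_real R - 16 / 3 * chord_moment R = (LINT s|angle_measure. B s - 16 / 3 * chord_moment R)"
    proof -
      have "(LINT s|angle_measure. B s - 16 / 3 * chord_moment R) = (LINT s|angle_measure. B s) - (LINT s|angle_measure. 16 / 3 * chord_moment R)"
        by (rule Bochner_Integration.integral_diff[OF iB]) simp
      also have "(LINT s|angle_measure. 16 / 3 * chord_moment R) = 16 / 3 * chord_moment R"
        using A.prob_space by simp
      finally show ?thesis by (simp only: I_real_def B_def)
    qed
    also have "\<bar>\<dots>\<bar> \<le> bnd"
      by (rule integral_bounded_ang[OF _ key]) measurable
    finally show ?thesis by (simp add: bnd_def)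
  qed
  moreover have "0 \<le> D" using L(1) by (simp add: D_def)
  ultimately show ?thesis by blast
qed

text \<open>The choice e = 1 / sqrt R balances the two errors: relative to R^3 the first is of order
  R^(-1/2), and so is (1 + sqrt R) R^2 / R^3.\<close>

lemma I_real_asymp: "((\<lambda>R. I_real R / R ^ 3) \<longlongrightarrow> 256 / 9) at_top"
proof -
  obtain D where D: "0 \<le> D" "\<And>R e. 0 < R \<Longrightarrow> 0 < e \<Longrightarrow>
      \<bar>I_real R - 16 / 3 * chord_moment R\<bar> \<le> e * (16 / 3 * chord_moment R) + (1 + 1 / e) * (D * R\<^sup>2)"
    using I_real_approx by blast
  let ?m = "\<lambda>R. 16 / 3 * (chord_moment R / R ^ 3)"
  have m: "(?m \<longlongrightarrow> 256 / 9) at_top"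
    using tendsto_mult[OF tendsto_const chord_moment_asymp, of "16 / 3"] by simp
  have r: "((\<lambda>R::real. 1 / R) \<longlongrightarrow> 0) at_top" 
    using tendsto_inverse_0_at_top[OF filterlim_ident] by (simp add: inverse_eq_divide)
  have sr: "((\<lambda>R. 1 / sqrt R) \<longlongrightarrow> 0) at_top"
    using tendsto_real_sqrt[OF r] by (simp add: real_sqrt_divide)
  have "((\<lambda>R. 1 / sqrt R * ?m R + (1 / R + 1 / sqrt R) * D) \<longlongrightarrow> 0 * (256 / 9) + (0 + 0) * D) at_top"
    by (intro tendsto_intros m r sr)
  then have b: "((\<lambda>R. 1 / sqrt R * ?m R + (1 / R + 1 / sqrt R) * D) \<longlongrightarrow> 0) at_top" by simp
  have "((\<lambda>R. I_real R / R ^ 3 - ?m R) \<longlongrightarrow> 0) at_top"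
  proof (rule Lim_null_comparison[OF _ b])
    show "\<forall>\<^sub>F R in at_top. norm (I_real R / R ^ 3 - ?m R) \<le> 1 / sqrt R * ?m R + (1 / R + 1 / sqrt R) * D"
      using eventually_gt_at_top[of 0]
    proof eventually_elim
      fix R :: real assume R: "0 < R"
      have "norm (I_real R / R ^ 3 - ?m R) = \<bar>I_real R - 16 / 3 * chord_moment R\<bar> / R ^ 3"
      proof -
        have "I_real R / R ^ 3 - ?m R = (I_real R - 16 / 3 * chord_moment R) / R ^ 3"
          by (simp add: diff_divide_distrib)
        then show ?thesis using R by (simp only: real_norm_def abs_divide) simp
      qed
      also have "\<dots> \<le> (1 / sqrt R * (16 / 3 * chord_moment R) + (1 + 1 / (1 / sqrt R)) * (D * R\<^sup>2)) / R ^ 3"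
        using R by (intro divide_right_mono D(2)) auto
      also have "\<dots> = 1 / sqrt R * ?m R + (1 / R + 1 / sqrt R) * D"
      proof -
        have "R\<^sup>2 / R ^ 3 = 1 / R" using R by (simp add: power2_eq_square power3_eq_cube)
        moreover have "sqrt R * (1 / R) = 1 / sqrt R" using R by (simp add: real_div_sqrt field_simps)
        moreover have "(1 + s) * (D * x) = (x + s * x) * D" for s x
          by (simp add: algebra_simps)
        ultimately have "(1 + sqrt R) * (D * (R\<^sup>2 / R ^ 3)) = (1 / R + 1 / sqrt R) * D"
          by (simp only:)
        then show ?thesis by (simp add: add_divide_distrib)
      qed
      finally show "norm (I_real R / R ^ 3 - ?m R) \<le> 1 / sqrt R * ?m R + (1 / R + 1 / sqrt R) * D" .
    qed
  qed
  from tendsto_add[OF this m] show ?thesis by simp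
qed

theorem theorem4:
  "I_moment \<sim>[at_top] (\<lambda>R. complex_of_real (256 / 9 * R ^ 3))"
proof (rule asymp_equivI')
  have "((\<lambda>R. I_real R / R ^ 3 * (9 / 256)) \<longlongrightarrow> 256 / 9 * (9 / 256)) at_top"
    by (intro tendsto_intros I_real_asymp)
  from tendsto_of_real[OF this]
  have "((\<lambda>R. complex_of_real (I_real R / R ^ 3 * (9 / 256))) \<longlongrightarrow> complex_of_real (256 / 9 * (9 / 256))) at_top" .
  then have "((\<lambda>R. complex_of_real (I_real R / R ^ 3 * (9 / 256))) \<longlongrightarrow> 1) at_top"
    by (rule tendsto_eq_rhs) simp
  then show "((\<lambda>R. I_moment R / complex_of_real (256 / 9 * R ^ 3)) \<longlongrightarrow> 1) at_top"
  proof (rule Lim_transform_eventually)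
    show "\<forall>\<^sub>F R in at_top. complex_of_real (I_real R / R ^ 3 * (9 / 256)) = I_moment R / complex_of_real (256 / 9 * R ^ 3)"
      using eventually_gt_at_top[of 0]
    proof eventually_elim
      fix R :: real assume R: "0 < R"
      have "I_real R / R ^ 3 * (9 / 256) = I_real R / (256 / 9 * R ^ 3)" by simp
      then show "complex_of_real (I_real R / R ^ 3 * (9 / 256)) = I_moment R / complex_of_real (256 / 9 * R ^ 3)"
        unfolding I_moment_eq[OF R] of_real_divide[symmetric] by (simp only:)
    qed
  qed
qed

end
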